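(* Let $m,n\in\mathbb N$ and $f\in\mathbb Z^{m+n}_+$. Then (1) $\mathcal U_f=\sum_{\theta\in\{0,1\}^m}q^{|\theta|}\mathcal K_{\mathbb L_\theta(f)}$; (2) $\mathcal K_f=\sum_{\theta\in\mathbb N^m}(-q)^{|\theta|}\mathcal U_{\mathbb L'_\theta(f)}$.
   Context: Setting: $\mathcal U=U_q(\mathfrak{sl}(\infty))$ over $\mathbb Q(q)$ with generators $E_a,F_a,K_{a,a+1}^{\pm1}$ ($a\in\mathbb Z$), comultiplication $\Delta(E_a)=1\otimes E_a+E_a\otimes K_{a,a+1}^{-1}$, $\Delta(F_a)=F_a\otimes1+K_{a,a+1}\otimes F_a$, bar map $\bar q=q^{-1}$ fixing $E_a,F_a$, inverting $K_{a,a+1}$. $\Lambda^k\mathbb V$ has basis $v_{a_1}\wedge\cdots\wedge v_{a_k}$ ($a_1>\cdots>a_k$), where for index set $S$: $F_a$ replaces $a$ by $a+1$ if $a\in S,a+1\notin S$ (else $0$), $E_a$ replaces $a+1$ by $a$ if $a+1\in S,a\notin S$ (else $0$), $K_{a,a+1}$ acts by $q^{[a\in S]-[a+1\in S]}$. $I(m|n)=\{-m,\dots,-1\}\cup\{1,\dots,n\}$; $\mathbb Z^{m+n}_+=\{f:I(m|n)\to\mathbb Z\mid f(-m)>\cdots>f(-1),\ f(1)>\cdots>f(n)\}$. $\mathcal E^{m+n}=\Lambda^m\mathbb V\otimes\Lambda^n\mathbb V$ with basis $\mathcal K_f=v_{f(-m)}\wedge\cdots\wedge v_{f(-1)}\otimes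 v_{f(1)}\wedge\cdots\wedge v_{f(n)}$. Bruhat ordering: transitive closure of $f<f\cdot\tau_{ij}$ for $i<j$ with $f(i)<f(j)$ ($(f\cdot\tau)(k)=f(\tau(k))$). Bar involution: the unique anti-linear involution on $\mathcal E^{m+n}$ fixing $\mathcal K_f$ for Bruhat-minimal $f\in\mathbb Z^{m+n}_+$, with $\overline{Xu}=\bar X\bar u$ and $\overline{\mathcal K_f}\in\mathcal K_f+\sum_{g<f}\mathbb Z[q,q^{-1}]\mathcal K_g$. $\mathcal U_f$ is the unique bar-invariant element of $\mathcal K_f+\sum_{g<f}q\mathbb Z[q]\mathcal K_g$. Pairs and operators: for $f\in\mathbb Z^{m+n}$ injective on negative and on positive indices, $(i|j)$ ($i<0<j$) is an atypical pair if $f(i)>f(j)$, $f(i)\notin\{f(k):k>0\}$, $f(j)\notin\{f(l):l<0\}$, with distance $f(i)-f(j)$; $\Sigma^k_f$ is the set of atypical pairs of distance $k$ sharing no entry with any pair in $\Sigma^1_f\cup\dots\cup\Sigma^{k-1}_f$; $\Sigma^+_f=\bigcup_k\Sigma^k_f$. For $-m\le i\le-1$, $\mathbb L_i(f)=f\cdot\tau_{ij}$ if $(i|j)\in\Sigma^+_f$ for some $j$, and $\mathbb L_i(f)=\emptyset$ otherwise; operators applied to $\emptyset$ give $\emptyset$. $f^+$ denotes the element of $\mathbb Z^{m+n}_+$ obtained by sorting values at negative positions decreasingly and at positive positions decreasingly, $\emptyset^+=\emptyset$, and $\mathcal K_\emptyset=\mathcal U_\emptyset=0$. For $\theta=(\theta_{-m},\dots,\theta_{-1})\in\mathbb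 N^m$, $|\theta|=\sum\theta_i$, $\mathbb L_\theta(f)=(\mathbb L_{-1}^{\theta_{-1}}\circ\mathbb L_{-2}^{\theta_{-2}}\circ\cdots\circ\mathbb L_{-m}^{\theta_{-m}}(f))^+$ and $\mathbb L'_\theta(f)=(\mathbb L_{-m}^{\theta_{-m}}\circ\cdots\circ\mathbb L_{-1}^{\theta_{-1}}(f))^+$. *)

theory Defs
  imports "HOL-Computational_Algebra.Computational_Algebra" "HOL-Computational_Algebra.Field_as_Ring" "HOL-Library.Function_Algebras"
begin

type_synonym Qq = "rat poly fract"

definition qq :: Qq where "qq = Fract [:0, 1:] 1"

definition qpow :: "int \<Rightarrow> Qq" where "qpow k = qq powi k"

text \<open>bar map q -> q^{-1}: a(q)/b(q) is sent to a(1/q)/b(1/q), using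
  p(1/q) = q^{-deg p} * reflect_poly p.\<close>
definition bar_q :: "Qq \<Rightarrow> Qq" where
  "bar_q x = (case quot_of_fract x of (a, b) \<Rightarrow>
      Fract (reflect_poly a * monom 1 (degree b)) (reflect_poly b * monom 1 (degree a)))"

definition laurent :: "Qq \<Rightarrow> bool" where
  "laurent x \<longleftrightarrow> (\<exists>(p::int poly) (k::nat). x = Fract (map_poly of_int p) (monom 1 k))"

definition qZq :: "Qq \<Rightarrow> bool" where
  "qZq x \<longleftrightarrow> (\<exists>p::int poly. coeff p 0 = 0 \<and> x = Fract (map_poly of_int p) 1)"

definition negpos :: "nat \<Rightarrow> int set" where "negpos m = {- int m .. -1}"
definition pospos :: "nat \<Rightarrow> int set" where "pospos n = {1 .. int n}"
definition Iset :: "nat \<Rightarrow> nat \<Rightarrow> int set" where "Iset m n = negpos m \<union> pospos n"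

definition Zplus :: "nat \<Rightarrow> nat \<Rightarrow> (int \<Rightarrow> int) set" where
  "Zplus m n = {f. (\<forall>k. k \<notin> Iset m n \<longrightarrow> f k = 0)
      \<and> (\<forall>i\<in>negpos m. \<forall>i'\<in>negpos m. i < i' \<longrightarrow> f i > f i')
      \<and> (\<forall>j\<in>pospos n. \<forall>j'\<in>pospos n. j < j' \<longrightarrow> f j > f j')}"

section \<open>The space E^{m+n} = Lambda^m V (x) Lambda^n V\<close>

text \<open>A vector is a finitely supported family of coefficients of the basis
  K_f, f in Z^{m+n}_+.\<close>
type_synonym vecE = "(int \<Rightarrow> int) \<Rightarrow> Qq"

definition is_vec :: "nat \<Rightarrow> nat \<Rightarrow> vecE \<Rightarrow> bool" where
  "is_vec m n u \<longleftrightarrow> finite {g. u g \<noteq> 0} \<and> {g. u g \<noteq> 0} \<subseteq> Zplus m n"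

definition basisK :: "(int \<Rightarrow> int) \<Rightarrow> vecE" where
  "basisK f = (\<lambda>g. if g = f then 1 else 0)"

definition scal :: "Qq \<Rightarrow> vecE \<Rightarrow> vecE" where
  "scal c u = (\<lambda>g. c * u g)"

definition lin_ext :: "((int \<Rightarrow> int) \<Rightarrow> vecE) \<Rightarrow> vecE \<Rightarrow> vecE" where
  "lin_ext B u = (\<lambda>g. \<Sum>f\<in>{f. u f \<noteq> 0}. u f * B f g)"

definition ind :: "int \<Rightarrow> int set \<Rightarrow> int" where
  "ind a S = (if a \<in> S then 1 else 0)"

text \<open>Weight of K_{a,a+1} on v_S: q^([a in S] - [a+1 in S]).\<close>
definition wt :: "int \<Rightarrow> int set \<Rightarrow> int" where
  "wt a S = ind a S - ind (a + 1) S"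

text \<open>Action of E_a via Delta(E_a) = 1 (x) E_a + E_a (x) K_{a,a+1}^{-1}.\<close>
definition Ebasis :: "nat \<Rightarrow> nat \<Rightarrow> int \<Rightarrow> (int \<Rightarrow> int) \<Rightarrow> vecE" where
  "Ebasis m n a f =
     (\<Sum>k\<in>pospos n. if f k = a + 1 \<and> a \<notin> f ` pospos n then basisK (f(k := a)) else 0)
   + (\<Sum>k\<in>negpos m. if f k = a + 1 \<and> a \<notin> f ` negpos m
        then scal (qpow (- wt a (f ` pospos n))) (basisK (f(k := a))) else 0)"

text \<open>Action of F_a via Delta(F_a) = F_a (x) 1 + K_{a,a+1} (x) F_a.\<close>
definition Fbasis :: "nat \<Rightarrow> nat \<Rightarrow> int \<Rightarrow> (int \<Rightarrow> int) \<Rightarrow> vecE" where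
  "Fbasis m n a f =
     (\<Sum>k\<in>negpos m. if f k = a \<and> a + 1 \<notin> f ` negpos m then basisK (f(k := a + 1)) else 0)
   + (\<Sum>k\<in>pospos n. if f k = a \<and> a + 1 \<notin> f ` pospos n
        then scal (qpow (wt a (f ` negpos m))) (basisK (f(k := a + 1))) else 0)"

text \<open>Action of K_{a,a+1} via K (x) K.\<close>
definition Kbasis :: "nat \<Rightarrow> nat \<Rightarrow> int \<Rightarrow> (int \<Rightarrow> int) \<Rightarrow> vecE" where
  "Kbasis m n a f = scal (qpow (wt a (f ` negpos m) + wt a (f ` pospos n))) (basisK f)"

definition Kinvbasis :: "nat \<Rightarrow> nat \<Rightarrow> int \<Rightarrow> (int \<Rightarrow> int) \<Rightarrow> vecE" where
  "Kinvbasis m n a f = scal (qpow (- (wt a (f ` negpos m) + wt a (f ` pospos n)))) (basisK f)"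

definition Eact where "Eact m n a = lin_ext (Ebasis m n a)"
definition Fact where "Fact m n a = lin_ext (Fbasis m n a)"
definition Kact where "Kact m n a = lin_ext (Kbasis m n a)"
definition Kinvact where "Kinvact m n a = lin_ext (Kinvbasis m n a)"

definition bstep :: "nat \<Rightarrow> nat \<Rightarrow> (int \<Rightarrow> int) \<Rightarrow> (int \<Rightarrow> int) \<Rightarrow> bool" where
  "bstep m n f g \<longleftrightarrow> (\<exists>i\<in>Iset m n. \<exists>j\<in>Iset m n. i < j \<and> f i < f j \<and> g = f(i := f j, j := f i))"

definition bless :: "nat \<Rightarrow> nat \<Rightarrow> (int \<Rightarrow> int) \<Rightarrow> (int \<Rightarrow> int) \<Rightarrow> bool" where
  "bless m n = tranclp (bstep m n)"

definition bruhat_minimal :: "nat \<Rightarrow> nat \<Rightarrow> (int \<Rightarrow> int) \<Rightarrow> bool" where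
  "bruhat_minimal m n f \<longleftrightarrow> f \<in> Zplus m n \<and> \<not> (\<exists>g\<in>Zplus m n. bless m n g f)"

definition is_bar_inv :: "nat \<Rightarrow> nat \<Rightarrow> (vecE \<Rightarrow> vecE) \<Rightarrow> bool" where
  "is_bar_inv m n \<psi> \<longleftrightarrow>
     (\<forall>u. \<not> is_vec m n u \<longrightarrow> \<psi> u = 0)
   \<and> (\<forall>u. is_vec m n u \<longrightarrow> is_vec m n (\<psi> u))
   \<and> (\<forall>u v. is_vec m n u \<longrightarrow> is_vec m n v \<longrightarrow> \<psi> (u + v) = \<psi> u + \<psi> v)
   \<and> (\<forall>c u. is_vec m n u \<longrightarrow> \<psi> (scal c u) = scal (bar_q c) (\<psi> u))
   \<and> (\<forall>u. is_vec m n u \<longrightarrow> \<psi> (\<psi> u) = u)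
   \<and> (\<forall>a u. is_vec m n u \<longrightarrow> \<psi> (Eact m n a u) = Eact m n a (\<psi> u))
   \<and> (\<forall>a u. is_vec m n u \<longrightarrow> \<psi> (Fact m n a u) = Fact m n a (\<psi> u))
   \<and> (\<forall>a u. is_vec m n u \<longrightarrow> \<psi> (Kact m n a u) = Kinvact m n a (\<psi> u))
   \<and> (\<forall>f. bruhat_minimal m n f \<longrightarrow> \<psi> (basisK f) = basisK f)
   \<and> (\<forall>f\<in>Zplus m n. \<forall>g. laurent ((\<psi> (basisK f) - basisK f) g)
        \<and> ((\<psi> (basisK f) - basisK f) g \<noteq> 0 \<longrightarrow> g \<in> Zplus m n \<and> bless m n g f))"

definition bar_inv :: "nat \<Rightarrow> nat \<Rightarrow> vecE \<Rightarrow> vecE" where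
  "bar_inv m n = (THE \<psi>. is_bar_inv m n \<psi>)"

definition Ucan :: "nat \<Rightarrow> nat \<Rightarrow> (int \<Rightarrow> int) \<Rightarrow> vecE" where
  "Ucan m n f = (THE u. is_vec m n u \<and> bar_inv m n u = u \<and> u f = 1
      \<and> (\<forall>g. g \<noteq> f \<longrightarrow> qZq (u g) \<and> (u g \<noteq> 0 \<longrightarrow> bless m n g f)))"

definition Kopt :: "(int \<Rightarrow> int) option \<Rightarrow> vecE" where
  "Kopt x = (case x of None \<Rightarrow> 0 | Some f \<Rightarrow> basisK f)"

definition Uopt :: "nat \<Rightarrow> nat \<Rightarrow> (int \<Rightarrow> int) option \<Rightarrow> vecE" where
  "Uopt m n x = (case x of None \<Rightarrow> 0 | Some f \<Rightarrow> Ucan m n f)"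

definition atyp :: "nat \<Rightarrow> nat \<Rightarrow> (int \<Rightarrow> int) \<Rightarrow> int \<Rightarrow> int \<Rightarrow> bool" where
  "atyp m n f i j \<longleftrightarrow> i \<in> negpos m \<and> j \<in> pospos n \<and> f i > f j
      \<and> f i \<notin> f ` pospos n \<and> f j \<notin> f ` negpos m"

fun sigma_upto :: "nat \<Rightarrow> nat \<Rightarrow> (int \<Rightarrow> int) \<Rightarrow> nat \<Rightarrow> (int \<times> int) set" where
  "sigma_upto m n f 0 = {}"
| "sigma_upto m n f (Suc k) = sigma_upto m n f k \<union>
     {(i, j). atyp m n f i j \<and> f i - f j = int (Suc k)
        \<and> (\<forall>(i', j')\<in>sigma_upto m n f k. i' \<noteq> i \<and> j' \<noteq> j)}"

definition sigma_plus :: "nat \<Rightarrow> nat \<Rightarrow> (int \<Rightarrow> int) \<Rightarrow> (int \<times> int) set" where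
  "sigma_plus m n f = (\<Union>k. sigma_upto m n f k)"

definition Lop :: "nat \<Rightarrow> nat \<Rightarrow> int \<Rightarrow> (int \<Rightarrow> int) option \<Rightarrow> (int \<Rightarrow> int) option" where
  "Lop m n i x = (case x of None \<Rightarrow> None | Some f \<Rightarrow>
     (if \<exists>j. (i, j) \<in> sigma_plus m n f
      then (let j = (THE j. (i, j) \<in> sigma_plus m n f) in Some (f(i := f j, j := f i)))
      else None))"

definition plus_sort :: "nat \<Rightarrow> nat \<Rightarrow> (int \<Rightarrow> int) option \<Rightarrow> (int \<Rightarrow> int) option" where
  "plus_sort m n x = (case x of None \<Rightarrow> None | Some f \<Rightarrow>
     Some (THE g. g \<in> Zplus m n \<and> g ` negpos m = f ` negpos m \<and> g ` pospos n = f ` pospos n))"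

definition Theta :: "nat \<Rightarrow> (int \<Rightarrow> nat) set" where
  "Theta m = {\<theta>. \<forall>i. i \<notin> negpos m \<longrightarrow> \<theta> i = 0}"

definition Theta01 :: "nat \<Rightarrow> (int \<Rightarrow> nat) set" where
  "Theta01 m = {\<theta>\<in>Theta m. \<forall>i. \<theta> i \<le> 1}"

definition theta_abs :: "nat \<Rightarrow> (int \<Rightarrow> nat) \<Rightarrow> nat" where
  "theta_abs m \<theta> = (\<Sum>i\<in>negpos m. \<theta> i)"

definition Ltheta :: "nat \<Rightarrow> nat \<Rightarrow> (int \<Rightarrow> nat) \<Rightarrow> (int \<Rightarrow> int) \<Rightarrow> (int \<Rightarrow> int) option" where
  "Ltheta m n \<theta> f = plus_sort m n
     (fold (\<lambda>i x. (Lop m n i ^^ \<theta> i) x) [- int m .. -1] (Some f))"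

definition Ltheta' :: "nat \<Rightarrow> nat \<Rightarrow> (int \<Rightarrow> nat) \<Rightarrow> (int \<Rightarrow> int) \<Rightarrow> (int \<Rightarrow> int) option" where
  "Ltheta' m n \<theta> f = plus_sort m n
     (fold (\<lambda>i x. (Lop m n i ^^ \<theta> i) x) (rev [- int m .. -1]) (Some f))"

end

theory Submission
  imports Defs
begin

text \<open>
  A weight \<open>f\<close> is recorded by labelling every integer with the sides (left, right, both, neither) on
  which it occurs as a value. Reading \<open>Rgt\<close> as an opening and \<open>Lft\<close> as a closing parenthesis, matching
  gives a system of arcs, which is \<open>\<Sigma>\<^sup>+\<close> of \<open>f\<close>. Let \<open>u(f)\<close> be the sum over all sets \<open>S\<close> of arcs of
  \<open>q^|S|\<close> times the basis vector obtained by exchanging the labels at the ends of the arcs in \<open>S\<close>.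
  The operators \<open>F\<^sub>a\<close> and \<open>E\<^sub>a\<close> only see the labels at \<open>a\<close> and \<open>a + 1\<close>: they create an arc, move an
  end of an arc across an unlabelled point, or join two arcs, and thus send \<open>u(f)\<close> to a multiple of
  some \<open>u(g)\<close> by \<open>0\<close>, \<open>1\<close> or \<open>q + 1/q\<close>. Hence the antilinear map that fixes all \<open>u(f)\<close> is a bar
  involution. It is the only one, since every \<open>u(f)\<close> arises from Bruhat-minimal basis vectors by
  creating and moving arcs. So \<open>u(f)\<close> is the canonical basis. Both formulas result from expanding
  the arcs of one position \<open>i\<close> at a time, \<open>W\<^sub>i(f) = W\<^sub>i\<^sub>+\<^sub>1(f) + q W\<^sub>i\<^sub>+\<^sub>1(L\<^sub>i(f))\<close>, where \<open>W\<^sub>i\<close> expands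
  the positions \<open>\<ge> i\<close>: the first one by iterating this identity, the second one by solving it for
  \<open>W\<^sub>i\<^sub>+\<^sub>1\<close>.
\<close>

section \<open>The bar map on rational functions\<close>

text \<open>Behind bar-invariance stand zigzag relations: where an operator joins two arcs, the 1/q
  in its coefficient cancels the q of an exchanged arc, and q + 1/q is the value of a closed loop.
  Labels forget positions. For the canonical basis nothing is lost, as a sorted weight is determined
  by its labels; but the operators \<open>L_i\<close> leave the sorted weights, so the link between
  \<Sigma> and arcs assumes mere injectivity on each side. The obstacle lies in the identity for
  \<open>W_i\<close>: exchanging the ends of an arc disturbs the arcs that enclose it, so no later
  position may carry the closing end of such an arc, nor an unmatched \<open>Lft\<close> further
  right. For the first formula this is automatic, since later positions carry smaller values. For
  the second, \<open>L_i\<close> is repeated at one position, whose value may fall below later ones;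
  the invariant \<open>Cnd\<close> records that arcs ending there then begin to the right of the
  current value. The repetition stops because the value at i runs down through the finitely many
  labelled points.\<close>

definition evq :: "rat poly \<Rightarrow> Qq \<Rightarrow> Qq" where
  "evq p x = poly (map_poly (\<lambda>c. to_fract [:c:]) p) x"

lemma evq_0 [simp]: "evq 0 x = 0"
  by (simp add: evq_def)

lemma evq_pCons: "evq (pCons a p) x = to_fract [:a:] + x * evq p x"
  by (simp add: evq_def map_poly_pCons)

lemma evq_1 [simp]: "evq 1 x = 1"
  by (simp add: evq_def map_poly_1 flip: one_pCons)

lemma evq_add: "evq (p + r) x = evq p x + evq r x"
proof (induction p r rule: poly_induct2)
  case (pCons a p b r)
  have "to_fract [:a + b:] = to_fract [:a:] + to_fract [:b:]"
    by (simp flip: to_fract_add)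
  with pCons show ?case by (simp add: evq_pCons algebra_simps)
qed auto

lemma evq_smult: "evq (smult c p) x = to_fract [:c:] * evq p x"
proof (induction p)
  case (pCons a p)
  have "to_fract [:c * a:] = to_fract [:c:] * to_fract [:a:]"
    by (simp flip: to_fract_mult)
  with pCons show ?case by (simp add: evq_pCons algebra_simps)
qed auto

lemma evq_mult: "evq (p * r) x = evq p x * evq r x"
proof (induction p)
  case (pCons a p)
  then show ?case
    by (simp add: evq_pCons evq_add evq_smult algebra_simps)
qed auto

lemma qq_eq: "qq = to_fract [:0, 1:]"
  by (simp add: qq_def to_fract_def)

lemma qq_nonzero [simp]: "qq \<noteq> 0"
  by (simp add: qq_eq)

lemma evq_qq: "evq p qq = to_fract p"
proof (induction p)
  case (pCons a p)
  have "to_fract (pCons a p) = to_fract ([:a:] + [:0, 1:] * p)" by simp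
  also have "\<dots> = to_fract [:a:] + qq * to_fract p"
    by (simp only: to_fract_add to_fract_mult qq_eq)
  finally show ?case using pCons by (simp add: evq_pCons)
qed auto

lemma map_poly_reflect:
  "map_poly (\<lambda>c. to_fract [:c:]) (reflect_poly p) = reflect_poly (map_poly (\<lambda>c. to_fract [:c :: rat:]) p)"
proof -
  have [simp]: "degree (map_poly (\<lambda>c. to_fract [:c:]) p) = degree p"
    by (rule degree_map_poly) auto
  show ?thesis
    by (rule poly_eqI) (auto simp: coeff_map_poly coeff_reflect_poly)
qed

lemma evq_reflect:
  assumes "x \<noteq> 0"
  shows "evq (reflect_poly p) x = x ^ degree p * evq p (inverse x)"
proof -
  have "degree (map_poly (\<lambda>c. to_fract [:c:]) p) = degree p"
    by (rule degree_map_poly) auto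
  then show ?thesis
    unfolding evq_def map_poly_reflect using poly_reflect_poly_nz[OF assms] by metis
qed

lemma evq_inverse_nonzero:
  assumes "p \<noteq> 0"
  shows "evq p (inverse qq) \<noteq> 0"
  using evq_reflect[of qq p] assms by (auto simp: evq_qq)

lemma to_fract_monom: "to_fract (monom 1 k) = qq ^ k"
proof (induction k)
  case (Suc k)
  have "monom 1 (Suc k) = [:0, 1:] * (monom 1 k :: rat poly)" by (simp add: monom_Suc)
  then have "to_fract (monom 1 (Suc k)) = qq * to_fract (monom (1 :: rat) k)"
    unfolding qq_eq by (simp only: to_fract_mult)
  then show ?case using Suc by simp
qed (simp add: monom_0 flip: one_pCons)

text \<open>\<open>bar_q\<close> is defined through the normalised quotient. Cross-multiplication
  shows that every representative gives the same result, namely evaluation at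
  \<open>inverse qq\<close>; additivity and multiplicativity then come from
  \<open>evq\<close>.\<close>

lemma bar_q_Fract:
  assumes "b \<noteq> 0"
  shows "bar_q (Fract a b) = evq a (inverse qq) / evq b (inverse qq)"
proof -
  obtain a' b' where ab: "quot_of_fract (Fract a b) = (a', b')" by fastforce
  have b': "b' \<noteq> 0"
    using snd_quot_of_fract_nonzero[of "Fract a b"] ab by simp
  have "Fract a' b' = Fract a b"
    using Fract_quot_of_fract[of "Fract a b"] ab by simp
  then have "a' * b = a * b'" using b' assms by (simp add: eq_fract)
  then have eq: "evq a' (inverse qq) * evq b (inverse qq) = evq a (inverse qq) * evq b' (inverse qq)"
    by (metis evq_mult)
  have "bar_q (Fract a b) = Fract (reflect_poly a' * monom 1 (degree b')) (reflect_poly b' * monom 1 (degree a'))"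
    by (simp add: bar_q_def ab)
  also have "\<dots> = to_fract (reflect_poly a' * monom 1 (degree b')) / to_fract (reflect_poly b' * monom 1 (degree a'))"
    using b' by (simp add: Fract_conv_to_fract)
  also have "\<dots> = evq a' (inverse qq) / evq b' (inverse qq)"
    by (simp add: to_fract_monom) (simp add: evq_reflect flip: evq_qq)
  also have "\<dots> = evq a (inverse qq) / evq b (inverse qq)"
    using eq evq_inverse_nonzero[OF assms] evq_inverse_nonzero[OF b'] by (simp add: field_simps)
  finally show ?thesis .
qed

lemma bar_q_add: "bar_q (x + y) = bar_q x + bar_q y"
proof (cases x, cases y)
  fix a b c d assume "x = Fract a b" "b \<noteq> 0" "y = Fract c d" "d \<noteq> 0"
  then show ?thesis
    using evq_inverse_nonzero[of b] evq_inverse_nonzero[of d]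
    by (simp add: bar_q_Fract evq_add evq_mult field_simps)
qed

lemma bar_q_mult: "bar_q (x * y) = bar_q x * bar_q y"
proof (cases x, cases y)
  fix a b c d assume "x = Fract a b" "b \<noteq> 0" "y = Fract c d" "d \<noteq> 0"
  then show ?thesis
    by (simp add: bar_q_Fract evq_mult)
qed

lemma bar_q_to_fract: "bar_q (to_fract p) = evq p (inverse qq)"
  by (simp add: to_fract_def bar_q_Fract)

lemma bar_q_0 [simp]: "bar_q 0 = 0"
  using bar_q_to_fract[of 0] by simp

lemma bar_q_1 [simp]: "bar_q 1 = 1"
  using bar_q_to_fract[of 1] by simp

lemma bar_q_uminus: "bar_q (- x) = - bar_q x"
  using bar_q_add[of x "- x"] by (simp add: eq_neg_iff_add_eq_0 add.commute)

lemma bar_q_inverse: "bar_q (inverse x) = inverse (bar_q x)"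
proof (cases "x = 0")
  case False
  then have "bar_q x * bar_q (inverse x) = 1" by (simp flip: bar_q_mult)
  then show ?thesis by (simp add: inverse_unique)
qed simp

lemma bar_q_qq [simp]: "bar_q qq = inverse qq"
  unfolding qq_eq bar_q_to_fract by (simp add: evq_pCons flip: qq_eq one_pCons)

lemma bar_q_power: "bar_q (x ^ k) = bar_q x ^ k"
  by (induction k) (simp_all add: bar_q_mult)

lemma bar_q_const: "bar_q (to_fract [:c:]) = to_fract [:c:]"
  by (simp add: bar_q_to_fract evq_pCons)

lemma bar_q_evq: "bar_q (evq p x) = evq p (bar_q x)"
  by (induction p) (simp_all add: evq_pCons bar_q_add bar_q_mult bar_q_const)

text \<open>By \<open>bar_q_evq\<close> the bar map moves only the point of evaluation, here from
  \<open>inverse qq\<close> back to \<open>qq\<close>, where \<open>evq\<close> is the embedding of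
  polynomials.\<close>

lemma bar_q_bar_q [simp]: "bar_q (bar_q x) = x"
proof (cases x)
  case (Fract a b)
  then show ?thesis
    by (simp add: bar_q_Fract divide_inverse bar_q_mult bar_q_inverse bar_q_evq evq_qq
        flip: Fract_conv_to_fract)
      (simp add: Fract_conv_to_fract divide_inverse)
qed

lemma bar_q_qpow: "bar_q (qpow k) = qpow (- k)"
  by (simp add: qpow_def power_int_def bar_q_power bar_q_inverse)

section \<open>Membership in q Z[q] and in the Laurent polynomials Z[q, 1/q]\<close>

lemma qZq_qq_power: "k > 0 \<Longrightarrow> qZq (qq ^ k)"
  unfolding qZq_def
  by (rule exI[of _ "monom 1 k"])
     (simp add: map_poly_monom to_fract_monom flip: to_fract_def)

lemma qZq_0 [simp]: "qZq 0"
  unfolding qZq_def by (rule exI[of _ 0]) (simp flip: to_fract_def)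

lemma of_int_poly_diff:
  "map_poly of_int (p - r) = (map_poly of_int p - map_poly of_int r :: 'a :: ring_1 poly)"
  by (rule poly_eqI) (simp add: coeff_map_poly)

lemma of_int_poly_add:
  "map_poly of_int (p + r) = (map_poly of_int p + map_poly of_int r :: 'a :: ring_1 poly)"
  by (rule poly_eqI) (simp add: coeff_map_poly)

lemma of_int_poly_mult:
  "map_poly of_int (p * r) = (map_poly of_int p * map_poly of_int r :: 'a :: comm_ring_1 poly)"
  by (rule poly_eqI) (simp add: coeff_map_poly coeff_mult)

lemma qZq_diff: "qZq x \<Longrightarrow> qZq y \<Longrightarrow> qZq (x - y)"
  unfolding qZq_def to_fract_def[symmetric]
  by (metis of_int_poly_diff coeff_diff diff_self to_fract_diff)

text \<open>Invariance of a polynomial r says that reversing its coefficients multiplies it by q^deg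
  r. The constant term of the reversed polynomial is the leading coefficient, that of the product is
  0. This is the source of uniqueness for the canonical basis.\<close>

lemma bar_invariant_qZq:
  assumes "qZq x" "bar_q x = x"
  shows "x = 0"
proof (rule ccontr)
  assume "x \<noteq> 0"
  obtain p :: "int poly" where p: "coeff p 0 = 0" "x = to_fract (map_poly of_int p)"
    using assms(1) unfolding qZq_def to_fract_def by blast
  define r where "r = (map_poly of_int p :: rat poly)"
  have r: "coeff r 0 = 0" "x = to_fract r" using p by (auto simp: r_def coeff_map_poly)
  have "r \<noteq> 0" using \<open>x \<noteq> 0\<close> r by auto
  have "to_fract (reflect_poly r) = qq ^ degree r * bar_q x"
    unfolding r(2) bar_q_to_fract by (simp add: evq_reflect flip: evq_qq)
  also have "\<dots> = to_fract (monom 1 (degree r) * r)"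
    using assms(2) r(2) by (simp add: to_fract_mult to_fract_monom)
  finally have "reflect_poly r = monom 1 (degree r) * r" by (simp only: to_fract_eq_iff)
  then have "coeff (reflect_poly r) 0 = coeff (monom 1 (degree r) * r) 0" by simp
  then have "lead_coeff r = 0" using r(1) by (simp add: coeff_mult)
  then show False using \<open>r \<noteq> 0\<close> by simp
qed

text \<open>With the denominator cleared, closure under sums and products is a computation with
  embedded integer polynomials.\<close>

lemma laurent_iff: "laurent x \<longleftrightarrow> (\<exists>(p::int poly) k. x * qq ^ k = to_fract (map_poly of_int p))"
proof -
  have "x = Fract (map_poly of_int p) (monom 1 k) \<longleftrightarrow> x * qq ^ k = to_fract (map_poly of_int p)"
    for p :: "int poly" and k
    by (simp add: Fract_conv_to_fract to_fract_monom field_simps)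
  then show ?thesis unfolding laurent_def by blast
qed

lemma laurent_mult:
  assumes "laurent x" "laurent y"
  shows "laurent (x * y)"
proof -
  obtain p k where 1: "x * qq ^ k = to_fract (map_poly of_int (p :: int poly))"
    using assms(1) laurent_iff by blast
  obtain r l where 2: "y * qq ^ l = to_fract (map_poly of_int (r :: int poly))"
    using assms(2) laurent_iff by blast
  have "x * y * qq ^ (k + l) = (x * qq ^ k) * (y * qq ^ l)" by (simp add: power_add)
  also have "\<dots> = to_fract (map_poly of_int (p * r))"
    by (simp only: 1 2 of_int_poly_mult to_fract_mult)
  finally show ?thesis unfolding laurent_iff by blast
qed

lemma laurent_qq_power: "laurent (qq ^ k)"
  unfolding laurent_iff
  by (rule exI[of _ "monom 1 k"], rule exI[of _ 0]) (simp add: map_poly_monom to_fract_monom)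

lemma laurent_inverse_qq_power: "laurent (inverse qq ^ k)"
  unfolding laurent_iff
  by (rule exI[of _ 1], rule exI[of _ k]) (simp flip: power_mult_distrib)

lemma laurent_0 [simp]: "laurent 0"
  unfolding laurent_iff by (rule exI[of _ 0]) simp

lemma laurent_1 [simp]: "laurent 1"
  using laurent_qq_power[of 0] by simp

lemma laurent_add:
  assumes "laurent x" "laurent y"
  shows "laurent (x + y)"
proof -
  obtain p k where 1: "x * qq ^ k = to_fract (map_poly of_int (p :: int poly))"
    using assms(1) laurent_iff by blast
  obtain r l where 2: "y * qq ^ l = to_fract (map_poly of_int (r :: int poly))"
    using assms(2) laurent_iff by blast
  have m: "to_fract (map_poly of_int (monom (1 :: int) j)) = qq ^ j" for j
    by (simp add: map_poly_monom to_fract_monom)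
  have "(x + y) * qq ^ (k + l) = (x * qq ^ k) * qq ^ l + (y * qq ^ l) * qq ^ k"
    by (simp add: power_add algebra_simps)
  also have "\<dots> = to_fract (map_poly of_int (p * monom 1 l + r * monom 1 k))"
    by (simp only: 1 2 of_int_poly_mult of_int_poly_add to_fract_mult to_fract_add m)
  finally show ?thesis unfolding laurent_iff by blast
qed

lemma laurent_uminus:
  assumes "laurent x"
  shows "laurent (- x)"
proof -
  have "map_poly of_int (- 1 :: int poly) = (- 1 :: rat poly)"
    using of_int_poly_diff[of 0 1, where ?'a = rat] by simp
  then have "- 1 * qq ^ 0 = to_fract (map_poly of_int (- 1 :: int poly))"
    by simp
  then have "laurent (- 1)" unfolding laurent_iff by blast
  then show ?thesis using laurent_mult[OF _ assms, of "- 1"] by simp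
qed

lemma laurent_sum: "(\<And>i. i \<in> A \<Longrightarrow> laurent (f i)) \<Longrightarrow> laurent (sum f A)"
  by (induction A rule: infinite_finite_induct) (simp_all add: laurent_add)

section \<open>Arcs\<close>

datatype label = Lft | Rgt | Cross | Circ

definition labelled :: "(int \<Rightarrow> label) \<Rightarrow> int \<Rightarrow> bool" where
  "labelled s v \<longleftrightarrow> s v = Lft \<or> s v = Rgt"

text \<open>Parenthesis matching without counting depths: a pair may be joined once every labelled
  point under it is matched under it. The recursion refers only to arcs strictly inside, so
  induction on the length is available throughout.\<close>

inductive arc :: "(int \<Rightarrow> label) \<Rightarrow> int \<Rightarrow> int \<Rightarrow> bool" for s where
  arcI: "a < b \<Longrightarrow> s a = Rgt \<Longrightarrow> s b = Lft \<Longrightarrow>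
    (\<And>c. a < c \<Longrightarrow> c < b \<Longrightarrow> labelled s c \<Longrightarrow> \<exists>d. a < d \<and> d < b \<and> (arc s c d \<or> arc s d c)) \<Longrightarrow>
    arc s a b"

definition partner :: "(int \<Rightarrow> label) \<Rightarrow> int \<Rightarrow> int \<Rightarrow> bool" where
  "partner s v w \<longleftrightarrow> arc s v w \<or> arc s w v"

definition matched :: "(int \<Rightarrow> label) \<Rightarrow> int \<Rightarrow> bool" where
  "matched s v \<longleftrightarrow> (\<exists>w. partner s v w)"

lemma arcD:
  assumes "arc s a b"
  shows "a < b" "s a = Rgt" "s b = Lft"
  using assms by (auto elim: arc.cases)

lemma arc_inside:
  assumes "arc s a b" "a < c" "c < b" "labelled s c"
  shows "\<exists>d. a < d \<and> d < b \<and> partner s c d"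
  using assms by (auto elim!: arc.cases simp: partner_def)

lemma partner_sym: "partner s v w \<longleftrightarrow> partner s w v"
  by (auto simp: partner_def)

text \<open>If two arcs share an end, the nearer of their other ends lies under the longer arc and
  has a partner there. This yields a shorter pair of arcs sharing an end on the opposite side, so
  both sides go through one induction on the length.\<close>

lemma arc_unique_aux:
  "nat (d - a) = k \<Longrightarrow> (arc s a b \<longrightarrow> arc s a d \<longrightarrow> a < b \<longrightarrow> b < d \<longrightarrow> False)
    \<and> (arc s b d \<longrightarrow> arc s a d \<longrightarrow> a < b \<longrightarrow> b < d \<longrightarrow> False)"
proof (induction k arbitrary: a b d rule: less_induct)
  case (less k)
  show ?case
  proof (intro conjI impI)
    assume h: "arc s a b" "arc s a d" "a < b" "b < d"
    have b: "s b = Lft" using arcD[OF h(1)] by simp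
    then obtain c where c: "a < c" "c < d" "partner s b c"
      using arc_inside[OF h(2), of b] h by (auto simp: labelled_def)
    have "arc s c b" using c(3) b by (auto simp: partner_def dest: arcD)
    moreover have "c < b" using arcD[OF \<open>arc s c b\<close>] by simp
    moreover have "nat (b - a) < k" using less.prems h by simp
    ultimately show False using less.IH[of "nat (b - a)" b a c] h c by blast
  next
    assume h: "arc s b d" "arc s a d" "a < b" "b < d"
    have b: "s b = Rgt" using arcD[OF h(1)] by simp
    then obtain c where c: "a < c" "c < d" "partner s b c"
      using arc_inside[OF h(2), of b] h by (auto simp: labelled_def)
    have "arc s b c" using c(3) b by (auto simp: partner_def dest: arcD)
    moreover have "b < c" using arcD[OF \<open>arc s b c\<close>] by simp
    moreover have "nat (d - b) < k" using less.prems h by simp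
    ultimately show False using less.IH[of "nat (d - b)" d b c] h c by blast
  qed
qed

lemma arc_unique_right: "arc s a b \<Longrightarrow> arc s a d \<Longrightarrow> b = d"
  using arc_unique_aux[of d a _ s b] arc_unique_aux[of b a _ s d] arcD(1)[of s a]
  by (metis linorder_neqE)

lemma arc_unique_left: "arc s a d \<Longrightarrow> arc s b d \<Longrightarrow> a = b"
  using arc_unique_aux[of d a _ s b] arc_unique_aux[of d b _ s a] arcD(1)[of s _ d]
  by (metis linorder_neqE)

lemma partner_unique: "partner s v w \<Longrightarrow> partner s v w' \<Longrightarrow> w = w'"
  unfolding partner_def
  using arc_unique_left arc_unique_right arcD label.distinct(1) by metis

lemma partner_neq: "partner s v w \<Longrightarrow> v \<noteq> w"
  by (auto simp: partner_def dest: arcD)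

lemma partner_labelled: "partner s v w \<Longrightarrow> labelled s v"
  by (auto simp: partner_def labelled_def dest: arcD)

lemma partner_inside:
  assumes "arc s a b" "a < c" "c < b" "partner s c d"
  shows "a < d \<and> d < b"
  using arc_inside[OF assms(1-3) partner_labelled[OF assms(4)]] partner_unique assms(4) by metis

lemma partner_outside:
  assumes "arc s a b" "partner s c d" "c < a \<or> b < c"
  shows "d < a \<or> b < d"
proof (rule ccontr)
  assume "\<not> (d < a \<or> b < d)"
  moreover have "d \<noteq> a"
  proof
    assume "d = a"
    then have "c = b" using partner_unique[of s a c b] assms by (auto simp: partner_def)
    then show False using assms(3) arcD(1)[OF assms(1)] by auto
  qed
  moreover have "d \<noteq> b"
  proof
    assume "d = b"
    then have "c = a" using partner_unique[of s b c a] assms by (auto simp: partner_def)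
    then show False using assms(3) arcD(1)[OF assms(1)] by auto
  qed
  ultimately have "a < d" "d < b" by auto
  then have "a < c \<and> c < b" using partner_inside[OF assms(1)] assms(2) partner_sym by metis
  then show False using assms(3) by auto
qed

text \<open>Completeness of the matching. In a shortest counterexample all labelled points between
  \<open>a\<close> and \<open>b\<close> are matched, and none has its partner beyond
  \<open>a\<close> or \<open>b\<close>, since that arc would enclose \<open>a\<close> or
  \<open>b\<close> and thereby match it. But then \<open>a\<close> and \<open>b\<close> form an
  arc.\<close>

lemma unmatched_Rgt_Lft:
  assumes "s a = Rgt" "s b = Lft" "a < b" "\<not> matched s a" "\<not> matched s b"
  shows False
  using assms
proof (induction "nat (b - a)" arbitrary: a b rule: less_induct)
  case less
  have "arc s a b"
  proof (rule arcI)
    fix c assume c: "a < c" "c < b" "labelled s c"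
    have "matched s c"
    proof (rule ccontr)
      assume u: "\<not> matched s c"
      show False
      proof (cases "s c = Rgt")
        case True
        then show False using less.hyps[of b c] less.prems c u by auto
      next
        case False
        then have "s c = Lft" using c by (auto simp: labelled_def)
        then show False using less.hyps[of c a] less.prems c u by auto
      qed
    qed
    then obtain d where d: "partner s c d" by (auto simp: matched_def)
    have "d \<noteq> a" "d \<noteq> b" using d less.prems partner_sym matched_def by metis+
    moreover have "\<not> d < a"
    proof
      assume "d < a"
      then have "arc s d c" using d c by (auto simp: partner_def dest: arcD)
      then show False using arc_inside[of s d c a] \<open>d < a\<close> c less.prems
        by (auto simp: matched_def labelled_def)
    qed
    moreover have "\<not> b < d"
    proof
      assume "b < d"
      then have "arc s c d" using d c by (auto simp: partner_def dest: arcD)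
      then show False using arc_inside[of s c d b] \<open>b < d\<close> c less.prems
        by (auto simp: matched_def labelled_def)
    qed
    ultimately show "\<exists>d. a < d \<and> d < b \<and> (arc s c d \<or> arc s d c)"
      using d by (auto simp: partner_def intro!: exI[of _ d])
  qed (use less.prems in auto)
  then show False using less.prems by (auto simp: matched_def partner_def)
qed

lemma arc_local:
  assumes "arc s a b" "\<And>c. a \<le> c \<Longrightarrow> c \<le> b \<Longrightarrow> s' c = s c"
  shows "arc s' a b"
  using assms
proof (induction "nat (b - a)" arbitrary: a b rule: less_induct)
  case less
  show ?case
  proof (rule arcI)
    fix c assume c: "a < c" "c < b" "labelled s' c"
    then have "labelled s c" using less.prems by (auto simp: labelled_def)
    then obtain d where d: "a < d" "d < b" "partner s c d"
      using arc_inside[OF less.prems(1)] c by blast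
    have "arc s c d \<Longrightarrow> arc s' c d" "arc s d c \<Longrightarrow> arc s' d c"
      by (rule less.hyps; use c d less.prems in auto)+
    then show "\<exists>d. a < d \<and> d < b \<and> (arc s' c d \<or> arc s' d c)"
      using d by (auto simp: partner_def)
  qed (use less.prems arcD[OF less.prems(1)] in auto)
qed

text \<open>Used to identify the matching of a modified label function. By \<open>ends\<close> and
  \<open>ins\<close>, every pair in \<open>M\<close> is an arc, by induction on its length. An arc
  outside \<open>M\<close> would, by uniqueness, have both ends free in \<open>M\<close>, which
  \<open>free\<close> excludes.\<close>

lemma arcs_eqI:
  assumes ends: "\<And>c d. M c d \<Longrightarrow> c < d \<and> s c = Rgt \<and> s d = Lft"
    and ins: "\<And>c d e. M c d \<Longrightarrow> c < e \<Longrightarrow> e < d \<Longrightarrow> labelled s e \<Longrightarrow> \<exists>w. c < w \<and> w < d \<and> (M e w \<or> M w e)"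
    and free: "\<And>c d. c < d \<Longrightarrow> s c = Rgt \<Longrightarrow> s d = Lft \<Longrightarrow> \<nexists>w. M c w \<Longrightarrow> \<nexists>w. M w d \<Longrightarrow> False"
  shows "arc s c d \<longleftrightarrow> M c d"
proof -
  have M: "M c d \<Longrightarrow> arc s c d" for c d
  proof (induction "nat (d - c)" arbitrary: c d rule: less_induct)
    case less
    show ?case
    proof (rule arcI)
      fix e assume e: "c < e" "e < d" "labelled s e"
      then obtain w where w: "c < w" "w < d" "M e w \<or> M w e" using ins less.prems by blast
      have "M e w \<Longrightarrow> arc s e w" "M w e \<Longrightarrow> arc s w e" by (rule less.hyps; use e w in auto)+
      then show "\<exists>w. c < w \<and> w < d \<and> (arc s e w \<or> arc s w e)" using w by auto
    qed (use ends[OF less.prems] in auto)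
  qed
  show ?thesis
  proof
    assume a: "arc s c d"
    show "M c d"
    proof (rule ccontr)
      assume n: "\<not> M c d"
      have "\<nexists>w. M c w" using M a n arc_unique_right by metis
      moreover have "\<nexists>w. M w d" using M a n arc_unique_left by metis
      ultimately show False using free arcD[OF a] by blast
    qed
  qed (rule M)
qed

definition arcs :: "(int \<Rightarrow> label) \<Rightarrow> (int \<times> int) set" where
  "arcs s = {(a, b). arc s a b}"

lemma arcs_iff [simp]: "(a, b) \<in> arcs s \<longleftrightarrow> arc s a b"
  by (simp add: arcs_def)

definition finite_state :: "(int \<Rightarrow> label) \<Rightarrow> bool" where
  "finite_state s \<longleftrightarrow> finite {v. s v \<noteq> Circ}"

lemma finite_labelled: "finite_state s \<Longrightarrow> finite {v. labelled s v}"
  unfolding finite_state_def by (rule finite_subset[rotated]) (auto simp: labelled_def)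

lemma finite_arcs:
  assumes "finite_state s"
  shows "finite (arcs s)"
proof (rule finite_subset)
  show "arcs s \<subseteq> {v. labelled s v} \<times> {v. labelled s v}"
    by (auto simp: labelled_def dest: arcD)
qed (use finite_labelled[OF assms] in auto)

section \<open>Changes of the matching when the labels at two adjacent points change\<close>

lemma arc_insert_adjacent:
  assumes "\<not> labelled s a" "\<not> labelled s (a + 1)"
  shows "arc (s(a := Rgt, a + 1 := Lft)) c d \<longleftrightarrow> arc s c d \<or> c = a \<and> d = a + 1"
proof (rule arcs_eqI)
  let ?s = "s(a := Rgt, a + 1 := Lft)"
  have n: "c \<notin> {a, a + 1} \<and> d \<notin> {a, a + 1}" if "arc s c d" for c d
    using arcD[OF that] assms by (auto simp: labelled_def)
  show "c < d \<and> ?s c = Rgt \<and> ?s d = Lft" if "arc s c d \<or> c = a \<and> d = a + 1" for c d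
    using that n arcD[of s c d] by auto
  show "\<exists>w>c. w < d \<and> ((arc s e w \<or> e = a \<and> w = a + 1) \<or> arc s w e \<or> w = a \<and> e = a + 1)"
    if "arc s c d \<or> c = a \<and> d = a + 1" "c < e" "e < d" "labelled ?s e" for c d e
  proof -
    have a: "arc s c d" using that by auto
    consider "e = a" | "e = a + 1" | "e \<noteq> a" "e \<noteq> a + 1" by blast
    then show ?thesis
    proof cases
      case 3
      then have "labelled s e" using that by (simp add: labelled_def)
      then show ?thesis using arc_inside[OF a that(2,3)] by (auto simp: partner_def)
    qed (use that n[OF a] in \<open>auto intro: exI[of _ "a + 1"] exI[of _ a]\<close>)
  qed
  show False if h: "c < d" "?s c = Rgt" "?s d = Lft" "\<nexists>w. arc s c w \<or> c = a \<and> w = a + 1"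
    "\<nexists>w. arc s w d \<or> w = a \<and> d = a + 1" for c d
  proof (rule unmatched_Rgt_Lft)
    have n: "c \<noteq> a" "d \<noteq> a + 1" "c \<noteq> a + 1" "d \<noteq> a" using h by (auto split: if_splits)
    then show "s c = Rgt" "s d = Lft" "c < d" using h by auto
    then show "\<not> matched s c" "\<not> matched s d"
      using h by (auto simp: matched_def partner_def dest: arcD)
  qed
qed

text \<open>An exchange with an unlabelled neighbour keeps the order of the labelled points, and the
  matching depends on nothing else.\<close>

lemma arc_swap_unlabelled:
  assumes "\<not> labelled s a \<or> \<not> labelled s (a + 1)"
  defines "\<tau> \<equiv> id(a := a + 1, a + 1 := a)"
  shows "arc (s \<circ> \<tau>) c d \<longleftrightarrow> arc s (\<tau> c) (\<tau> d)"
proof (rule arcs_eqI)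
  have \<tau>\<tau> [simp]: "\<tau> (\<tau> v) = v" for v by (simp add: \<tau>_def)
  have mono: "\<tau> v < \<tau> w" if "v < w" "labelled s v" "labelled s w" for v w
    using that assms(1) unfolding \<tau>_def by auto
  have lab: "labelled (s \<circ> \<tau>) v \<longleftrightarrow> labelled s (\<tau> v)" for v by (simp add: labelled_def)
  have l: "labelled s c" "labelled s d" if "arc s c d" for c d
    using arcD[OF that] by (auto simp: labelled_def)
  show "c < d \<and> (s \<circ> \<tau>) c = Rgt \<and> (s \<circ> \<tau>) d = Lft" if "arc s (\<tau> c) (\<tau> d)" for c d
    using arcD[OF that] mono[of "\<tau> c" "\<tau> d"] l[OF that] by simp
  have mono': "v < w" if "\<tau> v < \<tau> w" "labelled s (\<tau> v)" "labelled s (\<tau> w)" for v w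
    using mono[OF that] by simp
  have mono2: "\<tau> v < \<tau> w" if "v < w" "labelled s (\<tau> v)" "labelled s (\<tau> w)" for v w
    using mono'[of w v] that by (metis \<tau>\<tau> linorder_cases order_less_asym)
  show "\<exists>w>c. w < d \<and> (arc s (\<tau> e) (\<tau> w) \<or> arc s (\<tau> w) (\<tau> e))"
    if h: "arc s (\<tau> c) (\<tau> d)" "c < e" "e < d" "labelled (s \<circ> \<tau>) e" for c d e
  proof -
    have le: "labelled s (\<tau> e)" using h(4) lab by simp
    have "\<tau> c < \<tau> e" "\<tau> e < \<tau> d" using mono2 h le l[OF h(1)] by auto
    then obtain w where w: "\<tau> c < w" "w < \<tau> d" "partner s (\<tau> e) w"
      using arc_inside[OF h(1)] le by blast
    have lw: "labelled s w" using w partner_labelled partner_sym by metis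
    have "c < \<tau> w" "\<tau> w < d" using mono'[of c "\<tau> w"] mono'[of "\<tau> w" d] w lw l[OF h(1)] by auto
    then show ?thesis using w by (auto simp: partner_def intro!: exI[of _ "\<tau> w"])
  qed
  show False if h: "c < d" "(s \<circ> \<tau>) c = Rgt" "(s \<circ> \<tau>) d = Lft" "\<nexists>w. arc s (\<tau> c) (\<tau> w)"
    "\<nexists>w. arc s (\<tau> w) (\<tau> d)" for c d
  proof (rule unmatched_Rgt_Lft)
    show rl: "s (\<tau> c) = Rgt" "s (\<tau> d) = Lft" using h by auto
    then show "\<tau> c < \<tau> d" using mono2 h by (auto simp: labelled_def)
    have "\<nexists>w. arc s (\<tau> c) w" "\<nexists>w. arc s w (\<tau> d)" using h(4,5) \<tau>\<tau> by metis+
    then show "\<not> matched s (\<tau> c)" "\<not> matched s (\<tau> d)"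
      using rl by (auto simp: matched_def partner_def dest: arcD)
  qed
qed

text \<open>The conditions on partners cover two situations at once: \<open>a\<close> and
  \<open>a + 1\<close> form an arc, or both are unmatched. In either, erasing the two labels takes
  no end from another arc.\<close>

lemma arc_cap_closed:
  assumes "\<And>w. partner s a w \<Longrightarrow> w = a + 1" "\<And>w. partner s (a + 1) w \<Longrightarrow> w = a"
    "x \<in> {Cross, Circ}" "y \<in> {Cross, Circ}"
  shows "arc (s(a := y, a + 1 := x)) c d \<longleftrightarrow> arc s c d \<and> c \<notin> {a, a + 1} \<and> d \<notin> {a, a + 1}"
proof (rule arcs_eqI)
  let ?s = "s(a := y, a + 1 := x)"
  show "c < d \<and> ?s c = Rgt \<and> ?s d = Lft" if "arc s c d \<and> c \<notin> {a, a + 1} \<and> d \<notin> {a, a + 1}" for c d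
    using that arcD[of s c d] by auto
  show "\<exists>w>c. w < d \<and> (arc s e w \<and> e \<notin> {a, a + 1} \<and> w \<notin> {a, a + 1} \<or>
      arc s w e \<and> w \<notin> {a, a + 1} \<and> e \<notin> {a, a + 1})"
    if h: "arc s c d \<and> c \<notin> {a, a + 1} \<and> d \<notin> {a, a + 1}" "c < e" "e < d" "labelled ?s e" for c d e
  proof -
    have e: "e \<noteq> a" "e \<noteq> a + 1" "labelled s e"
      using h(4) assms(3,4) by (auto simp: labelled_def split: if_splits)
    then obtain w where w: "c < w" "w < d" "partner s e w" using arc_inside h by blast
    then have "w \<noteq> a" "w \<noteq> a + 1" using assms(1,2) e partner_sym by metis+
    then show ?thesis using w e by (auto simp: partner_def)
  qed
  show False if h: "c < d" "?s c = Rgt" "?s d = Lft"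
    "\<nexists>w. arc s c w \<and> c \<notin> {a, a + 1} \<and> w \<notin> {a, a + 1}"
    "\<nexists>w. arc s w d \<and> w \<notin> {a, a + 1} \<and> d \<notin> {a, a + 1}" for c d
  proof (rule unmatched_Rgt_Lft)
    have n: "c \<noteq> a" "c \<noteq> a + 1" "d \<noteq> a" "d \<noteq> a + 1"
      using h(2,3) assms(3,4) by (auto split: if_splits)
    then show "s c = Rgt" "s d = Lft" "c < d" using h by auto
    have "\<not> partner s c a" "\<not> partner s c (a + 1)" "\<not> partner s d a" "\<not> partner s d (a + 1)"
      using assms(1,2) n partner_sym by metis+
    then show "\<not> matched s c" "\<not> matched s d"
      using n h \<open>s c = Rgt\<close> \<open>s d = Lft\<close> unfolding matched_def partner_def
      by (auto dest: arcD)
  qed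
qed

text \<open>The loose end at \<open>u\<close> and the arc between \<open>v\<close> and
  \<open>p\<close> are pulled straight into one loose end at \<open>p\<close>, which therefore
  inherits the label of \<open>u\<close>. The arc leads away from \<open>u\<close>, since an arc
  over \<open>u\<close> would match it.\<close>

lemma arc_cap_half_free:
  assumes "\<not> matched s u" "labelled s u" "partner s v p" "u = a \<and> v = a + 1 \<or> u = a + 1 \<and> v = a"
    and xy: "x \<in> {Cross, Circ}" "y \<in> {Cross, Circ}"
  shows "u = a \<and> arc s v p \<or> u = a + 1 \<and> arc s p v"
    and "arc (s(a := y, a + 1 := x, p := s u)) c d \<longleftrightarrow> arc s c d \<and> c \<notin> {a, a + 1} \<and> d \<notin> {a, a + 1}"
proof -
  have pa: "p \<noteq> u" "p \<noteq> v" using assms(1,3) partner_sym partner_neq matched_def by metis+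
  have uncov: "\<not> (arc s c d \<and> c < u \<and> u < d)" for c d
    using arc_inside[of s c d u] assms(1,2) by (auto simp: matched_def)
  show side: "u = a \<and> arc s v p \<or> u = a + 1 \<and> arc s p v"
    using assms(3,4) uncov[of p v] uncov[of v p] pa arcD(1)[of s p v] arcD(1)[of s v p]
    unfolding partner_def by auto
  let ?s = "s(a := y, a + 1 := x, p := s u)"
  have ends: "{a, a + 1} = {u, v}" using assms(4) by auto
  have nu: "w \<noteq> u" if "partner s e w" for e w using assms(1) that partner_sym matched_def by metis
  have np: "e = p" if "partner s e v" for e
    using partner_unique[of s v e p] that assms(3) partner_sym by metis
  have pn: "p \<noteq> a" "p \<noteq> a + 1" using pa ends by auto
  show "arc ?s c d \<longleftrightarrow> arc s c d \<and> c \<notin> {a, a + 1} \<and> d \<notin> {a, a + 1}"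
  proof (rule arcs_eqI)
    fix c d assume h: "arc s c d \<and> c \<notin> {a, a + 1} \<and> d \<notin> {a, a + 1}"
    then have "c \<noteq> p" "d \<noteq> p"
      using partner_unique[of s p] assms(3) partner_sym unfolding partner_def ends insert_iff by metis+
    then show "c < d \<and> ?s c = Rgt \<and> ?s d = Lft" using h arcD[of s c d] by auto
  next
    fix c d e
    assume h: "arc s c d \<and> c \<notin> {a, a + 1} \<and> d \<notin> {a, a + 1}" "c < e" "e < d" "labelled ?s e"
    have e: "e \<noteq> a" "e \<noteq> a + 1" "labelled s e"
      using h(4) xy pn partner_labelled[of s p] assms(3) partner_sym[of s]
      by (auto simp: labelled_def split: if_splits)
    then obtain w where w: "c < w" "w < d" "partner s e w" using arc_inside h by blast
    have "w \<noteq> v"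
    proof
      assume "w = v"
      then have "c < u \<and> u < d" using h(1) w assms(4) by auto
      then show False using uncov h(1) by blast
    qed
    then have "w \<notin> {a, a + 1}" using nu[OF w(3)] unfolding ends by simp
    then show "\<exists>w>c. w < d \<and> (arc s e w \<and> e \<notin> {a, a + 1} \<and> w \<notin> {a, a + 1} \<or>
      arc s w e \<and> w \<notin> {a, a + 1} \<and> e \<notin> {a, a + 1})"
      using w e by (auto simp: partner_def)
  next
    fix c d
    assume h: "c < d" "?s c = Rgt" "?s d = Lft"
      "\<nexists>w. arc s c w \<and> c \<notin> {a, a + 1} \<and> w \<notin> {a, a + 1}"
      "\<nexists>w. arc s w d \<and> w \<notin> {a, a + 1} \<and> d \<notin> {a, a + 1}"
    have n: "c \<notin> {a, a + 1}" "d \<notin> {a, a + 1}"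
      using h(2,3) xy pn by (auto split: if_splits)
    have un: "\<not> matched s e"
      if "e \<notin> {a, a + 1}" "e \<noteq> p" "\<And>w. partner s e w \<Longrightarrow> w \<in> {a, a + 1}" for e
      using that nu[of e] np[of e] unfolding matched_def ends by blast
    have uc: "s c = Rgt \<and> \<not> matched s c" if "c \<noteq> p"
    proof -
      have sc: "s c = Rgt" using h(2) that n by auto
      then have "w \<in> {a, a + 1}" if "partner s c w" for w
        using that h(4) n(1) unfolding partner_def by (metis arcD(3) label.distinct(1))
      then show ?thesis using un[OF n(1) that] sc by blast
    qed
    have ud: "s d = Lft \<and> \<not> matched s d" if "d \<noteq> p"
    proof -
      have sd: "s d = Lft" using h(3) that n by auto
      then have "w \<in> {a, a + 1}" if "partner s d w" for w
        using that h(5) n(2) unfolding partner_def by (metis arcD(2) label.distinct(1))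
      then show ?thesis using un[OF n(2) that] sd by blast
    qed
    \<comment> \<open>No unmatched point lies under the arc between \<open>v\<close> and
      \<open>p\<close>. Hence unmatched points lie on the same side of \<open>u\<close> as of
      \<open>p\<close>, and \<open>unmatched_Rgt_Lft\<close> can be applied to \<open>u\<close> in
      place of the new loose end \<open>p\<close>.\<close>
    have uncov': "\<not> (v < e \<and> e < p) \<and> \<not> (p < e \<and> e < v)" if "\<not> matched s e" "labelled s e" for e
      using arc_inside[of s v p e] arc_inside[of s p v e] that side arcD(1)[of s v p] arcD(1)[of s p v]
      by (auto simp: matched_def)
    show False
    proof (cases "c = p")
      case True
      then have d: "s u = Rgt" "d \<noteq> p" using h by auto
      then have "u < d" using uncov'[of d] ud side h(1) True n(2) arcD(1)[of s v p] assms(4)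
        by (auto simp: labelled_def)
      then show False using unmatched_Rgt_Lft[of s u d] ud d assms(1) by auto
    next
      case c: False
      show False
      proof (cases "d = p")
        case True
        then have "s u = Lft" using h by auto
        moreover have "c < u" using uncov'[of c] uc[OF c] side h(1) True n(1) arcD(1)[of s p v] assms(4)
          by (auto simp: labelled_def)
        ultimately show False using unmatched_Rgt_Lft[of s c u] uc[OF c] assms(1) by auto
      next
        case False
        then show False using unmatched_Rgt_Lft[of s c d] uc[OF c] ud[OF False] h(1) by blast
      qed
    qed
  qed
qed

text \<open>With \<open>a\<close> opening and \<open>a + 1\<close> closing, the two arcs would
  cross. The remaining shapes are side by side, nested to the right, and nested to the left.\<close>

lemma cap_configuration:
  assumes "partner s a p" "partner s (a + 1) p'" "p \<noteq> a + 1"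
  shows "arc s p a \<and> arc s (a + 1) p' \<or> arc s a p \<and> arc s (a + 1) p' \<and> p' < p
    \<or> arc s p a \<and> arc s p' (a + 1) \<and> p' < p"
proof -
  have p': "p' \<noteq> a" using assms partner_unique[of s a p "a + 1"] partner_sym by metis
  show ?thesis
  proof (cases "arc s a p")
    case True
    then have "a < p' \<and> p' < p"
      using partner_inside[of s a p "a + 1" p'] assms arcD(1)[OF True] by auto
    then have "\<not> arc s p' (a + 1)" using p' arcD(1)[of s p' "a + 1"] by force
    then show ?thesis using True assms(2) \<open>a < p' \<and> p' < p\<close> unfolding partner_def by blast
  next
    case False
    then have pa: "arc s p a" using assms(1) by (simp add: partner_def)
    show ?thesis
    proof (cases "arc s p' (a + 1)")
      case True
      then have "p' < p" using partner_inside[of s p' "a + 1" a p] assms p' arcD(1)[OF True] by auto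
      then show ?thesis using pa True by auto
    next
      case False
      then show ?thesis using pa assms(2) unfolding partner_def by blast
    qed
  qed
qed

text \<open>The path from \<open>p\<close> through \<open>a\<close> and \<open>a + 1\<close> to
  \<open>p'\<close> is pulled straight into a single arc, whatever the shape of the two old ones;
  \<open>lo\<close> and \<open>hi\<close> put its ends in order.\<close>

lemma arc_cap_both:
  assumes pp: "partner s a p" "partner s (a + 1) p'" "p \<noteq> a + 1"
    and xy: "x \<in> {Cross, Circ}" "y \<in> {Cross, Circ}"
    and lh: "lo < hi" "{lo, hi} = {p, p'}"
  shows "arc (s(a := y, a + 1 := x, lo := Rgt, hi := Lft)) c d
    \<longleftrightarrow> arc s c d \<and> c \<notin> {a, a + 1} \<and> d \<notin> {a, a + 1} \<or> c = lo \<and> d = hi"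
proof -
  let ?s = "s(a := y, a + 1 := x, lo := Rgt, hi := Lft)"
  let ?M = "\<lambda>c d. arc s c d \<and> c \<notin> {a, a + 1} \<and> d \<notin> {a, a + 1} \<or> c = lo \<and> d = hi"
  have ne: "p' \<noteq> a" "p \<noteq> a" "p' \<noteq> a + 1" "p \<noteq> p'"
  proof -
    have r: "partner s p a" "partner s p' (a + 1)" using pp partner_sym by blast+
    show "p \<noteq> a" "p' \<noteq> a + 1" using pp partner_neq by blast+
    show "p' \<noteq> a" using partner_unique[of s a p "a + 1"] pp r by blast
    show "p \<noteq> p'" using partner_unique[of s p a "a + 1"] r by auto
  qed
  have r: "partner s p a" "partner s p' (a + 1)" using pp partner_sym by blast+
  have wa: "e = p" if "partner s e a" for e
    using that pp(1) partner_unique[of s a e p] partner_sym by blast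
  have wb: "e = p'" if "partner s e (a + 1)" for e
    using that pp(2) partner_unique[of s "a + 1" e p'] partner_sym by blast
  have pe: "w \<in> {a, a + 1}" if "partner s e w" "e \<in> {p, p'}" for e w
    using that r partner_unique[of s p a w] partner_unique[of s p' "a + 1" w] by auto
  \<comment> \<open>A point under the new arc lies under one of two old arcs side by side, or
    between two nested ones; in the latter case \<open>partner_outside\<close> keeps its partner
    away from the inner arc.\<close>
  have inner: "\<exists>w. partner s e w \<and> lo < w \<and> w < hi \<and> w \<noteq> a \<and> w \<noteq> a + 1"
    if e: "lo < e" "e < hi" "e \<noteq> a" "e \<noteq> a + 1" "labelled s e" for e
  proof -
    have en: "e \<noteq> p" "e \<noteq> p'" using e lh(2) by (auto simp: doubleton_eq_iff)
    consider "arc s p a" "arc s (a + 1) p'" | "arc s a p" "arc s (a + 1) p'" "p' < p"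
      | "arc s p a" "arc s p' (a + 1)" "p' < p" using cap_configuration[OF pp] by blast
    then show ?thesis
    proof cases
      case 1
      have o: "p < a" "a + 1 < p'" using arcD(1)[OF 1(1)] arcD(1)[OF 1(2)] by auto
      have lo: "lo = p" "hi = p'" using o lh by (auto simp: doubleton_eq_iff)
      show ?thesis
      proof (cases "e < a")
        case True
        then show ?thesis using arc_inside[OF 1(1), of e] e lo o by force
      next
        case False
        then have "a + 1 < e" using e by auto
        then show ?thesis using arc_inside[OF 1(2), of e] e lo o by force
      qed
    next
      case 2
      have o: "a < p" "a + 1 < p'" using arcD(1)[OF 2(1)] arcD(1)[OF 2(2)] by auto
      have lo: "lo = p'" "hi = p" using 2(3) lh by (auto simp: doubleton_eq_iff)
      obtain w where w: "a < w" "w < p" "partner s e w"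
        using arc_inside[OF 2(1), of e] e lo o by auto
      have "w < a + 1 \<or> p' < w" using partner_outside[OF 2(2) w(3)] e lo by auto
      then show ?thesis using w lo o by (intro exI[of _ w]) auto
    next
      case 3
      have o: "p < a" using arcD(1)[OF 3(1)] by auto
      have lo: "lo = p'" "hi = p" using 3(3) lh by (auto simp: doubleton_eq_iff)
      obtain w where w: "p' < w" "w < a + 1" "partner s e w"
        using arc_inside[OF 3(2), of e] e lo o by auto
      have "w < p \<or> a < w" using partner_outside[OF 3(1) w(3)] e lo by auto
      then show ?thesis using w lo o by (intro exI[of _ w]) auto
    qed
  qed
  have "labelled s p" "labelled s p'" using r partner_labelled by blast+
  then have lab: "labelled s lo" "labelled s hi" using lh(2) by (auto simp: doubleton_eq_iff)
  have es: "e \<noteq> a \<and> e \<noteq> a + 1 \<and> labelled s e" if "labelled ?s e" for e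
  proof -
    have "lo \<noteq> a" "lo \<noteq> a + 1" "hi \<noteq> a" "hi \<noteq> a + 1" using ne pp(3) lh(2) by (auto simp: doubleton_eq_iff)
    then show ?thesis using that xy lab unfolding labelled_def by (auto split: if_splits)
  qed
  show "arc ?s c d \<longleftrightarrow> ?M c d"
  proof (rule arcs_eqI[where M = ?M])
    fix c d assume h: "?M c d"
    show "c < d \<and> ?s c = Rgt \<and> ?s d = Lft"
    proof (cases "c = lo \<and> d = hi")
      case True
      then show ?thesis using lh(1) by simp
    next
      case False
      then have m: "arc s c d" "c \<notin> {a, a + 1}" "d \<notin> {a, a + 1}" using h by auto
      then have "c \<notin> {p, p'}" "d \<notin> {p, p'}" using pe[of c d] pe[of d c] by (auto simp: partner_def)
      then have "c \<noteq> lo" "c \<noteq> hi" "d \<noteq> lo" "d \<noteq> hi" unfolding lh(2)[symmetric] by simp_all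
      then show ?thesis using m arcD[OF m(1)] by simp
    qed
  next
    fix c d e
    assume h: "?M c d" "c < e" "e < d" "labelled ?s e"
    note e = es[OF h(4)]
    show "\<exists>w>c. w < d \<and> (?M e w \<or> ?M w e)"
    proof (cases "c = lo \<and> d = hi")
      case True
      then show ?thesis using inner[of e] h e by (auto simp: partner_def)
    next
      case False
      then have m: "arc s c d" "c \<notin> {a, a + 1}" "d \<notin> {a, a + 1}" using h by auto
      obtain w where w: "c < w" "w < d" "partner s e w" using arc_inside[OF m(1)] h e by blast
      \<comment> \<open>A point that has lost its partner at \<open>a\<close> or
        \<open>a + 1\<close> is \<open>p\<close> or \<open>p'\<close>, and its new partner is the
        other of these.\<close>
      consider "w = a" | "w = a + 1" | "w \<noteq> a" "w \<noteq> a + 1" by blast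
      then show ?thesis
      proof cases
        case 1
        then have "c < a + 1" "a + 1 < d" using m w by auto
        then have "c < p' \<and> p' < d" using partner_inside[OF m(1)] pp(2) by blast
        moreover have "e = p" using wa w 1 by auto
        ultimately show ?thesis using lh(2) by (auto simp: doubleton_eq_iff intro!: exI[of _ p'])
      next
        case 2
        then have "c < a" "a < d" using m w by auto
        then have "c < p \<and> p < d" using partner_inside[OF m(1)] pp(1) by blast
        moreover have "e = p'" using wb w 2 by auto
        ultimately show ?thesis using lh(2) by (auto simp: doubleton_eq_iff intro!: exI[of _ p])
      next
        case 3
        then show ?thesis using w e by (auto simp: partner_def)
      qed
    qed
  next
    fix c d
    assume h: "c < d" "?s c = Rgt" "?s d = Lft" "\<nexists>w. ?M c w" "\<nexists>w. ?M w d"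
    have c: "c \<noteq> lo" "c \<noteq> hi" "d \<noteq> lo" "d \<noteq> hi" using h by (auto split: if_splits)
    then have cp: "c \<notin> {p, p'}" "d \<notin> {p, p'}" using lh(2) by blast+
    have n: "c \<noteq> a" "c \<noteq> a + 1" "d \<noteq> a" "d \<noteq> a + 1"
      using es[of c] es[of d] h by (auto simp: labelled_def)
    then have s: "s c = Rgt" "s d = Lft" using h c by auto
    have "\<not> matched s c" using h(4) n cp wa[of c] wb[of c] s
      unfolding matched_def partner_def by (auto dest: arcD)
    moreover have "\<not> matched s d" using h(5) n cp wa[of d] wb[of d] s
      unfolding matched_def partner_def by (auto dest: arcD)
    ultimately show False using unmatched_Rgt_Lft[of s c d] s h(1) by blast
  qed
qed

section \<open>Arc expansions and the local operators\<close>

text \<open>The weight of one arc in an expansion, as a function of the labels found at its left and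
  right end: a factor q for an exchange, and 0 where no choice produces these labels.\<close>

definition om :: "label \<Rightarrow> label \<Rightarrow> Qq" where
  "om l r = (if l = Rgt \<and> r = Lft then 1 else if l = Lft \<and> r = Rgt then qq else 0)"

definition ends :: "(int \<times> int) set \<Rightarrow> int set" where
  "ends M = fst ` M \<union> snd ` M"

definition agree :: "int set \<Rightarrow> (int \<Rightarrow> label) \<Rightarrow> (int \<Rightarrow> label) \<Rightarrow> bool" where
  "agree E s t \<longleftrightarrow> (\<forall>v. v \<notin> E \<longrightarrow> t v = s v)"

definition arcprod :: "(int \<times> int) set \<Rightarrow> (int \<Rightarrow> label) \<Rightarrow> Qq" where
  "arcprod M t = (\<Prod>z\<in>M. om (t (fst z)) (t (snd z)))"

text \<open>The coefficient of \<open>t\<close> in the sum of all states obtained from \<open>s\<close> by exchanging the labels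
  at the ends of some of the arcs in \<open>M\<close>, each exchange contributing a factor \<open>q\<close>.\<close>
definition uM :: "(int \<times> int) set \<Rightarrow> (int \<Rightarrow> label) \<Rightarrow> (int \<Rightarrow> label) \<Rightarrow> Qq" where
  "uM M s t = (if agree (ends M) s t then arcprod M t else 0)"

definition Us :: "(int \<Rightarrow> label) \<Rightarrow> (int \<Rightarrow> label) \<Rightarrow> Qq" where
  "Us s = uM (arcs s) s"

lemma om_simps [simp]: "om Rgt Lft = 1" "om Lft Rgt = qq" "om l l = 0"
  "om Cross r = 0" "om Circ r = 0" "om l Cross = 0" "om l Circ = 0"
  by (auto simp: om_def)

lemma ends_insert [simp]: "ends (insert (a, b) M) = insert a (insert b (ends M))"
  by (auto simp: ends_def)

lemma ends_empty [simp]: "ends {} = {}"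
  by (simp add: ends_def)

lemma ends_arcs: "ends (arcs s) = {v. matched s v}"
  by (force simp: ends_def arcs_def matched_def partner_def image_iff)

lemma agree_upd:
  "v \<in> E \<Longrightarrow> agree E s (t(v := l)) \<longleftrightarrow> agree E s t"
  "v \<notin> E \<Longrightarrow> agree E s (t(v := l)) \<longleftrightarrow> l = s v \<and> agree (insert v E) s t"
  "v \<in> E \<Longrightarrow> agree E (s(v := l)) t \<longleftrightarrow> agree E s t"
  "v \<notin> E \<Longrightarrow> agree E (s(v := l)) t \<longleftrightarrow> t v = l \<and> agree (insert v E) s t"
  unfolding agree_def by (auto split: if_splits)

lemma arcprod_insert:
  assumes "finite M" "a \<notin> ends M"
  shows "arcprod (insert (a, b) M) t = om (t a) (t b) * arcprod M t"
proof -
  have "(a, b) \<notin> M" using assms(2) by (force simp: ends_def)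
  then show ?thesis using assms(1) by (simp add: arcprod_def)
qed

lemma arcprod_cong:
  assumes "\<And>v. v \<in> ends M \<Longrightarrow> t v = t' v"
  shows "arcprod M t = arcprod M t'"
  unfolding arcprod_def using assms by (intro prod.cong) (auto simp: ends_def)

lemma matched_labelled: "matched s v \<Longrightarrow> labelled s v"
  by (auto simp: matched_def partner_labelled)

lemma uM_support:
  assumes "uM M s t \<noteq> 0" "M \<subseteq> arcs s" "finite M"
  shows "labelled t v \<longleftrightarrow> labelled s v" "\<not> labelled s v \<Longrightarrow> t v = s v"
proof -
  have ag: "agree (ends M) s t" and nz: "arcprod M t \<noteq> 0"
    using assms by (auto simp: uM_def split: if_splits)
  have "labelled t v \<and> labelled s v" if v: "v \<in> ends M"
  proof
    obtain z where z: "z \<in> M" "v = fst z \<or> v = snd z" using v by (auto simp: ends_def)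
    have "om (t (fst z)) (t (snd z)) \<noteq> 0" using nz z(1) assms(3) by (simp add: arcprod_def)
    then show "labelled t v" using z(2) by (auto simp: labelled_def om_def split: if_splits)
    have "arc s (fst z) (snd z)" using z(1) assms(2) by (auto simp: arcs_def)
    then show "labelled s v" using z(2) by (auto simp: labelled_def dest: arcD)
  qed
  moreover have "t v = s v" if "v \<notin> ends M" using ag that by (simp add: agree_def)
  ultimately show "labelled t v \<longleftrightarrow> labelled s v" "\<not> labelled s v \<Longrightarrow> t v = s v"
    unfolding labelled_def by metis+
qed

lemma Us_zero:
  assumes "finite_state s" "labelled t v \<noteq> labelled s v \<or> \<not> labelled s v \<and> t v \<noteq> s v"
  shows "Us s t = 0"
  using uM_support[of "arcs s" s t v] finite_arcs[OF assms(1)] assms(2) unfolding Us_def by blast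

text \<open>The common form of the operators \<open>F\<^sub>a\<close> and \<open>E\<^sub>a\<close>, as maps on coefficient functions: \<open>F\<^sub>a\<close> is
  the case \<open>x = Cross\<close>, \<open>y = Circ\<close> and \<open>E\<^sub>a\<close> is the case \<open>x = Circ\<close>, \<open>y = Cross\<close>.\<close>
definition opf :: "label \<Rightarrow> label \<Rightarrow> int \<Rightarrow> ((int \<Rightarrow> label) \<Rightarrow> Qq) \<Rightarrow> (int \<Rightarrow> label) \<Rightarrow> Qq" where
  "opf x y a u t =
    (if t a = Rgt \<and> t (a + 1) = Lft then u (t(a := x, a + 1 := y))
     else if t a = Lft \<and> t (a + 1) = Rgt then qq * u (t(a := x, a + 1 := y))
     else if t a = y \<and> t (a + 1) = x
       then u (t(a := Lft, a + 1 := Rgt)) + inverse qq * u (t(a := Rgt, a + 1 := Lft))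
     else if t a = y \<and> labelled t (a + 1) then u (t(a := t (a + 1), a + 1 := y))
     else if labelled t a \<and> t (a + 1) = x then u (t(a := x, a + 1 := t a))
     else 0)"

lemma labelled_simps [simp]: "s v = Lft \<Longrightarrow> labelled s v" "s v = Rgt \<Longrightarrow> labelled s v"
  "s v = Cross \<Longrightarrow> \<not> labelled s v" "s v = Circ \<Longrightarrow> \<not> labelled s v"
  by (auto simp: labelled_def)

definition opposite :: "label \<Rightarrow> label \<Rightarrow> bool" where
  "opposite x y \<longleftrightarrow> x = Cross \<and> y = Circ \<or> x = Circ \<and> y = Cross"

lemma finite_state_upd: "finite_state s \<Longrightarrow> finite_state (s(v := l))"
  unfolding finite_state_def by (rule finite_subset[of _ "insert v {v. s v \<noteq> Circ}"]) auto

text \<open>The coefficients 1 and \<open>qq\<close> which the operator has at a pair of opposite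
  labels are exactly the weights \<open>om\<close> of the new arc.\<close>

lemma opf_create:
  assumes "finite_state s" "opposite x y" "s a = x" "s (a + 1) = y"
  shows "opf x y a (Us s) t = Us (s(a := Rgt, a + 1 := Lft)) t"
proof -
  let ?s = "s(a := Rgt, a + 1 := Lft)" and ?t = "t(a := x, a + 1 := y)"
  have un: "\<not> labelled s a" "\<not> labelled s (a + 1)" using assms by (auto simp: opposite_def)
  have ar: "arcs ?s = insert (a, a + 1) (arcs s)"
    using arc_insert_adjacent[OF un] by auto
  have E: "a \<notin> ends (arcs s)" "a + 1 \<notin> ends (arcs s)"
    using un matched_labelled unfolding ends_arcs by auto
  have W: "arcprod (arcs s) ?t = arcprod (arcs s) t"
    using E by (intro arcprod_cong) auto
  have ag: "agree (ends (arcs s)) s ?t \<longleftrightarrow> agree (insert a (insert (a + 1) (ends (arcs s)))) ?s t"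
    using E assms(3,4) by (auto simp: agree_def)
  have 1: "Us ?s t = om (t a) (t (a + 1)) * Us s ?t"
    by (simp add: Us_def uM_def ar arcprod_insert[OF finite_arcs[OF assms(1)] E(1)] W ag)
  have 2: "Us s (t(a := l, a + 1 := r)) = 0" if "l \<noteq> x \<or> r \<noteq> y" for l r
    using that Us_zero[OF assms(1), of "t(a := l, a + 1 := r)" a] un
      Us_zero[OF assms(1), of "t(a := l, a + 1 := r)" "a + 1"] assms(3,4) by auto
  show ?thesis
    unfolding 1 opf_def using assms(2) 2
    by (cases "t a"; cases "t (a + 1)") (auto simp: opposite_def labelled_def)
qed

lemma Us_swap_unlabelled:
  assumes "\<not> labelled s a \<or> \<not> labelled s (a + 1)"
  defines "\<tau> \<equiv> id(a := a + 1, a + 1 := a)"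
  shows "Us (s \<circ> \<tau>) t = Us s (t \<circ> \<tau>)"
proof -
  have \<tau>\<tau> [simp]: "\<tau> (\<tau> v) = v" for v by (simp add: \<tau>_def)
  have inj: "inj \<tau>" by (metis \<tau>\<tau> injI)
  have arc: "arc (s \<circ> \<tau>) c d \<longleftrightarrow> arc s (\<tau> c) (\<tau> d)" for c d
    using arc_swap_unlabelled[OF assms(1)] unfolding \<tau>_def .
  have ar: "arcs (s \<circ> \<tau>) = map_prod \<tau> \<tau> ` arcs s"
    unfolding arcs_def using arc
    by (force simp: image_iff)
  have "arcprod (arcs (s \<circ> \<tau>)) t = arcprod (arcs s) (t \<circ> \<tau>)"
    unfolding arcprod_def ar
    by (subst prod.reindex) (auto intro!: inj_onI simp: inj_eq[OF inj])
  moreover have "agree (ends (arcs (s \<circ> \<tau>))) (s \<circ> \<tau>) t \<longleftrightarrow> agree (ends (arcs s)) s (t \<circ> \<tau>)"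
  proof -
    have "v \<in> ends (arcs (s \<circ> \<tau>)) \<longleftrightarrow> \<tau> v \<in> ends (arcs s)" for v
      unfolding ends_arcs mem_Collect_eq matched_def partner_def arc by (metis \<tau>\<tau>)
    then show ?thesis unfolding agree_def comp_def by (metis \<tau>\<tau>)
  qed
  ultimately show ?thesis by (simp add: Us_def uM_def)
qed

lemma opf_move:
  assumes "finite_state s" "opposite x y"
    and "labelled s a \<and> s (a + 1) = y \<or> s a = x \<and> labelled s (a + 1)"
  shows "opf x y a (Us s) t = Us (s(a := s (a + 1), a + 1 := s a)) t"
proof -
  let ?\<tau> = "id(a := a + 1, a + 1 := a)"
  have un: "\<not> labelled s a \<or> \<not> labelled s (a + 1)" using assms by (auto simp: opposite_def)
  have "s(a := s (a + 1), a + 1 := s a) = s \<circ> ?\<tau>" "t \<circ> ?\<tau> = t(a := t (a + 1), a + 1 := t a)" by auto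
  then have 1: "Us (s(a := s (a + 1), a + 1 := s a)) t = Us s (t(a := t (a + 1), a + 1 := t a))"
    using Us_swap_unlabelled[OF un, of t] by simp
  have 2: "Us s (t(a := l, a + 1 := r)) = 0"
    if "\<not> (l \<in> {Lft, Rgt} \<and> r = y) \<and> \<not> (l = x \<and> r \<in> {Lft, Rgt})" for l r
    using that Us_zero[OF assms(1), of "t(a := l, a + 1 := r)" a]
      Us_zero[OF assms(1), of "t(a := l, a + 1 := r)" "a + 1"] assms(2,3)
    by (auto simp: labelled_def opposite_def)
  show ?thesis
    unfolding 1 opf_def using assms(2) 2
    by (cases "t a"; cases "t (a + 1)") (auto simp: opposite_def labelled_def)
qed

text \<open>The zigzag relations. The two labels are contracted with weights 1 and
  \<open>inverse qq\<close> against the weights of the arcs ending there; \<open>inverse qq\<close>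
  cancels the \<open>qq\<close> of an exchanged arc, so only a closed loop leaves a coefficient
  other than 0 and 1.\<close>

lemma opf_cap:
  assumes "finite_state s" "opposite x y" "labelled s a" "labelled s (a + 1)"
  obtains c s' where "bar_q c = c" "\<And>t. opf x y a (Us s) t = c * Us s' t" "finite_state s'"
proof -
  have xy: "x \<in> {Cross, Circ}" "y \<in> {Cross, Circ}" "x \<noteq> y" using assms(2) by (auto simp: opposite_def)
  define M where "M = {(c, d). arc s c d \<and> c \<notin> {a, a + 1} \<and> d \<notin> {a, a + 1}}"
  have finM: "finite M"
    by (rule finite_subset[OF _ finite_arcs[OF assms(1)]]) (auto simp: M_def)
  have E: "a \<notin> ends M" "a + 1 \<notin> ends M" by (auto simp: M_def ends_def)
  have W: "arcprod M (t(a := l, a + 1 := r)) = arcprod M t" for t l r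
    using E by (intro arcprod_cong) auto
  have zero: "Us s (t(a := l, a + 1 := r)) = 0" if "l \<in> {Cross, Circ} \<or> r \<in> {Cross, Circ}" for t l r
    using that Us_zero[OF assms(1), of "t(a := l, a + 1 := r)" a]
      Us_zero[OF assms(1), of "t(a := l, a + 1 := r)" "a + 1"] assms(3,4) by auto
  note result = that
  \<comment> \<open>The contraction leaves \<open>y\<close> at \<open>a\<close> and \<open>x\<close>
    at \<open>a + 1\<close>. At states with other labels there, both sides vanish, so only the
    displayed sum has to be computed.\<close>
  have finish: thesis
    if "bar_q c = c" "finite_state s'" "s' a = y" "s' (a + 1) = x"
      and *: "\<And>t. t a = y \<Longrightarrow> t (a + 1) = x \<Longrightarrow>
        Us s (t(a := Lft, a + 1 := Rgt)) + inverse qq * Us s (t(a := Rgt, a + 1 := Lft)) = c * Us s' t"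
    for s' c
  proof (rule result[of c s'])
    fix t :: "int \<Rightarrow> label"
    show "opf x y a (Us s) t = c * Us s' t"
    proof (cases "t a = y \<and> t (a + 1) = x")
      case True
      then show ?thesis using *[of t] xy by (auto simp: opf_def)
    next
      case False
      then have "Us s' t = 0"
        using Us_zero[OF \<open>finite_state s'\<close>, of t a] Us_zero[OF \<open>finite_state s'\<close>, of t "a + 1"]
          \<open>s' a = y\<close> \<open>s' (a + 1) = x\<close> xy by auto
      moreover have "opf x y a (Us s) t = 0"
        unfolding opf_def using False zero assms(2) by (auto simp: opposite_def)
      ultimately show ?thesis by simp
    qed
  qed (use that in simp_all)
  have pM: "p \<notin> ends M" if "partner s p v" "v \<in> {a, a + 1}" for p v
  proof
    assume "p \<in> ends M"
    then obtain z where z: "z \<in> M" "p = fst z \<or> p = snd z" by (auto simp: ends_def)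
    define w where "w = (if p = fst z then snd z else fst z)"
    have "partner s p w" "w \<notin> {a, a + 1}"
      using z by (auto simp: w_def M_def partner_def)
    then show False using that partner_unique by blast
  qed
  have arcs_eq: "arcs s = N \<union> M" if "\<And>c d. arc s c d \<Longrightarrow> (c, d) \<notin> M \<Longrightarrow> (c, d) \<in> N" "N \<subseteq> arcs s" for N
  proof
    show "arcs s \<subseteq> N \<union> M" using that(1) by auto
    show "N \<union> M \<subseteq> arcs s" using that(2) by (auto simp: M_def)
  qed
  have uniq: "(c, d) = w" if "arc s c d" "c = v \<or> d = v" "partner s v u"
      "w = (u, v) \<and> arc s u v \<or> w = (v, u) \<and> arc s v u" for c d u v w
  proof (cases "c = v")
    case True
    then have "d = u" using partner_unique[OF that(3), of d] that(1) by (simp add: partner_def)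
    then have "\<not> arc s u v" using True that(1) arcD(1)[of s u v] arcD(1)[OF that(1)] by auto
    then show ?thesis using that(4) True \<open>d = u\<close> by simp
  next
    case False
    then have v: "d = v" using that(2) by simp
    then have "c = u" using partner_unique[OF that(3), of c] that(1) by (simp add: partner_def)
    then have "\<not> arc s v u" using v that(1) arcD(1)[of s v u] arcD(1)[OF that(1)] by auto
    then show ?thesis using that(4) v \<open>c = u\<close> by simp
  qed
  show thesis
  proof (cases "arc s a (a + 1)")
    case True
    define s' where "s' = s(a := y, a + 1 := x)"
    have "partner s a w \<Longrightarrow> w = a + 1" "partner s (a + 1) w \<Longrightarrow> w = a" for w
      using True partner_unique[of s a w "a + 1"] partner_unique[of s "a + 1" w a] by (auto simp: partner_def)
    then have ar': "arcs s' = M"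
      unfolding s'_def using arc_cap_closed[of s a x y] xy by (auto simp: M_def)
    have ar: "arcs s = insert (a, a + 1) M"
      using True arc_unique_left arc_unique_right arcD[of s]
      by (auto simp: M_def dest: arcD)    show thesis
    \<comment> \<open>A closed loop: the exchanged arc contributes \<open>qq\<close>, the
      unexchanged one \<open>inverse qq\<close>.\<close>
    proof (rule finish[of "qq + inverse qq" s'])
      fix t assume t: "t a = y" "t (a + 1) = x"
      have "agree (insert a (insert (a + 1) (ends M))) s (t(a := l, a + 1 := r)) \<longleftrightarrow> agree (ends M) s' t"
        for l r using t E by (simp add: agree_upd s'_def insert_commute)
      then show "Us s (t(a := Lft, a + 1 := Rgt)) + inverse qq * Us s (t(a := Rgt, a + 1 := Lft))
        = (qq + inverse qq) * Us s' t"
        by (simp add: Us_def uM_def ar ar' arcprod_insert[OF finM E(1)] W distrib_right)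
    qed (auto simp: bar_q_add bar_q_inverse s'_def intro!: finite_state_upd assms)
  next
    case na: False
    have nRL: "\<not> (s a = Rgt \<and> s (a + 1) = Lft)"
    proof
      assume "s a = Rgt \<and> s (a + 1) = Lft"
      then have "arc s a (a + 1)" by (intro arcI) auto
      then show False using na by simp
    qed
    have na': "\<not> partner s a (a + 1)" "\<not> partner s (a + 1) a"
      using na arcD(1)[of s "a + 1" a] by (auto simp: partner_def)
    consider (free) "\<not> matched s a" "\<not> matched s (a + 1)"
      | (half) u v where "\<not> matched s u" "matched s v" "u = a \<and> v = a + 1 \<or> u = a + 1 \<and> v = a"
      | (both) "matched s a" "matched s (a + 1)" by blast
    then show thesis
    proof cases
      case free
      define s' where "s' = s(a := y, a + 1 := x)"
      have ar: "arcs s = M" using free by (auto simp: M_def matched_def partner_def)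
      have ar': "arcs s' = M"
        unfolding s'_def using arc_cap_closed[of s a x y] xy free by (auto simp: M_def matched_def)
      \<comment> \<open>Two equal unmatched labels are annihilated. Opposite ones can only be
        \<open>Lft\<close>, \<open>Rgt\<close> in this order, as \<open>Rgt\<close>,
        \<open>Lft\<close> would form an arc.\<close>
      define c :: Qq where "c = (if s a = Lft \<and> s (a + 1) = Rgt then 1 else 0)"
      show thesis
      proof (rule finish[of c s'])
        fix t assume t: "t a = y" "t (a + 1) = x"
        have "agree (ends M) s (t(a := l, a + 1 := r)) \<longleftrightarrow> l = s a \<and> r = s (a + 1) \<and> agree (ends M) s' t"
          for l r using t E by (auto simp: agree_upd s'_def insert_commute)
        then show "Us s (t(a := Lft, a + 1 := Rgt)) + inverse qq * Us s (t(a := Rgt, a + 1 := Lft))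
          = c * Us s' t"
          using nRL by (auto simp: Us_def uM_def ar ar' W c_def)
      qed (auto simp: c_def s'_def intro!: finite_state_upd assms)
    next
      case (half u v)
      then obtain p where p: "partner s v p" by (auto simp: matched_def)
      have lu: "labelled s u" using half(3) assms(3,4) by auto
      note hf = arc_cap_half_free[OF half(1) lu p half(3) xy(1,2)]
      define s' where "s' = s(a := y, a + 1 := x, p := s u)"
      have ar': "arcs s' = M" unfolding s'_def using hf(2) by (auto simp: M_def)
      \<comment> \<open>The direction of the arc at \<open>v\<close> is the one forced by
        \<open>hf(1)\<close>.\<close>
      define z where "z = (if u = a then (v, p) else (p, v))"
      have z: "z = (p, v) \<and> arc s p v \<or> z = (v, p) \<and> arc s v p" using hf(1) by (auto simp: z_def)
      have "arcs s = {z} \<union> M"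
      proof (rule arcs_eq)
        fix c d assume h: "arc s c d" "(c, d) \<notin> M"
        then have "c \<in> {a, a + 1} \<or> d \<in> {a, a + 1}" by (auto simp: M_def)
        moreover have "c \<noteq> u" "d \<noteq> u" using h(1) half(1) by (auto simp: matched_def partner_def)
        ultimately have "c = v \<or> d = v" using half(3) by auto
        then show "(c, d) \<in> {z}" using uniq[OF h(1) _ p z] by simp
      qed (use z in auto)
      then have ar: "arcs s = insert z M" by simp
      have pE: "p \<notin> ends M" using pM[of p v] p half(3) partner_sym by auto
      have pn: "p \<noteq> a" "p \<noteq> a + 1" using hf(1) half p partner_neq by (auto simp: matched_def partner_def)
      show thesis
      proof (rule finish[of 1 s'])
        fix t assume t: "t a = y" "t (a + 1) = x"
        \<comment> \<open>Being unmatched, \<open>u\<close> must keep its label, so only one of the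
          two summands survives.\<close>
        have "agree (insert v (insert p (ends M))) s (t(a := l, a + 1 := r)) \<longleftrightarrow>
            (if u = a then l else r) = s u \<and> agree (insert p (ends M)) s' t" for l r
          using t E pn half(3) by (auto simp: agree_upd s'_def insert_commute)
        moreover have "agree (ends M) s' t \<longleftrightarrow> t p = s u \<and> agree (insert p (ends M)) s' t"
          unfolding s'_def using pE by (simp add: agree_upd(3,4))
        ultimately show "Us s (t(a := Lft, a + 1 := Rgt)) + inverse qq * Us s (t(a := Rgt, a + 1 := Lft))
          = 1 * Us s' t"
          using lu pn half(3)
          by (cases "t p") (auto simp: Us_def uM_def ar ar' W z_def arcprod_insert[OF finM E(2)]
            arcprod_insert[OF finM pE] labelled_def insert_commute)
      qed (use pn in \<open>auto simp: s'_def intro!: finite_state_upd assms\<close>)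
    next
      case both
      then obtain p where p: "partner s a p" by (auto simp: matched_def)
      then have pE: "p \<notin> ends M" using pM[of p a] partner_sym by blast
      from both obtain p' where p': "partner s (a + 1) p'" by (auto simp: matched_def)
      then have pE': "p' \<notin> ends M" using pM[of p' "a + 1"] partner_sym by blast
      have pn: "p \<noteq> a + 1" "p \<noteq> a" "p' \<noteq> a" "p' \<noteq> a + 1"
        using p p' na' partner_neq by blast+
      have pp: "p \<noteq> p'"
        using p p' partner_unique[of s p a "a + 1"] partner_sym[of s] by auto
      obtain lo hi where lh: "lo < hi" "{lo, hi} = {p, p'}"
        using pp by (metis insert_commute linorder_neqE)
      define s' where "s' = s(a := y, a + 1 := x, lo := Rgt, hi := Lft)"
      have lhE: "lo \<notin> ends M" "hi \<notin> ends M" "lo \<notin> {a, a + 1}" "hi \<notin> {a, a + 1}"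
        using lh(2) pE pE' pn by (auto simp: doubleton_eq_iff)
      have ar': "arcs s' = insert (lo, hi) M"
        unfolding s'_def using arc_cap_both[OF p p' pn(1) xy(1,2) lh] by (auto simp: M_def)
      have MA: "arcs s = insert z (insert z' M)"
        if zz: "z = (p, a) \<and> arc s p a \<or> z = (a, p) \<and> arc s a p"
          "z' = (p', a + 1) \<and> arc s p' (a + 1) \<or> z' = (a + 1, p') \<and> arc s (a + 1) p'" for z z'
      proof -
        have "(c, d) = z \<or> (c, d) = z'" if h: "arc s c d" "(c, d) \<notin> M" for c d
        proof -
          have "(c = a \<or> d = a) \<or> (c = a + 1 \<or> d = a + 1)" using h by (auto simp: M_def)
          then show ?thesis
            using uniq[OF h(1) _ p, of z] uniq[OF h(1) _ p', of z'] zz by blast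
        qed
        moreover have "z \<in> arcs s" "z' \<in> arcs s" using zz by auto
        ultimately show ?thesis using arcs_eq[of "{z, z'}"] by auto
      qed
      \<comment> \<open>The condition on \<open>t\<close> away from the arcs involved; it is common
        to both summands and to the target state.\<close>
      define A where "A t \<longleftrightarrow> agree (insert lo (insert hi (ends M))) s' t" for t
      have agA: "agree (insert p (insert a (insert p' (insert (a + 1) (ends M))))) s (t(a := l, a + 1 := r))
        \<longleftrightarrow> A t" if "t a = y" "t (a + 1) = x" for t l r
      proof -
        have e: "insert p (insert a (insert p' (insert (a + 1) (ends M)))) = {a, a + 1} \<union> ({p, p'} \<union> ends M)"
          by blast
        have "A t \<longleftrightarrow> agree (insert a (insert (a + 1) (insert lo (insert hi (ends M))))) s t"
          unfolding A_def s'_def using that lhE(3,4) E by (simp add: agree_upd(3,4) insert_commute)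
        also have "insert a (insert (a + 1) (insert lo (insert hi (ends M)))) = {a, a + 1} \<union> ({p, p'} \<union> ends M)"
          unfolding lh(2)[symmetric] by blast
        finally show ?thesis unfolding e by (simp add: agree_upd(1))
      qed
      have RHS: "Us s' t = (if A t then om (t lo) (t hi) * arcprod M t else 0)" for t
        by (simp add: Us_def uM_def ar' A_def arcprod_insert[OF finM lhE(1)])
      have LHS: "Us s t = (if agree (insert p (insert a (insert p' (insert (a + 1) (ends M))))) s t
          then om (t (fst z)) (t (snd z)) * (om (t (fst z')) (t (snd z')) * arcprod M t) else 0)"
        if "z = (p, a) \<and> arc s p a \<or> z = (a, p) \<and> arc s a p"
          "z' = (p', a + 1) \<and> arc s p' (a + 1) \<or> z' = (a + 1, p') \<and> arc s (a + 1) p'" for z z' t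
      proof -
        obtain u v u' v' where z: "z = (u, v)" "z' = (u', v')" by fastforce
        have 1: "u' \<notin> ends M" "u \<notin> ends (insert (u', v') M)"
          using that z E pE pE' pn pp by auto
        have 2: "ends (insert z (insert z' M)) = insert p (insert a (insert p' (insert (a + 1) (ends M))))"
          using that by auto
        have 3: "finite (insert (u', v') M)" using finM by simp
        have "arcprod (arcs s) t = om (t u) (t v) * (om (t u') (t v') * arcprod M t)"
          unfolding MA[OF that] z by (simp add: arcprod_insert[OF 3 1(2)] arcprod_insert[OF finM 1(1)])
        then show ?thesis unfolding Us_def uM_def using MA[OF that] 2 z by simp
      qed
      show thesis
      proof (rule finish[of 1 s'])
        fix t assume t: "t a = y" "t (a + 1) = x"
        consider "arc s p a" "arc s (a + 1) p'" | "arc s a p" "arc s (a + 1) p'" "p' < p"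
          | "arc s p a" "arc s p' (a + 1)" "p' < p" using cap_configuration[OF p p' pn(1)] by blast
        then show "Us s (t(a := Lft, a + 1 := Rgt)) + inverse qq * Us s (t(a := Rgt, a + 1 := Lft))
          = 1 * Us s' t"
        proof cases
          case 1
          then have "p < p'" using arcD(1)[OF 1(1)] arcD(1)[OF 1(2)] by linarith
          then have lo: "lo = p" "hi = p'" using lh by (auto simp: doubleton_eq_iff)
          have e: "Us s (t(a := l, a + 1 := r)) = (if A t then om (t p) l * (om r (t p') * arcprod M t) else 0)" for l r
            using LHS[of "(p, a)" "(a + 1, p')" "t(a := l, a + 1 := r)"] 1 pn agA[OF t, of l r] W[of t l r] by simp
          show ?thesis
            unfolding e RHS lo by (cases "t p"; cases "t p'") simp_all
        next
          case 2
          then have lo: "lo = p'" "hi = p" using lh by (auto simp: doubleton_eq_iff)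
          have e: "Us s (t(a := l, a + 1 := r)) = (if A t then om l (t p) * (om r (t p') * arcprod M t) else 0)" for l r
            using LHS[of "(a, p)" "(a + 1, p')" "t(a := l, a + 1 := r)"] 2 pn agA[OF t, of l r] W[of t l r] by simp
          show ?thesis
            unfolding e RHS lo by (cases "t p"; cases "t p'") simp_all
        next
          case 3
          then have lo: "lo = p'" "hi = p" using lh by (auto simp: doubleton_eq_iff)
          have e: "Us s (t(a := l, a + 1 := r)) = (if A t then om (t p) l * (om (t p') r * arcprod M t) else 0)" for l r
            using LHS[of "(p, a)" "(p', a + 1)" "t(a := l, a + 1 := r)"] 3 pn agA[OF t, of l r] W[of t l r] by simp
          show ?thesis
            unfolding e RHS lo by (cases "t p"; cases "t p'") simp_all
        qed
      qed (use lhE in \<open>auto simp: s'_def intro!: finite_state_upd assms\<close>)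
    qed
  qed
qed

lemma opf_other:
  assumes "finite_state s" "opposite x y" "\<not> (s a = x \<and> s (a + 1) = y)"
    "\<not> (labelled s a \<and> s (a + 1) = y)" "\<not> (s a = x \<and> labelled s (a + 1))"
    "\<not> (labelled s a \<and> labelled s (a + 1))"
  shows "opf x y a (Us s) t = 0"
proof -
  have z: "Us s (t(a := l, a + 1 := r)) = 0"
    if "(l = x \<or> l \<in> {Lft, Rgt}) \<and> (r = y \<or> r \<in> {Lft, Rgt})" for l r
  proof (rule ccontr)
    let ?t = "t(a := l, a + 1 := r)"
    assume "Us s ?t \<noteq> 0"
    then have v: "labelled ?t v = labelled s v \<and> (labelled s v \<or> ?t v = s v)" for v
      using Us_zero[OF assms(1), of ?t v] by blast
    have "(l \<in> {Lft, Rgt}) = labelled s a \<and> (labelled s a \<or> l = s a)"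
      using v[of a] by (simp add: labelled_def)
    moreover have "(r \<in> {Lft, Rgt}) = labelled s (a + 1) \<and> (labelled s (a + 1) \<or> r = s (a + 1))"
      using v[of "a + 1"] by (simp add: labelled_def)
    ultimately show False using that assms(3-) by metis
  qed
  have "Us s (t(a := t (a + 1), a + 1 := y)) = 0" if "labelled t (a + 1)"
    by (rule z) (use that in \<open>auto simp: labelled_def\<close>)
  moreover have "Us s (t(a := x, a + 1 := t a)) = 0" if "labelled t a"
    by (rule z) (use that in \<open>auto simp: labelled_def\<close>)
  ultimately show ?thesis
    unfolding opf_def using z[of x y] z[of Lft Rgt] z[of Rgt Lft] by simp
qed

text \<open>The reason why a bar involution exists: every arc expansion is sent to a bar-invariant
  multiple of another one.\<close>

lemma opf_Us:
  assumes "finite_state s" "opposite x y"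
  obtains c s' where "bar_q c = c" "\<And>t. opf x y a (Us s) t = c * Us s' t" "finite_state s'"
proof -
  consider "s a = x \<and> s (a + 1) = y" | "labelled s a \<and> s (a + 1) = y" | "s a = x \<and> labelled s (a + 1)"
    | "labelled s a \<and> labelled s (a + 1)"
    | "\<not> (s a = x \<and> s (a + 1) = y)" "\<not> (labelled s a \<and> s (a + 1) = y)"
      "\<not> (s a = x \<and> labelled s (a + 1))" "\<not> (labelled s a \<and> labelled s (a + 1))" by blast
  then show thesis
  proof cases
    case 1
    then show thesis using that[of 1] opf_create[OF assms] finite_state_upd assms(1) by simp
  next
    case 2
    then show thesis using that[of 1] opf_move[OF assms] finite_state_upd assms(1) by simp
  next
    case 3
    then show thesis using that[of 1] opf_move[OF assms] finite_state_upd assms(1) by simp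
  next
    case 4
    then show thesis using that opf_cap[OF assms] by blast
  next
    case 5
    then show thesis using that[of 0 s] opf_other[OF assms 5] assms(1) by simp
  qed
qed

section \<open>Weights, labels and the Bruhat ordering\<close>

definition st :: "nat \<Rightarrow> nat \<Rightarrow> (int \<Rightarrow> int) \<Rightarrow> int \<Rightarrow> label" where
  "st m n f v = (if v \<in> f ` negpos m then if v \<in> f ` pospos n then Cross else Lft
     else if v \<in> f ` pospos n then Rgt else Circ)"

lemma finite_negpos [simp]: "finite (negpos m)" and finite_pospos [simp]: "finite (pospos n)"
  by (simp_all add: negpos_def pospos_def)

lemma finite_Iset [simp]: "finite (Iset m n)"
  by (simp add: Iset_def)

lemma card_negpos [simp]: "card (negpos m) = m" and card_pospos [simp]: "card (pospos n) = n"
  by (simp_all add: negpos_def pospos_def)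

lemma negpos_less_pospos: "i \<in> negpos m \<Longrightarrow> j \<in> pospos n \<Longrightarrow> i < j"
  by (auto simp: negpos_def pospos_def)

lemma negpos_pospos_disjoint [simp]: "i \<in> negpos m \<Longrightarrow> i \<notin> pospos n" "j \<in> pospos n \<Longrightarrow> j \<notin> negpos m"
  by (auto simp: negpos_def pospos_def)

lemma finite_state_st [simp]: "finite_state (st m n f)"
  unfolding finite_state_def
  by (rule finite_subset[of _ "f ` negpos m \<union> f ` pospos n"]) (auto simp: st_def)

lemma mem_negpos_st: "v \<in> f ` negpos m \<longleftrightarrow> st m n f v \<in> {Lft, Cross}"
  and mem_pospos_st: "v \<in> f ` pospos n \<longleftrightarrow> st m n f v \<in> {Rgt, Cross}"
  by (auto simp: st_def)

lemma st_eq_iff: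
  "st m n f = st m n g \<longleftrightarrow> f ` negpos m = g ` negpos m \<and> f ` pospos n = g ` pospos n"
proof
  assume "st m n f = st m n g"
  then show "f ` negpos m = g ` negpos m \<and> f ` pospos n = g ` pospos n"
    by (auto simp only: set_eq_iff mem_negpos_st[of _ _ _ n] mem_pospos_st[of _ _ _ m])
qed (auto simp: st_def)

lemma Zplus_neg: "f \<in> Zplus m n \<Longrightarrow> i \<in> negpos m \<Longrightarrow> i' \<in> negpos m \<Longrightarrow> i < i' \<Longrightarrow> f i' < f i"
  and Zplus_pos: "f \<in> Zplus m n \<Longrightarrow> j \<in> pospos n \<Longrightarrow> j' \<in> pospos n \<Longrightarrow> j < j' \<Longrightarrow> f j' < f j"
  and Zplus_outside: "f \<in> Zplus m n \<Longrightarrow> k \<notin> Iset m n \<Longrightarrow> f k = 0"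
  by (auto simp: Zplus_def)

lemma Zplus_inj: 
  assumes "f \<in> Zplus m n"
  shows "inj_on f (negpos m)" "inj_on f (pospos n)"
  using Zplus_neg[OF assms] Zplus_pos[OF assms] unfolding inj_on_def
  by (metis linorder_neqE order_less_irrefl)+

lemma decreasing_unique:
  fixes f g :: "int \<Rightarrow> int"
  assumes "\<And>i j. i \<in> {a..b} \<Longrightarrow> j \<in> {a..b} \<Longrightarrow> i < j \<Longrightarrow> f j < f i"
    and "\<And>i j. i \<in> {a..b} \<Longrightarrow> j \<in> {a..b} \<Longrightarrow> i < j \<Longrightarrow> g j < g i"
    and "f ` {a..b} = g ` {a..b}" "k \<in> {a..b}"
  shows "f k = g k"
proof -
  have s: "sorted (rev (map h [a..b])) \<and> distinct (rev (map h [a..b]))"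
    if "\<And>i j. i \<in> {a..b} \<Longrightarrow> j \<in> {a..b} \<Longrightarrow> i < j \<Longrightarrow> h j < h i" for h :: "int \<Rightarrow> int"
  proof -
    have "sorted_wrt (\<lambda>i j. h j < h i) [a..b]"
      by (rule sorted_wrt_mono_rel[OF _ sorted_wrt_upto]) (use that in auto)
    then have "sorted_wrt (<) (rev (map h [a..b]))" by (simp add: sorted_wrt_rev sorted_wrt_map)
    then show ?thesis unfolding strict_sorted_iff .
  qed
  have "rev (map f [a..b]) = rev (map g [a..b])"
    using s[of f, OF assms(1)] s[of g, OF assms(2)] assms(3)
    by (intro sorted_distinct_set_unique) auto
  then show ?thesis using assms(4) by auto
qed

lemma decreasing_exists:
  fixes A :: "int set"
  assumes "finite A" "card A = nat (b - a + 1)"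
  obtains f where "\<And>i j. i \<in> {a..b} \<Longrightarrow> j \<in> {a..b} \<Longrightarrow> i < j \<Longrightarrow> f j < f i" "f ` {a..b} = A"
proof
  define xs where "xs = sorted_list_of_set A"
  define f where "f k = xs ! nat (b - k)" for k
  have l: "length xs = nat (b - a + 1)" and sx: "set xs = A" and srt: "sorted_wrt (<) xs"
    using assms by (simp_all add: xs_def)
  show "f j < f i" if "i \<in> {a..b}" "j \<in> {a..b}" "i < j" for i j
    unfolding f_def by (rule sorted_wrt_nth_less[OF srt]) (use that l in auto)
  show "f ` {a..b} = A"
  proof -
    have "f ` {a..b} = (\<lambda>k. xs ! k) ` (\<lambda>k. nat (b - k)) ` {a..b}"
      by (simp add: f_def image_image)
    also have "(\<lambda>k. nat (b - k)) ` {a..b} = {..<length xs}"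
    proof (intro equalityI subsetI)
      fix k assume "k \<in> {..<length xs}"
      then show "k \<in> (\<lambda>k. nat (b - k)) ` {a..b}"
        using l by (intro image_eqI[of _ _ "b - int k"]) auto
    qed (use l in auto)
    also have "(\<lambda>k. xs ! k) ` {..<length xs} = A"
      using sx by (auto simp: set_conv_nth)
    finally show ?thesis .
  qed
qed

lemma Zplus_eqI:
  assumes "f \<in> Zplus m n" "g \<in> Zplus m n" "st m n f = st m n g"
  shows "f = g"
proof
  fix k
  consider "k \<in> negpos m" | "k \<in> pospos n" | "k \<notin> Iset m n" by (auto simp: Iset_def)
  then show "f k = g k"
  proof cases
    case 1
    then show ?thesis
      using decreasing_unique[of "- int m" "-1" f g k] Zplus_neg[OF assms(1)] Zplus_neg[OF assms(2)]
        assms(3)[unfolded st_eq_iff] unfolding negpos_def by blast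
  next
    case 2
    then show ?thesis
      using decreasing_unique[of 1 "int n" f g k] Zplus_pos[OF assms(1)] Zplus_pos[OF assms(2)]
        assms(3)[unfolded st_eq_iff] unfolding pospos_def by blast
  qed (use Zplus_outside assms in metis)
qed

lemma Zplus_exists:
  assumes "finite A" "card A = m" "finite B" "card B = n"
  obtains g where "g \<in> Zplus m n" "g ` negpos m = A" "g ` pospos n = B"
proof -
  obtain p where p: "\<And>i j. i \<in> negpos m \<Longrightarrow> j \<in> negpos m \<Longrightarrow> i < j \<Longrightarrow> p j < p i" "p ` negpos m = A"
    using decreasing_exists[of A "-1" "- int m"] assms unfolding negpos_def by auto
  obtain r where r: "\<And>i j. i \<in> pospos n \<Longrightarrow> j \<in> pospos n \<Longrightarrow> i < j \<Longrightarrow> r j < r i" "r ` pospos n = B"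
    using decreasing_exists[of B "int n" 1] assms unfolding pospos_def by auto
  define g where "g k = (if k \<in> negpos m then p k else if k \<in> pospos n then r k else 0)" for k
  show thesis
  proof (rule that[of g])
    show "g \<in> Zplus m n" using p(1) r(1) by (auto simp: Zplus_def Iset_def g_def)
    show "g ` negpos m = A" using p(2) by (auto simp: g_def)
    show "g ` pospos n = B" using r(2) by (force simp: g_def)
  qed
qed

text \<open>By \<open>valid_st\<close> and \<open>valid_exists\<close>, these are exactly the label
  functions of the weights in \<open>Zplus\<close>.\<close>

definition valid :: "nat \<Rightarrow> nat \<Rightarrow> (int \<Rightarrow> label) \<Rightarrow> bool" where
  "valid m n s \<longleftrightarrow> finite_state s \<and> card {v. s v \<in> {Lft, Cross}} = m \<and> card {v. s v \<in> {Rgt, Cross}} = n"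

lemma valid_st:
  assumes "inj_on f (negpos m)" "inj_on f (pospos n)"
  shows "valid m n (st m n f)"
proof -
  have "{v. st m n f v \<in> {Lft, Cross}} = f ` negpos m" "{v. st m n f v \<in> {Rgt, Cross}} = f ` pospos n"
    unfolding mem_negpos_st[symmetric] mem_pospos_st[symmetric] by simp_all
  then show ?thesis using assms by (simp add: valid_def card_image)
qed

lemma valid_exists:
  assumes "valid m n s"
  obtains g where "g \<in> Zplus m n" "st m n g = s"
proof -
  have f: "finite {v. s v \<in> {Lft, Cross}}" "finite {v. s v \<in> {Rgt, Cross}}"
    using assms unfolding valid_def finite_state_def
    by (auto elim!: finite_subset[rotated])
  obtain g where g: "g \<in> Zplus m n" "g ` negpos m = {v. s v \<in> {Lft, Cross}}" "g ` pospos n = {v. s v \<in> {Rgt, Cross}}"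
    using Zplus_exists[OF f(1) _ f(2)] assms unfolding valid_def by metis
  show thesis
  proof (rule that[OF g(1)], rule ext)
    fix v
    show "st m n g v = s v" unfolding st_def g(2,3) by (cases "s v") auto
  qed
qed

text \<open>Inverse of \<open>st\<close> on \<open>Zplus\<close>; preceded by \<open>st\<close> it
  is the sorting f^+, see \<open>plus_sort_Some\<close>.\<close>

definition sortZ :: "nat \<Rightarrow> nat \<Rightarrow> (int \<Rightarrow> label) \<Rightarrow> int \<Rightarrow> int" where
  "sortZ m n s = (THE g. g \<in> Zplus m n \<and> st m n g = s)"

lemma sortZ:
  assumes "valid m n s"
  shows "sortZ m n s \<in> Zplus m n" "st m n (sortZ m n s) = s"
proof -
  have "\<exists>!g. g \<in> Zplus m n \<and> st m n g = s"
    using valid_exists[OF assms] Zplus_eqI by metis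
  from theI'[OF this] show "sortZ m n s \<in> Zplus m n" "st m n (sortZ m n s) = s"
    unfolding sortZ_def by auto
qed

lemma sortZ_st [simp]: "f \<in> Zplus m n \<Longrightarrow> sortZ m n (st m n f) = f"
  using sortZ[OF valid_st[OF Zplus_inj]] Zplus_eqI by metis

lemma plus_sort_Some: "plus_sort m n (Some f) = Some (sortZ m n (st m n f))"
  by (simp add: plus_sort_def sortZ_def st_eq_iff)

section \<open>Exchanges of labels and the Bruhat ordering\<close>

definition flip :: "(int \<Rightarrow> label) \<Rightarrow> (int \<Rightarrow> label) \<Rightarrow> bool" where
  "flip s t \<longleftrightarrow> (\<exists>c d. c < d \<and> s c = Rgt \<and> s d = Lft \<and> t = s(c := Lft, d := Rgt))"

lemma valid_exchange:
  assumes "valid m n s" "s c = Rgt" "s d = Lft"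
  shows "valid m n (s(c := Lft, d := Rgt))"
proof -
  define t where "t = s(c := Lft, d := Rgt)"
  have h: "s c = Rgt" "s d = Lft" "t = s(c := Lft, d := Rgt)" using assms by (auto simp: t_def)
  have f: "finite {v. s v \<in> {Lft, Cross}}" "finite {v. s v \<in> {Rgt, Cross}}"
    using assms unfolding valid_def finite_state_def
    by (auto elim!: finite_subset[rotated])
  have 1: "{v. t v \<in> {Lft, Cross}} = insert c ({v. s v \<in> {Lft, Cross}} - {d})"
    "{v. t v \<in> {Rgt, Cross}} = insert d ({v. s v \<in> {Rgt, Cross}} - {c})"
    using h by auto
  have "card {v. t v \<in> {Lft, Cross}} = m" "card {v. t v \<in> {Rgt, Cross}} = n"
    unfolding 1 using f h assms(1) card_Suc_Diff1[OF f(1), of d] card_Suc_Diff1[OF f(2), of c]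
    by (simp_all add: valid_def)
  then show ?thesis using assms(1) h(3) by (simp add: valid_def finite_state_upd)
qed

lemma valid_flip:
  assumes "flip s t"
  shows "valid m n t \<longleftrightarrow> valid m n s"
proof -
  obtain c d where h: "c < d" "s c = Rgt" "s d = Lft" "t = s(c := Lft, d := Rgt)"
    using assms by (auto simp: flip_def)
  have "valid m n s" if "valid m n t"
  proof -
    have "s = t(d := Lft, c := Rgt)" using h by auto
    then show ?thesis using valid_exchange[OF that, of d c] h by auto
  qed
  then show ?thesis using valid_exchange[of m n s c d] h by auto
qed

lemma image_fun_upd_inj: "inj_on f J \<Longrightarrow> i \<in> J \<Longrightarrow> f(i := c) ` J = insert c (f ` J - {f i})"
  by (auto simp: image_iff inj_on_def)

lemma image_swap: "i \<in> J \<Longrightarrow> j \<in> J \<Longrightarrow> (h(i := h j, j := h i)) ` J = h ` J"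
  by (auto simp: image_iff)

lemma bstepI:
  assumes "i \<in> Iset m n" "j \<in> Iset m n" "i < j" "h j < h i"
  shows "bstep m n (h(i := h j, j := h i)) h"
  unfolding bstep_def
  by (rule bexI[OF _ assms(1)], rule bexI[OF _ assms(2)]) (use assms(3,4) in auto)

text \<open>Swapping a pair of values and then sorting must be realised by descending steps only: the
  larger value first travels to the position which the smaller one takes after sorting.\<close>
lemma rotate_neg:
  assumes "f \<in> Zplus m n" "i \<in> negpos m" "i \<le> r" "r \<le> -1"
  defines "R \<equiv> \<lambda>r k. if i \<le> k \<and> k < r then f (k + 1) else if k = r then f i else f k"
  shows "(bstep m n)\<^sup>*\<^sup>* (R r) f \<and> R r ` negpos m = f ` negpos m"
  using assms(3,4)
proof (induction r rule: int_ge_induct)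
  case base
  have "R i = f" by (auto simp: R_def)
  then show ?case by simp
next
  case (step r)
  have mem: "r \<in> negpos m" "r + 1 \<in> negpos m" using step assms(2) by (auto simp: negpos_def)
  have "f (r + 1) < f i" using Zplus_neg[OF assms(1,2) mem(2)] step by simp
  then have "bstep m n ((R r)(r := R r (r + 1), r + 1 := R r r)) (R r)"
    using mem step by (intro bstepI) (auto simp: Iset_def R_def)
  moreover have "(R r)(r := R r (r + 1), r + 1 := R r r) = R (r + 1)"
    using step(1) by (auto simp: fun_eq_iff R_def)
  ultimately show ?case
    using step image_swap[OF mem, of "R r"] by (auto intro: converse_rtranclp_into_rtranclp)
qed

lemma rotate_pos:
  assumes "f \<in> Zplus m n" "j \<in> pospos n" "l \<le> j" "1 \<le> l" "\<And>k. k \<in> pospos n \<Longrightarrow> h k = f k"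
  defines "R \<equiv> \<lambda>l k. if l < k \<and> k \<le> j then f (k - 1) else if k = l then f j else h k"
  shows "(bstep m n)\<^sup>*\<^sup>* (R l) h \<and> R l ` pospos n = f ` pospos n"
  using assms(3,4)
proof (induction l rule: int_le_induct)
  case base
  have "R j = h" using assms(2,5) by (auto simp: R_def)
  then show ?case using assms(5) by simp
next
  case (step l)
  have mem: "l - 1 \<in> pospos n" "l \<in> pospos n" using step assms(2) by (auto simp: pospos_def)
  have "f j < f (l - 1)" using Zplus_pos[OF assms(1) mem(1) assms(2)] step by simp
  then have "bstep m n ((R l)(l - 1 := R l l, l := R l (l - 1))) (R l)"
    using mem step assms(5) by (intro bstepI) (auto simp: Iset_def R_def)
  moreover have "(R l)(l - 1 := R l l, l := R l (l - 1)) = R (l - 1)"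
    using step(1) assms(5)[OF mem(1)] by (auto simp: fun_eq_iff R_def)
  ultimately show ?case
    using step image_swap[OF mem, of "R l"] by (auto intro: converse_rtranclp_into_rtranclp)
qed

lemma bless_flip:
  assumes f: "f \<in> Zplus m n" and g: "g \<in> Zplus m n" and fl: "flip (st m n f) (st m n g)"
  shows "bless m n g f"
proof -
  obtain c d where cd: "c < d" "st m n f c = Rgt" "st m n f d = Lft"
    "st m n g = (st m n f)(c := Lft, d := Rgt)" using fl by (auto simp: flip_def)
  obtain i where i: "i \<in> negpos m" "f i = d" using mem_negpos_st[of d f m n] cd by auto
  obtain j where j: "j \<in> pospos n" "f j = c" using mem_pospos_st[of c f n m] cd by auto
  have cn: "f k \<noteq> c" if "k \<in> negpos m" for k using mem_negpos_st[of c f m n] that cd by auto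
  have dn: "f k \<noteq> d" if "k \<in> pospos n" for k using mem_pospos_st[of d f n m] that cd by auto
  \<comment> \<open>Once \<open>c\<close> replaces \<open>d\<close> on the left, decreasing order
    puts \<open>c\<close> at \<open>r\<close>, the last negative position with a value above
    \<open>c\<close>.\<close>
  define r where "r = Max {k \<in> negpos m. c < f k}"
  have "r \<in> {k \<in> negpos m. c < f k}" unfolding r_def by (rule Max_in) (use i cd(1) in auto)
  moreover have "i \<le> r" unfolding r_def by (rule Max_ge) (use i cd(1) in auto)
  ultimately have r: "r \<in> negpos m" "c < f r" "i \<le> r" by auto
  have r': "f k < c" if "k \<in> negpos m" "r < k" for k
    using Max_ge[of "{k \<in> negpos m. c < f k}" k] that cn[OF that(1)] unfolding r_def[symmetric]
    by force
  \<comment> \<open>Likewise, \<open>l\<close> is the position that \<open>d\<close> takes on the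
    right when it replaces \<open>c\<close> there.\<close>
  define l where "l = Min {k \<in> pospos n. f k < d}"
  have "l \<in> {k \<in> pospos n. f k < d}" unfolding l_def by (rule Min_in) (use j cd(1) in auto)
  moreover have "l \<le> j" unfolding l_def by (rule Min_le) (use j cd(1) in auto)
  ultimately have l: "l \<in> pospos n" "f l < d" "l \<le> j" by auto
  have l': "d < f k" if "k \<in> pospos n" "k < l" for k
    using Min_le[of "{k \<in> pospos n. f k < d}" k] that dn[OF that(1)] unfolding l_def[symmetric]
    by force
  \<comment> \<open>\<open>?R\<close> moves \<open>d\<close> rightwards from \<open>i\<close> to
    \<open>r\<close>, and \<open>H\<close> then moves \<open>c\<close> leftwards from
    \<open>j\<close> to \<open>l\<close>, both by descending steps. Exchanging the values at
    \<open>r\<close> and \<open>l\<close> is one more descending step and gives a sorted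
    function.\<close>
  let ?R = "\<lambda>k. if i \<le> k \<and> k < r then f (k + 1) else if k = r then f i else f k"
  define H where "H k = (if l < k \<and> k \<le> j then f (k - 1) else if k = l then f j else ?R k)" for k
  have rl: "r < l" using negpos_less_pospos r l by blast
  have h: "H r = d" "H l = c" using rl r l i j by (simp_all add: H_def)
  have R: "(bstep m n)\<^sup>*\<^sup>* ?R f \<and> ?R ` negpos m = f ` negpos m"
    by (rule rotate_neg) (use f i r in \<open>auto simp: negpos_def\<close>)
  have HR: "(bstep m n)\<^sup>*\<^sup>* H ?R \<and> H ` pospos n = f ` pospos n"
    unfolding H_def by (rule rotate_pos) (use f j l r in \<open>auto simp: negpos_def pospos_def\<close>)
  have Hn: "H ` negpos m = f ` negpos m"
    using R l(1) by (subst R[THEN conjunct2, symmetric]) (auto simp: H_def negpos_def pospos_def intro!: image_cong)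
  have inj: "inj_on H (negpos m)" "inj_on H (pospos n)"
    using Hn HR Zplus_inj[OF f] by (auto intro!: eq_card_imp_inj_on simp: card_image)
  from HR R have Hf: "(bstep m n)\<^sup>*\<^sup>* H f" by (auto intro: rtranclp_trans)
  have "bstep m n (H(r := H l, l := H r)) H"
    by (rule bstepI) (use r(1) l(1) rl h cd(1) in \<open>auto simp: Iset_def\<close>)
  then have b: "bless m n (H(r := c, l := d)) f"
    unfolding bless_def h using Hf by (rule rtranclp_into_tranclp2)
  let ?g = "H(r := c, l := d)"
  have "?g ` negpos m = H(r := c) ` negpos m" "?g ` pospos n = H(l := d) ` pospos n"
    using r(1) l(1) by (auto intro!: image_cong)
  then have img: "?g ` negpos m = insert c (f ` negpos m - {d})" "?g ` pospos n = insert d (f ` pospos n - {c})"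
    using image_fun_upd_inj[OF inj(1) r(1), of c] image_fun_upd_inj[OF inj(2) l(1), of d]
    by (simp_all only: Hn HR[THEN conjunct2] h)
  have gp: "?g k = (if l < k \<and> k \<le> j then f (k - 1) else if k = l then d else f k)" if "k \<in> pospos n" for k
    using that r rl by (auto simp: H_def negpos_def pospos_def)
  have gn: "?g k = (if i \<le> k \<and> k < r then f (k + 1) else if k = r then c else f k)" if "k \<in> negpos m" for k
    using that l rl by (auto simp: H_def negpos_def pospos_def)
  have gZ: "?g \<in> Zplus m n"
    unfolding Zplus_def mem_Collect_eq
  proof (intro conjI ballI allI impI)
    fix k assume "k \<notin> Iset m n"
    then show "?g k = 0"
      using Zplus_outside[OF f] i j r l by (auto simp: H_def Iset_def negpos_def pospos_def)
  next
    fix k k' assume k: "k \<in> negpos m" "k' \<in> negpos m" "k < k'"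
    have "k + 1 \<in> negpos m" using k by (auto simp: negpos_def)
    moreover have "k' < r \<Longrightarrow> k' + 1 \<in> negpos m" using k r by (auto simp: negpos_def)
    ultimately show "?g k' < ?g k"
      unfolding gn[OF k(1)] gn[OF k(2)]
      using Zplus_neg[OF f k(1) k(2)] Zplus_neg[OF f, of "k + 1" "k' + 1"] Zplus_neg[OF f, of k "k' + 1"]
        Zplus_neg[OF f, of "k + 1" k'] Zplus_neg[OF f, of "k + 1" r] Zplus_neg[OF f, of k r] r r'[of k'] k
      by (smt (verit))
  next
    fix k k' assume k: "k \<in> pospos n" "k' \<in> pospos n" "k < k'"
    have "k' - 1 \<in> pospos n" using k by (auto simp: pospos_def)
    moreover have "l < k \<Longrightarrow> k - 1 \<in> pospos n" using k l by (auto simp: pospos_def)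
    ultimately show "?g k' < ?g k"
      unfolding gp[OF k(1)] gp[OF k(2)]
      using Zplus_pos[OF f k(1) k(2)] Zplus_pos[OF f, of "k - 1" "k' - 1"] Zplus_pos[OF f, of "k - 1" k']
        Zplus_pos[OF f, of k "k' - 1"] Zplus_pos[OF f, of l "k' - 1"] Zplus_pos[OF f, of l k'] l l'[of k] k
      by (smt (verit))
  qed
  have "st m n ?g = st m n g"
  proof -
    have "v \<in> ?g ` negpos m \<longleftrightarrow> v \<in> g ` negpos m" "v \<in> ?g ` pospos n \<longleftrightarrow> v \<in> g ` pospos n" for v
      unfolding img insert_iff Diff_iff singleton_iff
        mem_negpos_st[of v f m n] mem_negpos_st[of v g m n] mem_pospos_st[of v f n m] mem_pospos_st[of v g n m] cd(4)
      using cd(1-3) by auto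
    then show ?thesis unfolding st_eq_iff by blast
  qed
  then have "?g = g" by (rule Zplus_eqI[OF gZ g])
  then show ?thesis using b by metis
qed

text \<open>Different choices of \<open>F\<close> give the height \<open>mu\<close>, the number of
  occurrences of a value, and the sum over the negative positions.\<close>

lemma sum_swap_values:
  fixes F :: "int \<Rightarrow> int \<Rightarrow> int"
  assumes "i \<in> Iset m n" "j \<in> Iset m n" "i \<noteq> j"
  shows "(\<Sum>k\<in>Iset m n. F k ((f(i := f j, j := f i)) k))
    = (\<Sum>k\<in>Iset m n. F k (f k)) + F i (f j) + F j (f i) - F i (f i) - F j (f j)"
proof -
  have "(\<Sum>k\<in>Iset m n. G k) = G i + (G j + (\<Sum>k\<in>Iset m n - {i} - {j}. G k))" for G :: "int \<Rightarrow> int"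
    using assms by (simp add: sum.remove[of _ i] sum.remove[of _ j])
  moreover have "(\<Sum>k\<in>Iset m n - {i} - {j}. F k ((f(i := f j, j := f i)) k))
      = (\<Sum>k\<in>Iset m n - {i} - {j}. F k (f k))"
    by (intro sum.cong) auto
  ultimately show ?thesis using assms(3) by (simp add: fun_upd_def)
qed

text \<open>A height for the Bruhat ordering: a swap changes the sum of - k * f k by (j - i) (f j -
  f i). The term with the absolute value is invariant under swaps and keeps the total nonnegative,
  so \<open>nat\<close> loses nothing.\<close>

definition mu :: "nat \<Rightarrow> nat \<Rightarrow> (int \<Rightarrow> int) \<Rightarrow> nat" where
  "mu m n f = nat (\<Sum>k\<in>Iset m n. int (m + n) * \<bar>f k\<bar> - k * f k)"

lemma bstep_mu:
  assumes "bstep m n f g"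
  shows "mu m n f < mu m n g"
proof -
  obtain i j where h: "i \<in> Iset m n" "j \<in> Iset m n" "i < j" "f i < f j" "g = f(i := f j, j := f i)"
    using assms by (auto simp: bstep_def)
  have nn: "0 \<le> (\<Sum>k\<in>Iset m n. int (m + n) * \<bar>f k\<bar> - k * f k)"
  proof (rule sum_nonneg)
    fix k assume "k \<in> Iset m n"
    then have "\<bar>k\<bar> \<le> int (m + n)" by (auto simp: Iset_def negpos_def pospos_def)
    then have "\<bar>k\<bar> * \<bar>f k\<bar> \<le> int (m + n) * \<bar>f k\<bar>" by (rule mult_right_mono) simp
    then show "0 \<le> int (m + n) * \<bar>f k\<bar> - k * f k"
      using abs_ge_self[of "k * f k"] by (simp add: abs_mult)
  qed
  have "(\<Sum>k\<in>Iset m n. int (m + n) * \<bar>g k\<bar> - k * g k)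
    = (\<Sum>k\<in>Iset m n. int (m + n) * \<bar>f k\<bar> - k * f k) + (j - i) * (f j - f i)"
    using sum_swap_values[of i m n j "\<lambda>k v. int (m + n) * \<bar>v\<bar> - k * v" f] h(1-3)
    unfolding h(5) by (simp add: algebra_simps)
  moreover have "0 < (j - i) * (f j - f i)" using h by simp
  ultimately show ?thesis unfolding mu_def using nn by linarith
qed

lemma bless_mu: "bless m n f g \<Longrightarrow> mu m n f < mu m n g"
  unfolding bless_def by (induction rule: tranclp_induct) (auto dest: bstep_mu)

lemma bless_irrefl: "\<not> bless m n f f"
  using bless_mu by blast

lemma bless_trans: "bless m n f g \<Longrightarrow> bless m n g h \<Longrightarrow> bless m n f h"
  unfolding bless_def by (rule tranclp_trans)

lemma bless_values:
  assumes "bless m n g f"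
  shows "(\<Sum>k\<in>Iset m n. of_bool (g k = v) :: int) = (\<Sum>k\<in>Iset m n. of_bool (f k = v))"
    and "(\<Sum>k\<in>Iset m n. if k < 0 then g k else 0) \<le> (\<Sum>k\<in>Iset m n. if k < 0 then f k else 0)"
proof -
  have one: "(\<Sum>k\<in>Iset m n. of_bool (g k = v) :: int) = (\<Sum>k\<in>Iset m n. of_bool (f k = v)) \<and>
    (\<Sum>k\<in>Iset m n. if k < 0 then g k else 0) \<le> (\<Sum>k\<in>Iset m n. if k < 0 then f k else 0)"
    if gf: "bstep m n g f" for f g
  proof -
    obtain i j where h: "i \<in> Iset m n" "j \<in> Iset m n" "i < j" "g i < g j" "f = g(i := g j, j := g i)"
      using gf by (auto simp: bstep_def)
    show ?thesis
      using sum_swap_values[of i m n j "\<lambda>k w. of_bool (w = v)" g]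
        sum_swap_values[of i m n j "\<lambda>k w. if k < 0 then w else 0" g] h
      unfolding h(5) by (auto split: if_splits)
  qed
  have "(\<Sum>k\<in>Iset m n. of_bool (g k = v) :: int) = (\<Sum>k\<in>Iset m n. of_bool (f k = v)) \<and>
    (\<Sum>k\<in>Iset m n. if k < 0 then g k else 0) \<le> (\<Sum>k\<in>Iset m n. if k < 0 then f k else 0)"
    using assms unfolding bless_def
  proof (induction rule: tranclp_induct)
    case (step f f')
    then show ?case using one[of f f'] by simp
  qed (use one in blast)
  then show "(\<Sum>k\<in>Iset m n. of_bool (g k = v) :: int) = (\<Sum>k\<in>Iset m n. of_bool (f k = v))"
    "(\<Sum>k\<in>Iset m n. if k < 0 then g k else 0) \<le> (\<Sum>k\<in>Iset m n. if k < 0 then f k else 0)" by auto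
qed

lemma sum_Iset: "(\<Sum>k\<in>Iset m n. F k) = (\<Sum>k\<in>negpos m. F k) + (\<Sum>k\<in>pospos n. F k :: int)"
  unfolding Iset_def by (rule sum.union_disjoint) auto

lemma value_count:
  assumes "f \<in> Zplus m n"
  shows "(\<Sum>k\<in>Iset m n. of_bool (f k = v) :: int) = of_bool (v \<in> f ` negpos m) + of_bool (v \<in> f ` pospos n)"
proof -
  have "(\<Sum>k\<in>J. of_bool (f k = v) :: int) = of_bool (v \<in> f ` J)" if "inj_on f J" "finite J" for J
  proof (cases "v \<in> f ` J")
    case True
    then obtain k where k: "k \<in> J" "v = f k" by auto
    have "(\<Sum>k'\<in>J. of_bool (f k' = v) :: int) = (\<Sum>k'\<in>J. if k' = k then 1 else 0)"
      using k that by (intro sum.cong) (auto simp: inj_on_def)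
    then show ?thesis using k that(2) by simp
  qed (auto intro!: sum.neutral)
  then show ?thesis using Zplus_inj[OF assms] by (simp add: sum_Iset)
qed

lemma sum_strictly_separated:
  fixes A B :: "int set"
  assumes "finite A" "finite B" "card A = card B" "A \<noteq> {}" "\<And>a b. a \<in> A \<Longrightarrow> b \<in> B \<Longrightarrow> a < b"
  shows "\<Sum>A < \<Sum>B"
proof -
  obtain h where h: "bij_betw h A B" using finite_same_card_bij[OF assms(1-3)] by blast
  have "\<Sum>A < (\<Sum>a\<in>A. h a)"
    using assms h by (intro sum_strict_mono) (auto simp: bij_betw_def)
  also have "\<dots> = \<Sum>B" using sum.reindex_bij_betw[OF h, of "\<lambda>x. x"] by simp
  finally show ?thesis .
qed

text \<open>A smaller \<open>g\<close> has the same values with the same multiplicities, so it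
  differs by trading \<open>Lft\<close> values of \<open>f\<close> for \<open>Rgt\<close> values on
  the negative positions. By \<open>no\<close> the traded \<open>Lft\<close> values are smaller,
  which raises the sum there, against \<open>bless_values(2)\<close>.\<close>

lemma bruhat_minimalI:
  assumes f: "f \<in> Zplus m n" and no: "\<And>c d. c < d \<Longrightarrow> st m n f c = Rgt \<Longrightarrow> st m n f d = Lft \<Longrightarrow> False"
  shows "bruhat_minimal m n f"
proof -
  have False if g: "g \<in> Zplus m n" and b: "bless m n g f" for g
  proof -
    let ?A = "f ` negpos m" and ?B = "f ` pospos n" and ?A' = "g ` negpos m" and ?B' = "g ` pospos n"
    have cnt: "(of_bool (v \<in> ?A') + of_bool (v \<in> ?B') :: int) = of_bool (v \<in> ?A) + of_bool (v \<in> ?B)" for v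
      using bless_values(1)[OF b, of v] value_count[OF f] value_count[OF g] by simp
    have s: "(\<Sum>k\<in>Iset m n. if k < 0 then h k else 0) = \<Sum>(h ` negpos m)" if "h \<in> Zplus m n" for h
    proof -
      have "(\<Sum>k\<in>negpos m. if k < 0 then h k else 0) = (\<Sum>k\<in>negpos m. h k)"
        by (intro sum.cong) (auto simp: negpos_def)
      moreover have "(\<Sum>k\<in>pospos n. if k < 0 then h k else 0) = 0"
        by (intro sum.neutral) (auto simp: pospos_def)
      ultimately show ?thesis
        using Zplus_inj(1)[OF that] by (simp add: sum_Iset sum.reindex)
    qed
    have le: "\<Sum>?A' \<le> \<Sum>?A" using bless_values(2)[OF b] s[OF f] s[OF g] by simp
    have ca: "card ?A = m" "card ?A' = m"
      using Zplus_inj(1)[OF f] Zplus_inj(1)[OF g] by (simp_all add: card_image)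
    have "card ?A = card (?A \<inter> ?A') + card (?A - ?A')" "card ?A' = card (?A' \<inter> ?A) + card (?A' - ?A)"
      by (rule card_Int_Diff, simp)+
    then have cd: "card (?A - ?A') = card (?A' - ?A)"
      unfolding ca Int_commute[of ?A' ?A] by linarith
    have lt: "a < b" if "a \<in> ?A - ?A'" "b \<in> ?A' - ?A" for a b
    proof (rule ccontr)
      assume "\<not> a < b"
      then have "b < a" using that by (metis DiffD1 DiffD2 linorder_neqE)
      moreover have "st m n f a = Lft" using cnt[of a] that by (auto simp: st_def of_bool_def split: if_splits)
      moreover have "st m n f b = Rgt" using cnt[of b] that by (auto simp: st_def of_bool_def split: if_splits)
      ultimately show False using no by blast
    qed
    have "\<Sum>(?A - ?A') < \<Sum>(?A' - ?A)" if "?A - ?A' \<noteq> {}"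
      by (rule sum_strictly_separated[OF _ _ cd that lt]) simp_all
    moreover have "\<Sum>?A = \<Sum>(?A - ?A') + \<Sum>(?A \<inter> ?A')" "\<Sum>?A' = \<Sum>(?A' - ?A) + \<Sum>(?A \<inter> ?A')"
      using sum.Int_Diff[of ?A "\<lambda>x. x" ?A'] sum.Int_Diff[of ?A' "\<lambda>x. x" ?A] by (simp_all add: Int_commute)
    ultimately have "?A - ?A' = {}" using le by linarith
    then have "?A = ?A'" using card_subset_eq[of ?A' ?A] ca by auto
    moreover from this have "v \<in> ?B \<longleftrightarrow> v \<in> ?B'" for v
      using cnt[of v] by (cases "v \<in> ?B"; cases "v \<in> ?B'") simp_all
    then have "?B = ?B'" by blast
    ultimately have "st m n f = st m n g" by (simp add: st_eq_iff)
    then have "f = g" by (rule Zplus_eqI[OF f g])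
    then show False using b bless_irrefl by blast
  qed
  then show ?thesis using f by (auto simp: bruhat_minimal_def)
qed

lemma bruhat_minimalD:
  assumes "bruhat_minimal m n f" "c < d" "st m n f c = Rgt" "st m n f d = Lft"
  shows False
proof -
  have f: "f \<in> Zplus m n" using assms(1) by (simp add: bruhat_minimal_def)
  let ?t = "(st m n f)(c := Lft, d := Rgt)"
  have fl: "flip (st m n f) ?t" using assms by (auto simp: flip_def)
  then have "valid m n ?t" using valid_flip valid_st Zplus_inj f by blast
  then obtain g where g: "g \<in> Zplus m n" "st m n g = ?t" by (rule valid_exists)
  then show False using bless_flip[OF f g(1)] fl assms(1) by (auto simp: bruhat_minimal_def)
qed

lemma flips_bless:
  assumes f: "f \<in> Zplus m n" and "flip\<^sup>*\<^sup>* (st m n f) t"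
  shows "\<exists>g\<in>Zplus m n. st m n g = t \<and> (g = f \<or> bless m n g f)"
  using assms(2)
proof (induction rule: rtranclp_induct)
  case (step t t')
  then obtain g where g: "g \<in> Zplus m n" "st m n g = t" "g = f \<or> bless m n g f" by blast
  then have "valid m n t'" using step valid_flip valid_st Zplus_inj by metis
  then obtain h where h: "h \<in> Zplus m n" "st m n h = t'" by (rule valid_exists)
  then have "bless m n h g" using bless_flip g step by metis
  then show ?case using h g bless_trans by blast
qed (use f in auto)

lemma flips_valid: "flip\<^sup>*\<^sup>* s t \<Longrightarrow> valid m n t \<longleftrightarrow> valid m n s"
  by (induction rule: rtranclp_induct) (auto dest: valid_flip)

section \<open>The support and the coefficients of an arc expansion\<close>

lemma arc_ends_disjoint:
  assumes "arc s a b" "(a, b) \<notin> M" "M \<subseteq> arcs s"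
  shows "a \<notin> ends M" "b \<notin> ends M"
proof -
  have "c \<noteq> a \<and> d \<noteq> b \<and> c \<noteq> b \<and> d \<noteq> a" if "(c, d) \<in> M" for c d
  proof -
    have cd: "arc s c d" using that assms(3) by auto
    have "c \<noteq> a" using arc_unique_right[OF assms(1), of d] cd that assms(2) by auto
    moreover have "d \<noteq> b" using arc_unique_left[OF assms(1), of c] cd that assms(2) by auto
    ultimately show ?thesis using arcD(2,3)[OF cd] arcD(2,3)[OF assms(1)] by auto
  qed
  then show "a \<notin> ends M" "b \<notin> ends M" unfolding ends_def by fastforce+
qed

text \<open>Undoing the exchange at one arc leaves a state in the expansion over the remaining arcs;
  redoing it is a single \<open>flip\<close>.\<close>

lemma uM_flips:
  assumes "finite M" "M \<subseteq> arcs s" "uM M s t \<noteq> 0"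
  shows "flip\<^sup>*\<^sup>* s t"
  using assms
proof (induction M arbitrary: t rule: finite_induct)
  case empty
  then have "t = s" by (auto simp: uM_def agree_def split: if_splits)
  then show ?case by simp
next
  case (insert z M)
  obtain a b where z: "z = (a, b)" by fastforce
  have ab: "arc s a b" "M \<subseteq> arcs s" using insert.prems z by auto
  note E = arc_ends_disjoint[OF ab(1) insert.hyps(2)[unfolded z] ab(2)]
  have s: "s a = Rgt" "s b = Lft" "a < b" using arcD[OF ab(1)] by auto
  have nz: "om (t a) (t b) * arcprod M t \<noteq> 0" and ag: "agree (insert a (insert b (ends M))) s t"
    using insert.prems(2) unfolding uM_def z arcprod_insert[OF insert.hyps(1) E(1)]
    by (auto split: if_splits)
  have o: "t a = Rgt \<and> t b = Lft \<or> t a = Lft \<and> t b = Rgt" using nz by (auto simp: om_def split: if_splits)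
  let ?t = "t(a := Rgt, b := Lft)"
  have "arcprod M ?t = arcprod M t" using E by (intro arcprod_cong) auto
  moreover have "agree (ends M) s ?t" using ag s by (auto simp: agree_def)
  ultimately have "uM M s ?t \<noteq> 0" using nz by (auto simp: uM_def)
  then have *: "flip\<^sup>*\<^sup>* s ?t" using insert.IH ab(2) by blast
  from o show ?case
  proof
    assume "t a = Rgt \<and> t b = Lft"
    then have "?t = t" by auto
    then show ?thesis using * by simp
  next
    assume "t a = Lft \<and> t b = Rgt"
    then have eq: "?t(a := Lft, b := Rgt) = t" by auto
    have "flip ?t (?t(a := Lft, b := Rgt))"
      unfolding flip_def by (rule exI[of _ a], rule exI[of _ b]) (use s(3) in simp)
    then show ?thesis using * unfolding eq by (rule rtranclp.rtrancl_into_rtrancl[rotated])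
  qed
qed

lemma Us_self [simp]:
  assumes "finite_state s"
  shows "Us s s = 1"
proof -
  have "arcprod (arcs s) s = 1"
    unfolding arcprod_def by (rule prod.neutral) (auto simp: arcD)
  then show ?thesis by (simp add: Us_def uM_def agree_def)
qed

text \<open>The exponent counts the exchanged arcs. There is at least one when \<open>t\<close>
  differs from \<open>s\<close>, so the coefficient lies in q Z[q].\<close>

lemma Us_power:
  assumes "finite_state s" "Us s t \<noteq> 0" "t \<noteq> s"
  shows "\<exists>k>0. Us s t = qq ^ k"
proof -
  have fin: "finite (arcs s)" using finite_arcs assms(1) .
  have ag: "agree (ends (arcs s)) s t" and nz: "arcprod (arcs s) t \<noteq> 0"
    using assms(2) by (auto simp: Us_def uM_def split: if_splits)
  let ?N = "{z \<in> arcs s. t (fst z) = Lft}"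
  have o: "t c = Rgt \<and> t d = Lft \<or> t c = Lft \<and> t d = Rgt" if "(c, d) \<in> arcs s" for c d
  proof -
    have "om (t c) (t d) \<noteq> 0"
    proof
      assume "om (t c) (t d) = 0"
      then have "arcprod (arcs s) t = 0" unfolding arcprod_def using fin that
        by (intro prod_zero bexI[of _ "(c, d)"]) simp_all
      then show False using nz by simp
    qed
    then show ?thesis by (auto simp: om_def split: if_splits)
  qed
  have "arcprod (arcs s) t = (\<Prod>z\<in>arcs s. if t (fst z) = Lft then qq else 1)"
    unfolding arcprod_def using o by (intro prod.cong) (force simp: om_def)+
  also have "\<dots> = qq ^ card ?N"
    using fin by (simp add: prod.If_cases Int_def)
  finally have "Us s t = qq ^ card ?N" using ag by (simp add: Us_def uM_def)
  moreover have "?N \<noteq> {}"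
  proof
    assume e: "?N = {}"
    have "t v = s v" for v
    proof (cases "v \<in> ends (arcs s)")
      case True
      then obtain c d where cd: "(c, d) \<in> arcs s" "v = c \<or> v = d" by (auto simp: ends_def)
      then have "t c = Rgt \<and> t d = Lft" using o[OF cd(1)] e by force
      then show ?thesis using cd by (auto dest: arcD)
    qed (use ag in \<open>auto simp: agree_def\<close>)
    then show False using assms(3) by auto
  qed
  ultimately show ?thesis using fin by (intro exI[of _ "card ?N"]) (auto simp: card_gt_0_iff)
qed

section \<open>Matrix coefficients of E and F in terms of labels\<close>

fun remA :: "label \<Rightarrow> label" where
  "remA Lft = Circ" | "remA Cross = Rgt" | "remA l = l"

text \<open>\<open>A\<close> refers to the set of values on the negative positions and
  \<open>B\<close> to that on the positive ones; the four functions record how a label changes when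
  its point leaves or enters such a set.\<close>

fun addA :: "label \<Rightarrow> label" where
  "addA Circ = Lft" | "addA Rgt = Cross" | "addA l = l"

fun remB :: "label \<Rightarrow> label" where
  "remB Rgt = Circ" | "remB Cross = Lft" | "remB l = l"

fun addB :: "label \<Rightarrow> label" where
  "addB Circ = Rgt" | "addB Lft = Cross" | "addB l = l"

text \<open>A shift by 1 to a free value cannot overtake another value, so the function stays
  sorted.\<close>

lemma Zplus_move:
  assumes J: "J = negpos m \<and> J' = pospos n \<or> J = pospos n \<and> J' = negpos m"
    and f: "f \<in> Zplus m n" and k: "k \<in> J" "f k = a" and b: "b \<notin> f ` J" "\<bar>b - a\<bar> = 1"
  shows "f(k := b) \<in> Zplus m n" "f(k := b) ` J = insert b (f ` J - {a})" "f(k := b) ` J' = f ` J'"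
proof -
  have inj: "inj_on f J" using Zplus_inj[OF f] J by blast
  have kJ': "k \<notin> J'" using J k(1) by auto
  have less: "(f(k := b)) i' < (f(k := b)) i" if "i \<in> J" "i' \<in> J" "f i' < f i" for i i'
  proof -
    have "f i \<noteq> b" "f i' \<noteq> b" using b(1) that by auto
    then show ?thesis using that(3) k(2) b(2) by auto
  qed
  have less': "(f(k := b)) i' < (f(k := b)) i" if "i \<in> J'" "i' \<in> J'" "f i' < f i" for i i'
    using that kJ' by auto
  have mono: "(f(k := b)) i' < (f(k := b)) i"
    if "i < i'" "i \<in> negpos m \<and> i' \<in> negpos m \<or> i \<in> pospos n \<and> i' \<in> pospos n" for i i'
    using that J less[of i i'] less'[of i i'] Zplus_neg[OF f, of i i'] Zplus_pos[OF f, of i i'] by blast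
  have "k \<in> Iset m n" using J k(1) by (auto simp: Iset_def)
  then have "(f(k := b)) i = 0" if "i \<notin> Iset m n" for i
    using Zplus_outside[OF f that] that by auto
  then show "f(k := b) \<in> Zplus m n"
    unfolding Zplus_def using mono by simp
  show "f(k := b) ` J = insert b (f ` J - {a})"
    using image_fun_upd_inj[OF inj k(1)] k(2) by simp
  show "f(k := b) ` J' = f ` J'" using kJ' by (intro image_cong) auto
qed

lemma st_move_neg:
  assumes "f \<in> Zplus m n" "k \<in> negpos m" "f k = a" "b \<notin> f ` negpos m" "\<bar>b - a\<bar> = 1"
  shows "st m n (f(k := b)) = (st m n f)(a := remA (st m n f a), b := addA (st m n f b))"
proof -
  have "a \<in> f ` negpos m" "a \<noteq> b" using assms by auto
  then show ?thesis
    unfolding st_def Zplus_move(2,3)[OF disjI1[OF conjI[OF refl refl]] assms] fun_eq_iff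
    using assms(4) by auto
qed

lemma st_move_pos:
  assumes "f \<in> Zplus m n" "k \<in> pospos n" "f k = a" "b \<notin> f ` pospos n" "\<bar>b - a\<bar> = 1"
  shows "st m n (f(k := b)) = (st m n f)(a := remB (st m n f a), b := addB (st m n f b))"
proof -
  have "a \<in> f ` pospos n" "a \<noteq> b" using assms by auto
  then show ?thesis
    unfolding st_def Zplus_move(2,3)[OF disjI2[OF conjI[OF refl refl]] assms] fun_eq_iff
    using assms(4) by auto
qed

lemma sum_fun_app: "(\<Sum>i\<in>A. F i) x = (\<Sum>i\<in>A. F i x)"
  by (induction A rule: infinite_finite_induct) auto

lemma sum_unique_value:
  fixes f :: "int \<Rightarrow> int" and G :: "int \<Rightarrow> Qq"
  assumes "inj_on f J" "finite J"
  shows "(\<Sum>k\<in>J. if f k = a \<and> P then G k else 0) = (if a \<in> f ` J \<and> P then G (THE k. k \<in> J \<and> f k = a) else 0)"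
proof (cases "a \<in> f ` J \<and> P")
  case True
  then obtain k where k: "k \<in> J" "f k = a" by auto
  have u: "k' = k" if "k' \<in> J" "f k' = a" for k' using assms(1) k that by (auto simp: inj_on_def)
  have "(THE k. k \<in> J \<and> f k = a) = k" using k u by blast
  moreover have "(\<Sum>k'\<in>J. if f k' = a \<and> P then G k' else 0) = (\<Sum>k'\<in>J. if k' = k then G k' else 0)"
  proof (rule sum.cong[OF refl])
    fix k' assume "k' \<in> J"
    then have "f k' = a \<and> P \<longleftrightarrow> k' = k" using u[of k'] k True by blast
    then show "(if f k' = a \<and> P then G k' else 0) = (if k' = k then G k' else 0)" by simp
  qed
  ultimately show ?thesis using k assms(2) True by simp
qed (auto intro!: sum.neutral)

text \<open>Injectivity leaves at most one nonzero summand, and its target is recognised by its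
  labels. This is where positions disappear from the action.\<close>

lemma sum_move:
  assumes J: "J = negpos m \<and> J' = pospos n \<or> J = pospos n \<and> J' = negpos m"
    and f: "f \<in> Zplus m n" and b: "\<bar>b - a\<bar> = 1"
    and T: "\<And>k. k \<in> J \<Longrightarrow> f k = a \<Longrightarrow> b \<notin> f ` J \<Longrightarrow> st m n (f(k := b)) = T"
  shows "(\<Sum>k\<in>J. if f k = a \<and> b \<notin> f ` J then scal c (basisK (f(k := b))) else 0) g
    = (if g \<in> Zplus m n \<and> (a \<in> f ` J \<and> b \<notin> f ` J) \<and> st m n g = T then c else 0)"
proof -
  let ?P = "a \<in> f ` J \<and> b \<notin> f ` J"
  let ?k = "THE k. k \<in> J \<and> f k = a"
  have inj: "inj_on f J" and fin: "finite J" using Zplus_inj[OF f] J by auto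
  have "(\<Sum>k\<in>J. if f k = a \<and> b \<notin> f ` J then scal c (basisK (f(k := b))) else 0) g
    = (\<Sum>k\<in>J. if f k = a \<and> b \<notin> f ` J then scal c (basisK (f(k := b))) g else 0)"
    unfolding sum_fun_app by (intro sum.cong) auto
  also have "\<dots> = (if ?P then scal c (basisK (f(?k := b))) g else 0)"
    by (rule sum_unique_value[OF inj fin])
  also have "\<dots> = (if g \<in> Zplus m n \<and> ?P \<and> st m n g = T then c else 0)"
  proof (cases ?P)
    case True
    then obtain k where k: "k \<in> J" "f k = a" by auto
    have "k' = k" if "k' \<in> J" "f k' = a" for k'
      using inj k that by (auto simp: inj_on_def)
    then have "?k = k" using k by blast
    moreover have "g = f(k := b) \<longleftrightarrow> g \<in> Zplus m n \<and> st m n g = T"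
      using Zplus_move(1)[OF J f k _ b] True T[OF k] Zplus_eqI[of g m n "f(k := b)"] by auto
    ultimately show ?thesis using True by (simp add: scal_def basisK_def)
  qed auto
  finally show ?thesis .
qed

lemma sum_move_neg:
  assumes f: "f \<in> Zplus m n" and b: "\<bar>b - a\<bar> = 1"
  shows "(\<Sum>k\<in>negpos m. if f k = a \<and> b \<notin> f ` negpos m then scal c (basisK (f(k := b))) else 0) g
    = (if g \<in> Zplus m n \<and> st m n f a \<in> {Lft, Cross} \<and> st m n f b \<in> {Rgt, Circ}
         \<and> st m n g = (st m n f)(a := remA (st m n f a), b := addA (st m n f b)) then c else 0)"
proof -
  have P: "a \<in> f ` negpos m \<and> b \<notin> f ` negpos m \<longleftrightarrow> st m n f a \<in> {Lft, Cross} \<and> st m n f b \<in> {Rgt, Circ}"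
    by (auto simp: st_def)
  have T: "st m n (f(k := b)) = (st m n f)(a := remA (st m n f a), b := addA (st m n f b))"
    if "k \<in> negpos m" "f k = a" "b \<notin> f ` negpos m" for k
    by (rule st_move_neg[OF f that b])
  show ?thesis
    by (subst sum_move[OF disjI1[OF conjI[OF refl refl]] f b T]) (simp_all only: P conj_assoc simp_thms)
qed

lemma sum_move_pos:
  assumes f: "f \<in> Zplus m n" and b: "\<bar>b - a\<bar> = 1"
  shows "(\<Sum>k\<in>pospos n. if f k = a \<and> b \<notin> f ` pospos n then scal c (basisK (f(k := b))) else 0) g
    = (if g \<in> Zplus m n \<and> st m n f a \<in> {Rgt, Cross} \<and> st m n f b \<in> {Lft, Circ}
         \<and> st m n g = (st m n f)(a := remB (st m n f a), b := addB (st m n f b)) then c else 0)"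
proof -
  have P: "a \<in> f ` pospos n \<and> b \<notin> f ` pospos n \<longleftrightarrow> st m n f a \<in> {Rgt, Cross} \<and> st m n f b \<in> {Lft, Circ}"
    by (auto simp: st_def)
  have T: "st m n (f(k := b)) = (st m n f)(a := remB (st m n f a), b := addB (st m n f b))"
    if "k \<in> pospos n" "f k = a" "b \<notin> f ` pospos n" for k
    by (rule st_move_pos[OF f that b])
  show ?thesis
    by (subst sum_move[OF disjI2[OF conjI[OF refl refl]] f b T]) (simp_all only: P conj_assoc simp_thms)
qed

lemma scal_1 [simp]: "scal 1 u = u"
  by (simp add: scal_def)

lemma upd_pair_eq: "s(a := p, a + 1 := r) = s(a := p', a + 1 := r') \<longleftrightarrow> p = p' \<and> r = r'" for a :: int
proof
  assume eq: "s(a := p, a + 1 := r) = s(a := p', a + 1 := r')"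
  show "p = p' \<and> r = r'" using fun_cong[OF eq, of a] fun_cong[OF eq, of "a + 1"] by simp
qed simp

lemma upd_pair_eq_self: "s(a := p, a + 1 := r) = s \<longleftrightarrow> p = s a \<and> r = s (a + 1)" for a :: int
  using upd_pair_eq[of s a p r "s a" "s (a + 1)"] by simp

text \<open>Comparison with the comultiplication: on the indicator function of \<open>s\<close>,
  \<open>opf\<close> gives the matrix coefficients of F and E. Here \<open>w\<close> and
  \<open>w'\<close> are the exponents of K on the left and on the right tensor factor.\<close>

lemma opf_delta:
  fixes a :: int
  defines "w \<equiv> \<lambda>s. (if s a \<in> {Lft, Cross} then 1 else 0) - (if s (a + 1) \<in> {Lft, Cross} then 1 else 0 :: int)"
    and "w' \<equiv> \<lambda>s. (if s a \<in> {Rgt, Cross} then 1 else 0) - (if s (a + 1) \<in> {Rgt, Cross} then 1 else 0 :: int)"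
  shows "opf Cross Circ a (\<lambda>r. if r = s then 1 else 0) t =
      (if s a \<in> {Lft, Cross} \<and> s (a + 1) \<in> {Rgt, Circ}
         \<and> t = s(a := remA (s a), a + 1 := addA (s (a + 1))) then 1 else 0)
    + (if s a \<in> {Rgt, Cross} \<and> s (a + 1) \<in> {Lft, Circ}
         \<and> t = s(a := remB (s a), a + 1 := addB (s (a + 1))) then qpow (w s) else 0)" (is ?F)
    "opf Circ Cross a (\<lambda>r. if r = s then 1 else 0) t =
      (if s (a + 1) \<in> {Rgt, Cross} \<and> s a \<in> {Lft, Circ}
         \<and> t = s(a := addB (s a), a + 1 := remB (s (a + 1))) then 1 else 0)
    + (if s (a + 1) \<in> {Lft, Cross} \<and> s a \<in> {Rgt, Circ}
         \<and> t = s(a := addA (s a), a + 1 := remA (s (a + 1))) then qpow (- w' s) else 0)" (is ?E)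
proof -
  have "?F \<and> ?E"
  \<comment> \<open>If \<open>t\<close> and \<open>s\<close> differ outside \<open>a\<close> and
    \<open>a + 1\<close>, everything vanishes. Otherwise the claim is a finite check over the four
    labels involved.\<close>
  proof (cases "\<exists>p r. t = s(a := p, a + 1 := r)")
    case False
    have n: "t(a := l, a + 1 := l') \<noteq> s" for l l'
    proof
      assume "t(a := l, a + 1 := l') = s"
      then have "t = s(a := t a, a + 1 := t (a + 1))" by auto
      then show False using False by blast
    qed
    have n': "t \<noteq> s(a := p, a + 1 := r)" for p r using False by blast
    have "opf x y a (\<lambda>r. if r = s then 1 else 0) t = 0" for x y
      unfolding opf_def using n by simp
    then show ?thesis using n' by simp
  next
    case True
    then obtain p r where t: "t = s(a := p, a + 1 := r)" by blast
    have t1: "t a = p" "t (a + 1) = r" using t by auto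
    have t2: "t(a := l, a + 1 := l') = s \<longleftrightarrow> l = s a \<and> l' = s (a + 1)" for l l'
      unfolding t using upd_pair_eq_self[of s a l l'] by (simp add: fun_upd_twist)
    have t3: "t = s(a := l, a + 1 := l') \<longleftrightarrow> p = l \<and> r = l'" for l l'
      unfolding t by (rule upd_pair_eq)
    have qp: "qpow 0 = 1" "qpow 1 = qq" "qpow (- 1) = inverse qq" by (simp_all add: qpow_def)
    show ?thesis
      unfolding opf_def labelled_def t1 t2 t3 w_def w'_def
      by (cases p; cases r; cases "s a"; cases "s (a + 1)") (simp_all add: qp)
  qed
  then show ?F ?E by auto
qed

lemma Fbasis_apply:
  assumes "f \<in> Zplus m n"
  shows "Fbasis m n a f g
    = (if g \<in> Zplus m n then opf Cross Circ a (\<lambda>r. if r = st m n f then 1 else 0) (st m n g) else 0)"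
proof -
  have w: "wt a (f ` negpos m)
    = (if st m n f a \<in> {Lft, Cross} then 1 else 0) - (if st m n f (a + 1) \<in> {Lft, Cross} then 1 else 0)"
    unfolding wt_def ind_def mem_negpos_st[of _ f m n] by simp
  have b: "\<bar>a + 1 - a\<bar> = 1" by simp
  show ?thesis
    unfolding Fbasis_def plus_fun_def sum_move_neg[OF assms b, of 1 g, unfolded scal_1]
      sum_move_pos[OF assms b] opf_delta(1) w
    by (cases "g \<in> Zplus m n") (simp_all only: simp_thms if_True if_False add_0)
qed

lemma Ebasis_apply:
  assumes "f \<in> Zplus m n"
  shows "Ebasis m n a f g
    = (if g \<in> Zplus m n then opf Circ Cross a (\<lambda>r. if r = st m n f then 1 else 0) (st m n g) else 0)"
proof -
  have w: "wt a (f ` pospos n)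
    = (if st m n f a \<in> {Rgt, Cross} then 1 else 0) - (if st m n f (a + 1) \<in> {Rgt, Cross} then 1 else 0)"
    unfolding wt_def ind_def mem_pospos_st[of _ f n m] by simp
  have tw: "s(a + 1 := p, a := r) = s(a := r, a + 1 := p)" for s :: "int \<Rightarrow> label" and p r
    by (rule fun_upd_twist) simp
  have b: "\<bar>a - (a + 1)\<bar> = 1" by simp
  show ?thesis
    unfolding Ebasis_def plus_fun_def sum_move_pos[OF assms b, of 1 g, unfolded scal_1]
      sum_move_neg[OF assms b] tw opf_delta(2) w
    by (cases "g \<in> Zplus m n") (simp_all only: simp_thms if_True if_False add_0)
qed

section \<open>The bar involution and the canonical basis\<close>

definition Uvec :: "nat \<Rightarrow> nat \<Rightarrow> (int \<Rightarrow> label) \<Rightarrow> vecE" where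
  "Uvec m n s = (\<lambda>g. if g \<in> Zplus m n then Us s (st m n g) else 0)"

lemma Uvec_apply: "Uvec m n s g = (if g \<in> Zplus m n then Us s (st m n g) else 0)"
  by (simp add: Uvec_def)

lemma finite_Us_support:
  assumes "finite_state s"
  shows "finite {t. Us s t \<noteq> 0}"
proof (rule inj_on_finite)
  \<comment> \<open>Given \<open>s\<close>, a state in the support is determined by its set of
    points labelled \<open>Lft\<close>.\<close>
  let ?L = "\<lambda>t :: int \<Rightarrow> label. {v. t v = Lft}"
  have sup: "(labelled t v \<longleftrightarrow> labelled s v) \<and> (\<not> labelled s v \<longrightarrow> t v = s v)" if "Us s t \<noteq> 0" for t v
    using Us_zero[OF assms, of t v] that by blast
  show "finite (Pow {v. labelled s v})" using finite_labelled[OF assms] by simp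
  show "?L ` {t. Us s t \<noteq> 0} \<subseteq> Pow {v. labelled s v}"
    using sup by (fastforce simp: labelled_def)
  show "inj_on ?L {t. Us s t \<noteq> 0}"
  proof (rule inj_onI, rule ext)
    fix t t' v assume h: "t \<in> {t. Us s t \<noteq> 0}" "t' \<in> {t. Us s t \<noteq> 0}" "?L t = ?L t'"
    then have iff: "t v = Lft \<longleftrightarrow> t' v = Lft" by blast
    have "Us s t \<noteq> 0" "Us s t' \<noteq> 0" using h(1,2) by auto
    note * = this[THEN sup, of v]
    show "t v = t' v"
    proof (cases "labelled s v")
      case True
      then have "labelled t v" "labelled t' v" using * by blast+
      then show ?thesis using iff unfolding labelled_def by metis
    next
      case False
      then show ?thesis using * by simp
    qed
  qed
qed

lemma is_vec_supp: "is_vec m n u \<Longrightarrow> finite {f. u f \<noteq> 0}" "is_vec m n u \<Longrightarrow> u f \<noteq> 0 \<Longrightarrow> f \<in> Zplus m n"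
  by (auto simp: is_vec_def)

lemma is_vecI:
  assumes "finite S" "S \<subseteq> Zplus m n" "\<And>f. f \<notin> S \<Longrightarrow> u f = 0"
  shows "is_vec m n u"
  unfolding is_vec_def using assms by (auto intro: finite_subset)

lemma is_vec_0 [simp]: "is_vec m n 0"
  by (rule is_vecI[of "{}"]) auto

lemma is_vec_add: "is_vec m n u \<Longrightarrow> is_vec m n v \<Longrightarrow> is_vec m n (u + v)"
  by (rule is_vecI[of "{f. u f \<noteq> 0} \<union> {f. v f \<noteq> 0}"]) (auto simp: is_vec_def)

lemma is_vec_scal: "is_vec m n u \<Longrightarrow> is_vec m n (scal c u)"
  by (rule is_vecI[of "{f. u f \<noteq> 0}"]) (auto simp: is_vec_def scal_def)

lemma is_vec_basisK [simp]: "f \<in> Zplus m n \<Longrightarrow> is_vec m n (basisK f)"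
  by (rule is_vecI[of "{f}"]) (auto simp: basisK_def)

lemma is_vec_sum: "(\<And>i. i \<in> A \<Longrightarrow> is_vec m n (F i)) \<Longrightarrow> is_vec m n (\<Sum>i\<in>A. F i)"
  by (induction A rule: infinite_finite_induct) (simp_all add: is_vec_add)

lemma is_vec_Uvec [simp]:
  assumes "finite_state s"
  shows "is_vec m n (Uvec m n s)"
proof (rule is_vecI)
  have "inj_on (st m n) (Zplus m n)" by (rule inj_onI) (rule Zplus_eqI)
  then have "inj_on (st m n) {g \<in> Zplus m n. Us s (st m n g) \<noteq> 0}" by (rule inj_on_subset) auto
  then show "finite {g \<in> Zplus m n. Us s (st m n g) \<noteq> 0}"
    by (rule inj_on_finite[OF _ _ finite_Us_support[OF assms]]) auto
qed (auto simp: Uvec_def)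

lemma vec_decompose:
  assumes "is_vec m n u"
  shows "u = (\<Sum>f\<in>{f. u f \<noteq> 0}. scal (u f) (basisK f))"
proof
  fix g
  have "(\<Sum>f\<in>{f. u f \<noteq> 0}. scal (u f) (basisK f)) g = (\<Sum>f\<in>{f. u f \<noteq> 0}. if f = g then u g else 0)"
    unfolding sum_fun_app by (intro sum.cong) (auto simp: scal_def basisK_def)
  then show "u g = (\<Sum>f\<in>{f. u f \<noteq> 0}. scal (u f) (basisK f)) g"
    using is_vec_supp(1)[OF assms] by simp
qed

lemma Uvec_self: "f \<in> Zplus m n \<Longrightarrow> Uvec m n (st m n f) f = 1"
  by (simp add: Uvec_def)

lemma Uvec_bless:
  assumes "f \<in> Zplus m n" "Uvec m n (st m n f) g \<noteq> 0" "g \<noteq> f"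
  shows "g \<in> Zplus m n" "bless m n g f" "\<exists>k>0. Uvec m n (st m n f) g = qq ^ k"
proof -
  show g: "g \<in> Zplus m n" using assms(2) by (auto simp: Uvec_def split: if_splits)
  then have nz: "Us (st m n f) (st m n g) \<noteq> 0" using assms(2) by (simp add: Uvec_def)
  then have "flip\<^sup>*\<^sup>* (st m n f) (st m n g)"
    unfolding Us_def by (intro uM_flips[OF finite_arcs]) auto
  then obtain h where "h \<in> Zplus m n" "st m n h = st m n g" "h = f \<or> bless m n h f"
    using flips_bless[OF assms(1)] by blast
  then show "bless m n g f" using Zplus_eqI[OF _ g] assms(3) by blast
  have "st m n g \<noteq> st m n f" using Zplus_eqI[OF g assms(1)] assms(3) by blast
  then show "\<exists>k>0. Uvec m n (st m n f) g = qq ^ k"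
    using Us_power[OF finite_state_st nz] g by (simp add: Uvec_def)
qed

text \<open>The family \<open>Uvec\<close> is unitriangular over \<open>basisK\<close>, which is
  inverted by induction on \<open>mu\<close>. As \<open>P\<close> is an arbitrary property closed
  under sums and multiples, identities between antilinear maps are covered as well.\<close>

lemma vec_span:
  assumes zero: "P 0"
    and add: "\<And>u v. is_vec m n u \<Longrightarrow> is_vec m n v \<Longrightarrow> P u \<Longrightarrow> P v \<Longrightarrow> P (u + v)"
    and scal: "\<And>c u. is_vec m n u \<Longrightarrow> P u \<Longrightarrow> P (scal c u)"
    and U: "\<And>f. f \<in> Zplus m n \<Longrightarrow> P (Uvec m n (st m n f))"
    and u: "is_vec m n u"
  shows "P u"
proof -
  have sum: "P (\<Sum>i\<in>A. F i)" if "\<And>i. i \<in> A \<Longrightarrow> is_vec m n (F i) \<and> P (F i)" for A and F :: "(int \<Rightarrow> int) \<Rightarrow> vecE"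
    using that by (induction A rule: infinite_finite_induct) (auto intro!: zero add is_vec_sum)
  have K: "P (basisK f)" if "f \<in> Zplus m n" for f
    using that
  proof (induction "mu m n f" arbitrary: f rule: less_induct)
    case less
    let ?u = "Uvec m n (st m n f)"
    let ?S = "{g. ?u g \<noteq> 0}"
    have fin: "finite ?S" using is_vec_supp[OF is_vec_Uvec] by simp
    have "f \<in> ?S" using Uvec_self[OF less.prems] by simp
    define Z where "Z = (\<Sum>g\<in>?S - {f}. scal (?u g) (basisK g))"
    have uZ: "?u = basisK f + Z"
      unfolding Z_def using \<open>f \<in> ?S\<close> vec_decompose[of m n ?u] sum.remove[OF fin, of f "\<lambda>g. scal (?u g) (basisK g)"]
        Uvec_self[OF less.prems] by simp
    have eq: "basisK f = ?u + scal (- 1) Z"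
    proof
      fix g
      show "basisK f g = (?u + scal (- 1) Z) g" using fun_cong[OF uZ, of g] by (simp add: scal_def)
    qed
    have v: "is_vec m n (scal (?u g) (basisK g)) \<and> P (scal (?u g) (basisK g))" if "g \<in> ?S - {f}" for g
    proof -
      have g: "g \<in> Zplus m n" "bless m n g f" using Uvec_bless[OF less.prems] that by auto
      then show ?thesis using less.hyps[OF bless_mu] by (simp add: scal is_vec_scal)
    qed
    have "is_vec m n Z" unfolding Z_def using v by (intro is_vec_sum) blast
    moreover have "P Z" unfolding Z_def using v by (intro sum) blast
    ultimately have "P (?u + scal (- 1) Z)"
      using less.prems by (intro add scal is_vec_scal U) simp_all
    then show ?case using eq by simp
  qed
  have "P (\<Sum>f\<in>{f. u f \<noteq> 0}. scal (u f) (basisK f))"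
    using is_vec_supp(2)[OF u] K by (intro sum) (simp add: scal is_vec_scal)
  then show ?thesis using vec_decompose[OF u] by simp
qed

lemma lin_ext_superset:
  assumes "finite S" "{f. u f \<noteq> 0} \<subseteq> S"
  shows "lin_ext B u g = (\<Sum>f\<in>S. u f * B f g)"
  unfolding lin_ext_def using assms by (intro sum.mono_neutral_left) auto

lemma lin_ext_add:
  assumes "finite {f. u f \<noteq> 0}" "finite {f. v f \<noteq> 0}"
  shows "lin_ext B (u + v) = lin_ext B u + lin_ext B v"
proof
  fix g
  let ?S = "{f. u f \<noteq> 0} \<union> {f. v f \<noteq> 0}"
  have S: "finite ?S" using assms by simp
  show "lin_ext B (u + v) g = (lin_ext B u + lin_ext B v) g"
  proof -
    have "{f. u f \<noteq> 0} \<subseteq> ?S" "{f. v f \<noteq> 0} \<subseteq> ?S" "{f. (u + v) f \<noteq> 0} \<subseteq> ?S" by auto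
    note * = this[THEN lin_ext_superset[OF S]]
    show ?thesis unfolding plus_fun_apply[of "lin_ext B u"] * by (simp add: distrib_right sum.distrib)
  qed
qed

lemma lin_ext_scal:
  assumes "finite {f. u f \<noteq> 0}"
  shows "lin_ext B (scal c u) = scal c (lin_ext B u)"
proof
  fix g
  show "lin_ext B (scal c u) g = scal c (lin_ext B u) g"
    using lin_ext_superset[OF assms, of u B g] lin_ext_superset[OF assms, of "scal c u" B g]
    by (auto simp: scal_def sum_distrib_left mult.assoc)
qed

lemma lin_ext_eq_sum: "lin_ext B u = (\<Sum>f\<in>{f. u f \<noteq> 0}. scal (u f) (B f))"
  by (rule ext) (simp add: lin_ext_def sum_fun_app scal_def)

lemma is_vec_lin_ext:
  assumes "is_vec m n u" "\<And>f. f \<in> Zplus m n \<Longrightarrow> is_vec m n (B f)"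
  shows "is_vec m n (lin_ext B u)"
  unfolding lin_ext_eq_sum using assms is_vec_supp(2)[OF assms(1)] by (intro is_vec_sum is_vec_scal) auto

text \<open>Carries a vector over to a coefficient function on all label functions, the form on
  which \<open>opf\<close> acts.\<close>

definition hat :: "nat \<Rightarrow> nat \<Rightarrow> vecE \<Rightarrow> (int \<Rightarrow> label) \<Rightarrow> Qq" where
  "hat m n u r = (\<Sum>f\<in>{f. u f \<noteq> 0}. u f * (if r = st m n f then 1 else 0))"

lemma opf_sum: "opf x y a (\<lambda>r. \<Sum>i\<in>I. c i * v i r) t = (\<Sum>i\<in>I. c i * opf x y a (v i) t)"
  unfolding opf_def by (auto simp: sum_distrib_left sum.distrib algebra_simps intro!: sum.cong)

lemma lin_ext_opf:
  assumes "is_vec m n u"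
    and "\<And>f. f \<in> Zplus m n \<Longrightarrow> B f g
      = (if g \<in> Zplus m n then opf x y a (\<lambda>r. if r = st m n f then 1 else 0) (st m n g) else 0)"
  shows "lin_ext B u g = (if g \<in> Zplus m n then opf x y a (hat m n u) (st m n g) else 0)"
proof -
  have "lin_ext B u g = (\<Sum>f\<in>{f. u f \<noteq> 0}. u f * (if g \<in> Zplus m n
      then opf x y a (\<lambda>r. if r = st m n f then 1 else 0) (st m n g) else 0))"
    unfolding lin_ext_def by (intro sum.cong refl) (simp add: assms(2) is_vec_supp(2)[OF assms(1)])
  moreover have "opf x y a (hat m n u) t
    = (\<Sum>f\<in>{f. u f \<noteq> 0}. u f * opf x y a (\<lambda>r. if r = st m n f then 1 else 0) t)" for t
    unfolding hat_def opf_sum ..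
  ultimately show ?thesis by simp
qed

lemma act_apply:
  assumes "is_vec m n u"
  shows "Fact m n a u g = (if g \<in> Zplus m n then opf Cross Circ a (hat m n u) (st m n g) else 0)"
    and "Eact m n a u g = (if g \<in> Zplus m n then opf Circ Cross a (hat m n u) (st m n g) else 0)"
  unfolding Fact_def Eact_def
  by (rule lin_ext_opf[OF assms], rule Fbasis_apply, assumption)
    (rule lin_ext_opf[OF assms], rule Ebasis_apply, assumption)

lemma Us_valid:
  assumes "finite_state s" "Us s t \<noteq> 0"
  shows "valid m n t \<longleftrightarrow> valid m n s"
  using assms uM_flips[OF finite_arcs[OF assms(1)] order_refl] flips_valid unfolding Us_def by blast

text \<open>Exchanges preserve \<open>valid\<close>, so restricting \<open>Us s\<close> to labels of
  weights loses none of its support.\<close>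

lemma hat_Uvec:
  assumes "valid m n s"
  shows "hat m n (Uvec m n s) = Us s"
proof
  fix r
  have fs: "finite_state s" using assms by (simp add: valid_def)
  show "hat m n (Uvec m n s) r = Us s r"
  proof (cases "Us s r = 0")
    case True
    have "(\<Sum>f\<in>{f. Uvec m n s f \<noteq> 0}. Uvec m n s f * (if r = st m n f then 1 else 0)) = 0"
      by (rule sum.neutral) (use True in \<open>auto simp: Uvec_def\<close>)
    then show ?thesis using True by (simp add: hat_def)
  next
    case False
    then have "valid m n r" using Us_valid[OF fs False] assms by simp
    then obtain h where h: "h \<in> Zplus m n" "st m n h = r" by (rule valid_exists)
    have eq: "Uvec m n s f * (if r = st m n f then 1 else 0) = (if f = h then Uvec m n s h else 0)" for f
    proof (cases "f \<in> Zplus m n")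
      case True
      then have "r = st m n f \<longleftrightarrow> f = h" using h(2) Zplus_eqI[OF True h(1)] by metis
      then show ?thesis by simp
    next
      case False
      then show ?thesis using h by (auto simp: Uvec_def)
    qed
    have "h \<in> {f. Uvec m n s f \<noteq> 0}" using False h by (simp add: Uvec_def)
    then show ?thesis
      unfolding hat_def eq using is_vec_supp(1)[OF is_vec_Uvec[OF fs]] h by (simp add: Uvec_def)
  qed
qed

lemma act_Uvec:
  assumes "valid m n s" "X = Fact m n a \<or> X = Eact m n a"
  obtains c s' where "valid m n s'" "bar_q c = c" "X (Uvec m n s) = scal c (Uvec m n s')"
proof -
  have fs: "finite_state s" using assms by (simp add: valid_def)
  obtain x y where xy: "opposite x y"
    "\<And>g. X (Uvec m n s) g = (if g \<in> Zplus m n then opf x y a (Us s) (st m n g) else 0)"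
    using assms(2)
  proof
    assume "X = Fact m n a"
    then show thesis using that[of Cross Circ] act_apply(1)[OF is_vec_Uvec[OF fs], of m n a] hat_Uvec[OF assms(1)]
      by (simp add: opposite_def)
  next
    assume "X = Eact m n a"
    then show thesis using that[of Circ Cross] act_apply(2)[OF is_vec_Uvec[OF fs], of m n a] hat_Uvec[OF assms(1)]
      by (simp add: opposite_def)
  qed
  obtain c s' where c: "bar_q c = c" "\<And>t. opf x y a (Us s) t = c * Us s' t" "finite_state s'"
    using opf_Us[OF fs xy(1)] by blast
  have eq: "X (Uvec m n s) = scal c (Uvec m n s')"
    by (rule ext) (simp add: xy(2) c(2) scal_def Uvec_apply)
  show thesis
  \<comment> \<open>The target can be invalid, for instance after contracting two equal labels. Its
    vector is then 0, so the coefficient 0 with the valid state \<open>s\<close> serves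
    instead.\<close>
  proof (cases "valid m n s'")
    case True
    then show thesis using that c eq by blast
  next
    case False
    have "Uvec m n s' g = 0" for g
    proof (cases "g \<in> Zplus m n")
      case True
      then have "valid m n (st m n g)" using valid_st Zplus_inj by blast
      then show ?thesis using Us_valid[OF c(3)] False by (auto simp: Uvec_def)
    qed (simp add: Uvec_def)
    then have "X (Uvec m n s) = scal 0 (Uvec m n s)" using eq by (auto simp: scal_def fun_eq_iff)
    then show thesis using that[of s 0] assms(1) by simp
  qed
qed

text \<open>The image of \<open>basisK f\<close> under the bar map, found by solving the invariance
  of \<open>Uvec\<close> for its leading term. The bound on \<open>mu\<close> gives termination; for
  \<open>f\<close> in \<open>Zplus\<close> it selects precisely the support without
  \<open>f\<close>.\<close>

function barK :: "nat \<Rightarrow> nat \<Rightarrow> (int \<Rightarrow> int) \<Rightarrow> vecE" where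
  "barK m n f = Uvec m n (st m n f) + scal (- 1)
     (\<Sum>g\<in>{g. Uvec m n (st m n f) g \<noteq> 0 \<and> mu m n g < mu m n f}.
        scal (bar_q (Uvec m n (st m n f) g)) (barK m n g))"
  by pat_completeness auto
termination by (relation "measure (\<lambda>(m, n, f). mu m n f)") auto

declare barK.simps [simp del]

lemma barK_properties:
  assumes "f \<in> Zplus m n"
  shows "is_vec m n (barK m n f) \<and> barK m n f f = 1 \<and>
    (\<forall>g. laurent (barK m n f g) \<and> (barK m n f g \<noteq> 0 \<longrightarrow> g \<in> Zplus m n \<and> (g = f \<or> bless m n g f)))"
  using assms
proof (induction "mu m n f" arbitrary: f rule: less_induct)
  case less
  let ?u = "Uvec m n (st m n f)"
  let ?S = "{g. ?u g \<noteq> 0 \<and> mu m n g < mu m n f}"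
  have S: "g \<in> Zplus m n \<and> bless m n g f \<and> (\<exists>k. ?u g = qq ^ k)" if "g \<in> ?S" for g
    using Uvec_bless[OF less.prems, of g] that by auto
  have IH: "is_vec m n (barK m n g)" "laurent (barK m n g h)"
    "barK m n g h \<noteq> 0 \<Longrightarrow> h \<in> Zplus m n \<and> (h = g \<or> bless m n h g)" if "g \<in> ?S" for g h
    using less.hyps[of g] S[OF that] that by auto
  have app: "barK m n f g = ?u g - (\<Sum>h\<in>?S. bar_q (?u h) * barK m n h g)" for g
    by (subst barK.simps) (simp add: sum_fun_app scal_def)
  have tri: "barK m n h g \<noteq> 0 \<Longrightarrow> g \<in> Zplus m n \<and> bless m n g f" if "h \<in> ?S" for h g
    using IH(3)[OF that] S[OF that] bless_trans by blast
  have "is_vec m n (barK m n f)"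
    by (subst barK.simps, intro is_vec_add is_vec_scal is_vec_sum is_vec_Uvec)
      (use IH(1) in simp_all)
  moreover have "barK m n f f = 1"
  proof -
    have "(\<Sum>h\<in>?S. bar_q (?u h) * barK m n h f) = 0"
    proof (rule sum.neutral, rule ballI)
      fix h assume "h \<in> ?S"
      then have "barK m n h f = 0" using tri[of h f] bless_irrefl[of m n f] by blast
      then show "bar_q (?u h) * barK m n h f = 0" by simp
    qed
    then show ?thesis using app[of f] Uvec_self[OF less.prems] by simp
  qed
  moreover have "laurent (barK m n f g)" for g
  proof -
    have "laurent (?u g)"
      using Uvec_bless(3)[OF less.prems, of g] Uvec_self[OF less.prems] laurent_qq_power
      by (cases "?u g = 0"; cases "g = f") auto
    moreover have "laurent (\<Sum>h\<in>?S. bar_q (?u h) * barK m n h g)"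
    proof (rule laurent_sum)
      fix h assume hS: "h \<in> ?S"
      obtain k where "?u h = qq ^ k" using S[OF hS] by blast
      then show "laurent (bar_q (?u h) * barK m n h g)" using IH(2)[OF hS] laurent_inverse_qq_power
        by (simp add: bar_q_power laurent_mult)
    qed
    ultimately show ?thesis
      unfolding app diff_conv_add_uminus by (rule laurent_add[OF _ laurent_uminus])
  qed
  moreover have "g \<in> Zplus m n \<and> (g = f \<or> bless m n g f)" if "barK m n f g \<noteq> 0" for g
  proof (cases "?u g = 0")
    case True
    then have "\<exists>h\<in>?S. bar_q (?u h) * barK m n h g \<noteq> 0"
      using that app[of g] sum.neutral[of ?S "\<lambda>h. bar_q (?u h) * barK m n h g"] by auto
    then show ?thesis using tri by fastforce
  next
    case False
    then show ?thesis using Uvec_bless[OF less.prems, of g] less.prems by blast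
  qed
  ultimately show ?case by blast
qed

text \<open>Coefficients are conjugated before the linear extension, which makes the map antilinear.
  The value 0 outside the space is the one that \<open>is_bar_inv\<close> prescribes.\<close>

definition psi :: "nat \<Rightarrow> nat \<Rightarrow> vecE \<Rightarrow> vecE" where
  "psi m n u = (if is_vec m n u then lin_ext (barK m n) (\<lambda>f. bar_q (u f)) else 0)"

lemma bar_q_eq_0_iff [simp]: "bar_q x = 0 \<longleftrightarrow> x = 0"
  by (metis bar_q_0 bar_q_bar_q)

lemma psi_Uvec:
  assumes f: "f \<in> Zplus m n"
  shows "psi m n (Uvec m n (st m n f)) = Uvec m n (st m n f)"
proof -
  let ?u = "Uvec m n (st m n f)"
  let ?S = "{g. ?u g \<noteq> 0 \<and> mu m n g < mu m n f}"
  have fin: "finite {g. ?u g \<noteq> 0}" using is_vec_supp[OF is_vec_Uvec] by simp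
  have S: "{g. ?u g \<noteq> 0} = insert f ?S"
  proof -
    have "mu m n g < mu m n f" if "?u g \<noteq> 0" "g \<noteq> f" for g
      using bless_mu[OF Uvec_bless(2)[OF f that]] .
    then show ?thesis using Uvec_self[OF f] by auto
  qed
  have finS: "finite ?S" by (rule finite_subset[OF _ fin]) auto
  have "psi m n ?u = (\<Sum>g\<in>insert f ?S. scal (bar_q (?u g)) (barK m n g))"
    unfolding psi_def lin_ext_eq_sum S[symmetric] by simp
  also have "\<dots> = barK m n f + (\<Sum>g\<in>?S. scal (bar_q (?u g)) (barK m n g))"
    using finS by (simp add: Uvec_self[OF f])
  also have "\<dots> = ?u"
    by (subst barK.simps) (simp add: scal_def fun_eq_iff)
  finally show ?thesis .
qed

lemma psi_add:
  assumes "is_vec m n u" "is_vec m n v"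
  shows "psi m n (u + v) = psi m n u + psi m n v"
proof -
  have "(\<lambda>f. bar_q ((u + v) f)) = (\<lambda>f. bar_q (u f)) + (\<lambda>f. bar_q (v f))"
    by (simp add: fun_eq_iff bar_q_add)
  then show ?thesis
    using assms is_vec_supp(1)[OF assms(1)] is_vec_supp(1)[OF assms(2)]
    by (simp add: psi_def is_vec_add lin_ext_add)
qed

lemma psi_scal:
  assumes "is_vec m n u"
  shows "psi m n (scal c u) = scal (bar_q c) (psi m n u)"
proof -
  have "(\<lambda>f. bar_q (scal c u f)) = scal (bar_q c) (\<lambda>f. bar_q (u f))"
    by (simp add: fun_eq_iff bar_q_mult scal_def)
  then show ?thesis
    using assms is_vec_supp(1)[OF assms] by (simp add: psi_def is_vec_scal lin_ext_scal)
qed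

lemma is_vec_psi:
  assumes "is_vec m n u"
  shows "is_vec m n (psi m n u)"
proof -
  have "is_vec m n (\<lambda>f. bar_q (u f))" using assms by (simp add: is_vec_def)
  then show ?thesis using is_vec_lin_ext barK_properties assms by (simp add: psi_def)
qed

lemma Kact_apply:
  "Kact m n a u g = qpow (wt a (g ` negpos m) + wt a (g ` pospos n)) * u g" (is ?K)
  "Kinvact m n a u g = qpow (- (wt a (g ` negpos m) + wt a (g ` pospos n))) * u g" (is ?I)
  if "finite {f. u f \<noteq> 0}"
proof -
  have "(\<Sum>f\<in>{f. u f \<noteq> 0}. u f * scal (c f) (basisK f) g) = c g * u g" for c
  proof -
    have "(\<Sum>f\<in>{f. u f \<noteq> 0}. u f * scal (c f) (basisK f) g) = (\<Sum>f\<in>{f. u f \<noteq> 0}. if f = g then c g * u g else 0)"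
      by (intro sum.cong) (auto simp: scal_def basisK_def)
    then show ?thesis using that by simp
  qed
  then show ?K ?I
    unfolding Kact_def Kinvact_def lin_ext_def Kbasis_def Kinvbasis_def by simp_all
qed

lemma linear_act:
  assumes "X \<in> {Fact m n a, Eact m n a, Kact m n a, Kinvact m n a}"
  shows "is_vec m n u \<Longrightarrow> is_vec m n v \<Longrightarrow> X (u + v) = X u + X v"
    "is_vec m n u \<Longrightarrow> X (scal c u) = scal c (X u)"
    "is_vec m n u \<Longrightarrow> is_vec m n (X u)"
proof -
  obtain B where B: "X = lin_ext B" "\<And>f. f \<in> Zplus m n \<Longrightarrow> is_vec m n (B f)"
  proof -
    have "is_vec m n (Fbasis m n a f)" "is_vec m n (Ebasis m n a f)" "is_vec m n (Kbasis m n a f)"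
      "is_vec m n (Kinvbasis m n a f)" if f: "f \<in> Zplus m n" for f
    proof -
      have move: "is_vec m n (if f k = a \<and> b \<notin> f ` J then scal c (basisK (f(k := b))) else 0)"
        if "J = negpos m \<and> J' = pospos n \<or> J = pospos n \<and> J' = negpos m" "\<bar>b - a\<bar> = 1" "k \<in> J"
        for J J' k b a c
      proof (cases "f k = a \<and> b \<notin> f ` J")
        case True
        then have "f(k := b) \<in> Zplus m n" using Zplus_move(1)[OF that(1) f that(3) _ _ that(2)] by blast
        then show ?thesis by (simp add: is_vec_scal)
      next
        case False
        then show ?thesis by (simp only: if_False is_vec_0)
      qed
      note 1 = move[OF disjI1[OF conjI[OF refl refl]]] and 2 = move[OF disjI2[OF conjI[OF refl refl]]]
      show "is_vec m n (Fbasis m n a f)" unfolding Fbasis_def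
        by (intro is_vec_add is_vec_sum 1[where c = 1, unfolded scal_1] 2) auto
      show "is_vec m n (Ebasis m n a f)" unfolding Ebasis_def
        by (intro is_vec_add is_vec_sum 1 2[where c = 1, unfolded scal_1]) auto
      show "is_vec m n (Kbasis m n a f)" "is_vec m n (Kinvbasis m n a f)"
        using f by (simp_all add: Kbasis_def Kinvbasis_def is_vec_scal)
    qed
    then show thesis using that assms unfolding Fact_def Eact_def Kact_def Kinvact_def by blast
  qed
  show "is_vec m n u \<Longrightarrow> is_vec m n v \<Longrightarrow> X (u + v) = X u + X v"
    "is_vec m n u \<Longrightarrow> X (scal c u) = scal c (X u)" "is_vec m n u \<Longrightarrow> is_vec m n (X u)"
    unfolding B(1) using is_vec_supp(1)[of m n] by (simp_all add: lin_ext_add lin_ext_scal is_vec_lin_ext B(2))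
qed

text \<open>An exchange does not change how often a point occurs on both sides together, so an arc
  expansion is an eigenvector of K.\<close>

lemma weight_Uvec:
  assumes "Uvec m n s g \<noteq> 0" "finite_state s" "Uvec m n s h \<noteq> 0"
  shows "wt a (g ` negpos m) + wt a (g ` pospos n) = wt a (h ` negpos m) + wt a (h ` pospos n)"
proof -
  have c: "ind v (f ` negpos m) + ind v (f ` pospos n)
      = (if labelled s v then 1 else if s v = Cross then 2 else 0)" if "Uvec m n s f \<noteq> 0" for f v
  proof -
    have nz: "Us s (st m n f) \<noteq> 0" using that by (auto simp: Uvec_def split: if_splits)
    show ?thesis
      using Us_zero[OF assms(2), of "st m n f" v] nz
      unfolding ind_def mem_negpos_st[of v f m n] mem_pospos_st[of v f n m]
      by (cases "st m n f v"; cases "s v") auto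
  qed
  show ?thesis
    unfolding wt_def using c[OF assms(1), of a] c[OF assms(1), of "a + 1"] c[OF assms(3), of a] c[OF assms(3), of "a + 1"]
    by linarith
qed

lemma Uvec_eq_basisK:
  assumes "f \<in> Zplus m n" "\<And>c d. c < d \<Longrightarrow> st m n f c = Rgt \<Longrightarrow> st m n f d = Lft \<Longrightarrow> False"
  shows "Uvec m n (st m n f) = basisK f"
proof
  fix g
  have "arcs (st m n f) = {}" using assms(2) by (auto simp: arcs_def dest: arcD)
  then have "Us (st m n f) t = (if t = st m n f then 1 else 0)" for t
    by (auto simp: Us_def uM_def agree_def arcprod_def)
  then show "Uvec m n (st m n f) g = basisK f g"
    using Zplus_eqI[OF _ assms(1)] assms(1) by (auto simp: Uvec_def basisK_def)
qed

lemma is_bar_inv_psi: "is_bar_inv m n (psi m n)"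
  unfolding is_bar_inv_def
proof (intro conjI allI ballI impI)
  show "psi m n u = 0" if "\<not> is_vec m n u" for u using that by (simp add: psi_def)
  show "is_vec m n (psi m n u)" if "is_vec m n u" for u by (rule is_vec_psi[OF that])
  show "psi m n (u + v) = psi m n u + psi m n v" if "is_vec m n u" "is_vec m n v" for u v
    by (rule psi_add[OF that])
  show "psi m n (scal c u) = scal (bar_q c) (psi m n u)" if "is_vec m n u" for c u
    by (rule psi_scal[OF that])
  have psi0: "psi m n 0 = 0" by (simp add: psi_def lin_ext_def fun_eq_iff)
  show "psi m n (psi m n u) = u" if "is_vec m n u" for u
    by (rule vec_span[where P = "\<lambda>u. psi m n (psi m n u) = u", OF _ _ _ _ that])
      (simp_all add: psi_add psi_scal is_vec_psi psi_Uvec psi0)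
  \<comment> \<open>Commutation with an operator is reduced to the vectors \<open>Uvec\<close>.
    Separate \<open>X\<close> and \<open>Y\<close> are needed for K, which the bar map turns into
    its inverse.\<close>
  have comm: "psi m n (X u) = Y (psi m n u)"
    if X: "X \<in> {Fact m n a, Eact m n a, Kact m n a, Kinvact m n a}"
      and Y: "Y \<in> {Fact m n a, Eact m n a, Kact m n a, Kinvact m n a}"
      and U: "\<And>f. f \<in> Zplus m n \<Longrightarrow> psi m n (X (Uvec m n (st m n f))) = Y (Uvec m n (st m n f))"
      and u: "is_vec m n u" for X Y a u
  proof (rule vec_span[where P = "\<lambda>u. psi m n (X u) = Y (psi m n u)", OF _ _ _ _ u])
    have z: "X 0 = 0" if "X \<in> {Fact m n a, Eact m n a, Kact m n a, Kinvact m n a}" for X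
      using linear_act(2)[OF that is_vec_0, of 0] by (simp add: scal_def zero_fun_def)
    show "psi m n (X 0) = Y (psi m n 0)" using z[OF X] z[OF Y] psi0 by simp
  qed (simp_all add: linear_act[OF X] linear_act[OF Y] psi_add psi_scal is_vec_psi psi_Uvec U)
  have vst: "valid m n (st m n f)" if "f \<in> Zplus m n" for f using valid_st Zplus_inj that by blast
  have fixU: "psi m n (X (Uvec m n (st m n f))) = X (Uvec m n (st m n f))"
    if XF: "X = Fact m n a \<or> X = Eact m n a" "f \<in> Zplus m n" for X a f
  proof -
    obtain c s' where c: "valid m n s'" "bar_q c = c" "X (Uvec m n (st m n f)) = scal c (Uvec m n s')"
      using act_Uvec[OF vst[OF XF(2)] XF(1)] by blast
    obtain h where h: "h \<in> Zplus m n" "st m n h = s'" using valid_exists[OF c(1)] by blast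
    have "psi m n (Uvec m n s') = Uvec m n s'" using psi_Uvec[OF h(1)] h(2) by simp
    moreover have "is_vec m n (Uvec m n s')" using c(1) by (simp add: valid_def)
    ultimately show ?thesis using c by (simp add: psi_scal)
  qed
  show "psi m n (Eact m n a u) = Eact m n a (psi m n u)" if "is_vec m n u" for a u
    by (rule comm[OF _ _ _ that]) (use fixU in auto)
  show "psi m n (Fact m n a u) = Fact m n a (psi m n u)" if "is_vec m n u" for a u
    by (rule comm[OF _ _ _ that]) (use fixU in auto)
  show "psi m n (Kact m n a u) = Kinvact m n a (psi m n u)" if "is_vec m n u" for a u
  proof (rule comm[OF _ _ _ that])
    fix f assume f: "f \<in> Zplus m n"
    let ?u = "Uvec m n (st m n f)" and ?w = "\<lambda>g. wt a (g ` negpos m) + wt a (g ` pospos n)"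
    have fin: "finite {f. ?u f \<noteq> 0}" using is_vec_supp[OF is_vec_Uvec] by simp
    have w: "qpow (?w g) * ?u g = qpow (?w f) * ?u g \<and> qpow (- ?w g) * ?u g = qpow (- ?w f) * ?u g" for g
      using weight_Uvec[of m n "st m n f" g f a] Uvec_self[OF f] by (cases "?u g = 0") auto
    have "Kact m n a ?u = scal (qpow (?w f)) ?u" "Kinvact m n a ?u = scal (qpow (- ?w f)) ?u"
      using w by (simp_all add: fun_eq_iff Kact_apply[OF fin] scal_def)
    then show "psi m n (Kact m n a ?u) = Kinvact m n a ?u"
      by (simp add: psi_scal psi_Uvec[OF f] bar_q_qpow)
  qed auto
  show "psi m n (basisK f) = basisK f" if b: "bruhat_minimal m n f" for f
  proof -
    have f: "f \<in> Zplus m n" using b by (simp add: bruhat_minimal_def)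
    have "Uvec m n (st m n f) = basisK f" using Uvec_eq_basisK[OF f] bruhat_minimalD[OF b] by blast
    then show ?thesis using psi_Uvec[OF f] by simp
  qed
  have psiK: "psi m n (basisK f) = barK m n f" if "f \<in> Zplus m n" for f
  proof -
    have "{g. bar_q (basisK f g) \<noteq> 0} = {f}" by (auto simp: basisK_def)
    moreover have "basisK f f = 1" by (simp add: basisK_def)
    ultimately show ?thesis using that by (simp add: psi_def lin_ext_eq_sum)
  qed
  fix f g assume f: "f \<in> Zplus m n"
  note bp = barK_properties[OF f]
  have dg: "(psi m n (basisK f) - basisK f) g = barK m n f g - (if g = f then 1 else 0)"
    by (simp add: psiK[OF f]) (simp add: basisK_def)
  show "laurent ((psi m n (basisK f) - basisK f) g)"
    unfolding dg using bp laurent_add[OF _ laurent_uminus[OF laurent_1]] by auto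
  assume "(psi m n (basisK f) - basisK f) g \<noteq> 0"
  then have "g \<noteq> f" "barK m n f g \<noteq> 0" unfolding dg using bp by (auto split: if_splits)
  then show "g \<in> Zplus m n" "bless m n g f" using bp by auto
qed

section \<open>Uniqueness of the bar involution\<close>

lemma valid_swap_adjacent:
  fixes a :: int
  assumes "valid m n s"
  shows "valid m n (s(a := s (a + 1), a + 1 := s a))"
proof -
  let ?\<tau> = "id(a := a + 1, a + 1 := a)"
  define s' where "s' = s(a := s (a + 1), a + 1 := s a)"
  have e: "s' = s \<circ> ?\<tau>" by (auto simp: s'_def)
  have c: "card {v. s' v \<in> X} = card {v. s v \<in> X}" for X
    unfolding e by (rule bij_betw_same_card[of ?\<tau>], rule bij_betw_byWitness[of _ ?\<tau>]) (auto split: if_splits)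
  have "finite_state s'" using assms by (simp add: s'_def finite_state_upd valid_def)
  then have "valid m n s'" using assms unfolding valid_def c by blast
  then show ?thesis by (simp add: s'_def)
qed

lemma valid_create:
  fixes a :: int
  assumes "valid m n s" "s a = Rgt" "s (a + 1) = Lft"
  shows "valid m n (s(a := Cross, a + 1 := Circ))"
proof -
  let ?s = "s(a := Cross, a + 1 := Circ)"
  have f: "finite {v. s v \<in> {Lft, Cross}}"
    using assms unfolding valid_def finite_state_def by (auto elim!: finite_subset[rotated])
  have 1: "{v. ?s v \<in> {Lft, Cross}} = insert a ({v. s v \<in> {Lft, Cross}} - {a + 1})"
    "{v. ?s v \<in> {Rgt, Cross}} = {v. s v \<in> {Rgt, Cross}}"
    using assms by auto
  have "card {v. ?s v \<in> {Lft, Cross}} = m"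
    unfolding 1 using f assms card_Suc_Diff1[OF f, of "a + 1"] by (simp add: valid_def)
  then show ?thesis using assms 1(2) by (simp add: valid_def finite_state_upd)
qed

lemma act_Uvec_eq:
  assumes "valid m n s" "\<And>t. opf x y a (Us s) t = Us s' t"
  shows "x = Cross \<Longrightarrow> y = Circ \<Longrightarrow> Fact m n a (Uvec m n s) = Uvec m n s'"
    "x = Circ \<Longrightarrow> y = Cross \<Longrightarrow> Eact m n a (Uvec m n s) = Uvec m n s'"
proof -
  have v: "is_vec m n (Uvec m n s)" using assms(1) by (simp add: valid_def)
  show "x = Cross \<Longrightarrow> y = Circ \<Longrightarrow> Fact m n a (Uvec m n s) = Uvec m n s'"
    "x = Circ \<Longrightarrow> y = Cross \<Longrightarrow> Eact m n a (Uvec m n s) = Uvec m n s'"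
    using assms(2) by (auto simp: fun_eq_iff act_apply[OF v] hat_Uvec[OF assms(1)] Uvec_apply)
qed

text \<open>An innermost arc is shortened by moving its left end across unlabelled points, until it is
  created by a single operator; so all \<open>Uvec\<close> are obtained from minimal basis vectors.\<close>
lemma bar_inv_fixes_Uvec:
  assumes psi: "is_bar_inv m n \<phi>" and "valid m n s"
  shows "\<phi> (Uvec m n s) = Uvec m n s"
  using assms(2)
proof (induction "card {v. s v = Lft}" arbitrary: s rule: less_induct)
  case less
  have comm: "\<phi> (X (Uvec m n s')) = X (Uvec m n s')"
    if "valid m n s'" "\<phi> (Uvec m n s') = Uvec m n s'" "X = Fact m n a \<or> X = Eact m n a" for X a s'
  proof -
    have "is_vec m n (Uvec m n s')" using that by (simp add: valid_def)
    then show ?thesis using psi that unfolding is_bar_inv_def by metis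
  qed
  have short: "\<phi> (Uvec m n s) = Uvec m n s"
    if "valid m n s" "card {v. s v = Lft} = N" "c < d" "s c = Rgt" "s d = Lft"
      "\<forall>e. c < e \<longrightarrow> e < d \<longrightarrow> \<not> labelled s e"
      and IH: "\<And>s'. card {v. s' v = Lft} < N \<Longrightarrow> valid m n s' \<Longrightarrow> \<phi> (Uvec m n s') = Uvec m n s'"
    for c d s N
    using that(1-6)
  proof (induction "nat (d - c)" arbitrary: c s rule: less_induct)
    case (less c s)
    have fs: "finite_state s" using less.prems by (simp add: valid_def)
    show ?case
    proof (cases "d = c + 1")
      case True
      \<comment> \<open>Removing the arc of length 1 lowers the number of \<open>Lft\<close>, the
        measure of the outer induction; the operator F at \<open>c\<close> creates it again.\<close>
      let ?s = "s(c := Cross, c + 1 := Circ)"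
      have v: "valid m n ?s" using valid_create less.prems True by simp
      have "{v. s v = Lft} = insert (c + 1) {v. ?s v = Lft}" "c + 1 \<notin> {v. ?s v = Lft}"
        using less.prems True by auto
      moreover have "finite {v. ?s v = Lft}"
        using finite_labelled[of ?s] v by (auto simp: valid_def labelled_def elim!: finite_subset[rotated])
      ultimately have "card {v. ?s v = Lft} < N" using less.prems(2) by simp
      then have fx: "\<phi> (Uvec m n ?s) = Uvec m n ?s" using IH v by blast
      have "?s(c := Rgt, c + 1 := Lft) = s" using less.prems True by (auto simp: fun_eq_iff)
      then have "Fact m n c (Uvec m n ?s) = Uvec m n s"
        using opf_create[of ?s Cross Circ c] v act_Uvec_eq(1)[OF v, of Cross Circ c s]
        by (simp add: valid_def opposite_def)
      then show ?thesis using comm[OF v fx, of "Fact m n c" c] by simp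
    next
      case False
      then have cd: "c + 1 < d" using less.prems by simp
      define x where "x = s (c + 1)"
      have x: "x = Cross \<or> x = Circ"
        using less.prems(6) cd unfolding x_def by (cases "s (c + 1)") (auto simp: labelled_def)
      let ?s = "s(c := x, c + 1 := Rgt)"
      have eq: "?s = s(c := s (c + 1), c + 1 := s c)" using less.prems by (simp add: x_def)
      have v: "valid m n ?s" unfolding eq by (rule valid_swap_adjacent[OF less.prems(1)])
      have "{v. ?s v = Lft} = {v. s v = Lft}" using x less.prems(4) by (auto simp: x_def)
      then have "card {v. ?s v = Lft} = N" using less.prems by simp
      moreover have "\<forall>e. c + 1 < e \<longrightarrow> e < d \<longrightarrow> \<not> labelled ?s e"
        using less.prems(6) by (auto simp: labelled_def)
      ultimately have fx: "\<phi> (Uvec m n ?s) = Uvec m n ?s"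
        using less.hyps[of "c + 1" ?s] v cd less.prems by simp
      have restore: "?s(c := ?s (c + 1), c + 1 := ?s c) = s"
        using less.prems by (auto simp: x_def fun_eq_iff)
      \<comment> \<open>The unlabelled neighbour decides the operator: F moves \<open>Rgt\<close> to
        the left across \<open>Cross\<close>, E across \<open>Circ\<close>.\<close>
      have "Fact m n c (Uvec m n ?s) = Uvec m n s \<or> Eact m n c (Uvec m n ?s) = Uvec m n s"
        using x opf_move[of ?s Cross Circ c] opf_move[of ?s Circ Cross c] v restore
          act_Uvec_eq(1)[OF v, of Cross Circ c s] act_Uvec_eq(2)[OF v, of Circ Cross c s]
        by (auto simp: valid_def opposite_def labelled_def)
      then show ?thesis using comm[OF v fx, of "Fact m n c" c] comm[OF v fx, of "Eact m n c" c] by auto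
    qed
  qed
  show ?case
  proof (cases "\<exists>k c d. c < d \<and> s c = Rgt \<and> s d = Lft \<and> k = nat (d - c)")
    case True
    \<comment> \<open>For a pair \<open>Rgt\<close>, \<open>Lft\<close> at least distance, any
      labelled point in between would form a closer pair with one of the two ends.\<close>
    define k where "k = (LEAST k. \<exists>c d. c < d \<and> s c = Rgt \<and> s d = Lft \<and> k = nat (d - c))"
    obtain c d where cd: "c < d" "s c = Rgt" "s d = Lft" "k = nat (d - c)"
      using LeastI_ex[OF True] unfolding k_def by blast
    have least: "k \<le> nat (d' - c')" if "c' < d'" "s c' = Rgt" "s d' = Lft" for c' d'
      unfolding k_def using that by (intro Least_le) blast
    have "\<not> labelled s e" if "c < e" "e < d" for e
      using least[of e d] least[of c e] cd that by (auto simp: labelled_def)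
    then show ?thesis using short[of s _ c d] cd less by blast
  next
    case False
    obtain f where f: "f \<in> Zplus m n" "st m n f = s" using valid_exists[OF less.prems] by blast
    have no: "c < d \<Longrightarrow> st m n f c = Rgt \<Longrightarrow> st m n f d = Lft \<Longrightarrow> False" for c d using False f(2) by blast
    have "bruhat_minimal m n f" by (rule bruhat_minimalI[OF f(1) no])
    then have "\<phi> (basisK f) = basisK f" using psi by (simp add: is_bar_inv_def)
    then show ?thesis using Uvec_eq_basisK[OF f(1) no] f(2) by simp
  qed
qed

lemma bar_inv_eq_psi: "bar_inv m n = psi m n"
  unfolding bar_inv_def
proof (rule the_equality[where P = "is_bar_inv m n", OF is_bar_inv_psi])
  fix \<phi> assume phi: "is_bar_inv m n \<phi>"
  show "\<phi> = psi m n"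
  proof
    fix u
    show "\<phi> u = psi m n u"
    proof (cases "is_vec m n u")
      case True
      show ?thesis
      proof (rule vec_span[where P = "\<lambda>u. \<phi> u = psi m n u", OF _ _ _ _ True])
        have "\<phi> (scal 0 0) = scal 0 (\<phi> 0)" using phi unfolding is_bar_inv_def by (metis is_vec_0 bar_q_0)
        then show "\<phi> 0 = psi m n 0" by (simp add: scal_def psi_def lin_ext_def zero_fun_def)
        show "\<phi> (Uvec m n (st m n f)) = psi m n (Uvec m n (st m n f))" if "f \<in> Zplus m n" for f
          using bar_inv_fixes_Uvec[OF phi valid_st[OF Zplus_inj[OF that]]] psi_Uvec[OF that] by simp
      qed (use phi in \<open>simp_all add: is_bar_inv_def psi_add psi_scal\<close>)
    qed (use phi in \<open>simp add: is_bar_inv_def psi_def\<close>)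
  qed
qed

text \<open>At a point of the support with maximal \<open>mu\<close> only the diagonal coefficient
  of the bar map contributes. The coefficient of \<open>w\<close> there is thus bar-invariant, and
  \<open>bar_invariant_qZq\<close> makes it vanish.\<close>

lemma psi_fixed_qZq:
  assumes w: "is_vec m n w" "psi m n w = w" "\<And>g. qZq (w g)"
  shows "w = 0"
proof (rule ccontr)
  assume "w \<noteq> 0"
  let ?S = "{g. w g \<noteq> 0}"
  have fin: "finite ?S" using is_vec_supp(1)[OF w(1)] .
  have ne: "?S \<noteq> {}" using \<open>w \<noteq> 0\<close> by (auto simp: fun_eq_iff)
  obtain g where g: "g \<in> ?S" "\<And>h. h \<in> ?S \<Longrightarrow> mu m n h \<le> mu m n g"
  proof -
    have "Max (mu m n ` ?S) \<in> mu m n ` ?S" using fin ne by (intro Max_in) auto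
    then obtain g where g: "g \<in> ?S" "Max (mu m n ` ?S) = mu m n g" by blast
    have "mu m n h \<le> mu m n g" if "h \<in> ?S" for h
      unfolding g(2)[symmetric] using fin that by (intro Max_ge) auto
    then show thesis using that g(1) by blast
  qed
  have "w g = (\<Sum>h\<in>?S. bar_q (w h) * barK m n h g)"
    using w(1) fun_cong[OF w(2), of g] by (simp add: psi_def lin_ext_def)
  also have "\<dots> = (\<Sum>h\<in>?S. if h = g then bar_q (w g) else 0)"
  proof (rule sum.cong[OF refl])
    fix h assume h: "h \<in> ?S"
    have bp: "barK m n h h = 1" "barK m n h g \<noteq> 0 \<Longrightarrow> g = h \<or> bless m n g h"
      using barK_properties[OF is_vec_supp(2)[OF w(1), of h]] h by auto
    have "barK m n h g = 0" if "h \<noteq> g" using bp(2) bless_mu[of m n g h] g(2)[OF h] that by force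
    then show "bar_q (w h) * barK m n h g = (if h = g then bar_q (w g) else 0)" using bp(1) by auto
  qed
  also have "\<dots> = bar_q (w g)" using g(1) fin by simp
  finally show False using bar_invariant_qZq[OF w(3)[of g]] g(1) by simp
qed

text \<open>Two candidates differ by an invariant vector with all coefficients in q Z[q], as the
  leading coefficients at \<open>f\<close> cancel.\<close>

lemma Ucan_eq_Uvec:
  assumes f: "f \<in> Zplus m n"
  shows "Ucan m n f = Uvec m n (st m n f)"
  unfolding Ucan_def bar_inv_eq_psi
proof (rule the_equality)
  let ?u = "Uvec m n (st m n f)"
  have "qZq (?u g)" if "g \<noteq> f" for g
    using Uvec_bless(3)[OF f _ that] qZq_qq_power by (cases "?u g = 0") auto
  then show U: "is_vec m n ?u \<and> psi m n ?u = ?u \<and> ?u f = 1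
      \<and> (\<forall>g. g \<noteq> f \<longrightarrow> qZq (?u g) \<and> (?u g \<noteq> 0 \<longrightarrow> bless m n g f))"
    using psi_Uvec[OF f] Uvec_self[OF f] Uvec_bless(2)[OF f] by simp
  fix u assume u: "is_vec m n u \<and> psi m n u = u \<and> u f = 1
      \<and> (\<forall>g. g \<noteq> f \<longrightarrow> qZq (u g) \<and> (u g \<noteq> 0 \<longrightarrow> bless m n g f))"
  define w where "w = u + scal (- 1) ?u"
  have wg: "w g = u g - ?u g" for g by (simp add: w_def scal_def)
  have m1: "bar_q (- 1) = - 1" by (simp add: bar_q_uminus)
  have "w = 0"
  proof (rule psi_fixed_qZq)
    show "is_vec m n w" using u U by (simp add: w_def is_vec_add is_vec_scal)
    show "psi m n w = w" using u U by (simp add: w_def psi_add psi_scal is_vec_scal m1)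
    show "qZq (w g)" for g
      unfolding wg using u U by (cases "g = f") (auto intro: qZq_diff)
  qed
  then show "u = ?u" using wg by (auto simp: fun_eq_iff)
qed

section \<open>The operators \<open>L\<^sub>i\<close>\<close>

text \<open>Connects the choice by increasing distance in \<Sigma> with the matching. Labels outside
  the interval from \<open>c\<close> to \<open>d\<close> are erased; by completeness one of the two
  ends is matched within it, and the hypotheses leave only the other end as its partner.\<close>

lemma greedy_arc:
  assumes "c < d" "s c = Rgt" "s d = Lft"
    and "\<And>w. arc s c w \<Longrightarrow> d \<le> w" "\<And>w. arc s w d \<Longrightarrow> w \<le> c"
  shows "arc s c d"
proof -
  define s' where "s' v = (if c \<le> v \<and> v \<le> d then s v else Circ)" for v
  have in_range: "c \<le> v \<and> v \<le> d" if "s' v = Lft \<or> s' v = Rgt" for v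
    using that by (auto simp: s'_def split: if_splits)
  have loc: "arc s v w" if "arc s' v w" for v w
    using arc_local[OF that, of s] in_range[of v] in_range[of w] arcD[OF that] by (auto simp: s'_def)
  have "s' c = Rgt" "s' d = Lft" using assms by (auto simp: s'_def)
  then have "matched s' c \<or> matched s' d" using unmatched_Rgt_Lft[of s' c d] assms(1) by blast
  then show ?thesis
  proof
    assume "matched s' c"
    then obtain w where w: "arc s' c w"
      using \<open>s' c = Rgt\<close> by (auto simp: matched_def partner_def dest: arcD)
    then have "w = d" using assms(4)[OF loc[OF w]] in_range[of w] arcD(3)[OF w] by auto
    then show ?thesis using loc[OF w] by simp
  next
    assume "matched s' d"
    then obtain w where w: "arc s' w d"
      using \<open>s' d = Lft\<close> by (auto simp: matched_def partner_def dest: arcD)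
    then have "w = c" using assms(5)[OF loc[OF w]] in_range[of w] arcD(2)[OF w] by auto
    then show ?thesis using loc[OF w] by simp
  qed
qed

definition injZ :: "nat \<Rightarrow> nat \<Rightarrow> (int \<Rightarrow> int) \<Rightarrow> bool" where
  "injZ m n g \<longleftrightarrow> inj_on g (negpos m) \<and> inj_on g (pospos n)"

lemma st_Lft_iff: "st m n g v = Lft \<longleftrightarrow> v \<in> g ` negpos m \<and> v \<notin> g ` pospos n"
  and st_Rgt_iff: "st m n g v = Rgt \<longleftrightarrow> v \<in> g ` pospos n \<and> v \<notin> g ` negpos m"
  by (auto simp: st_def)

text \<open>By \<open>greedy_arc\<close>, a pair sharing no entry with closer pairs is an arc;
  conversely distinct arcs share no end. Injectivity is assumed instead of sortedness because the
  operators leave \<open>Zplus\<close>.\<close>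

lemma sigma_upto_iff:
  assumes "injZ m n g"
  shows "(i, j) \<in> sigma_upto m n g k \<longleftrightarrow>
    i \<in> negpos m \<and> j \<in> pospos n \<and> arc (st m n g) (g j) (g i) \<and> g i - g j \<le> int k"
proof (induction k arbitrary: i j)
  case 0
  then show ?case using arcD(1)[of "st m n g" "g j" "g i"] by auto
next
  case (Suc k)
  let ?s = "st m n g"
  have new: "atyp m n g i j \<and> (\<forall>(i', j')\<in>sigma_upto m n g k. i' \<noteq> i \<and> j' \<noteq> j)
      \<longleftrightarrow> i \<in> negpos m \<and> j \<in> pospos n \<and> arc ?s (g j) (g i)" if d: "g i - g j = int (Suc k)"
  proof
    assume h: "atyp m n g i j \<and> (\<forall>(i', j')\<in>sigma_upto m n g k. i' \<noteq> i \<and> j' \<noteq> j)"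
    then have ij: "i \<in> negpos m" "j \<in> pospos n" "g j < g i" "?s (g i) = Lft" "?s (g j) = Rgt"
      by (auto simp: atyp_def st_Lft_iff st_Rgt_iff)
    have ns: "\<not> (i', j') \<in> sigma_upto m n g k" if "i' = i \<or> j' = j" for i' j' using h that by blast
    have "arc ?s (g j) (g i)"
    proof (rule greedy_arc[OF ij(3,5,4)])
      fix w assume w: "arc ?s (g j) w"
      then obtain i' where i': "i' \<in> negpos m" "w = g i'" using arcD(3)[OF w] by (auto simp: st_Lft_iff)
      have "\<not> g i' - g j \<le> int k" using ns[of i' j] Suc.IH[of i' j] i' ij w by blast
      then show "g i \<le> w" using i' d by simp
    next
      fix w assume w: "arc ?s w (g i)"
      then obtain j' where j': "j' \<in> pospos n" "w = g j'" using arcD(2)[OF w] by (auto simp: st_Rgt_iff)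
      have "\<not> g i - g j' \<le> int k" using ns[of i j'] Suc.IH[of i j'] j' ij w by blast
      then show "w \<le> g j" using j' d by simp
    qed
    then show "i \<in> negpos m \<and> j \<in> pospos n \<and> arc ?s (g j) (g i)" using ij by blast
  next
    assume h: "i \<in> negpos m \<and> j \<in> pospos n \<and> arc ?s (g j) (g i)"
    then have arc: "arc ?s (g j) (g i)" by blast
    have "atyp m n g i j" using h arcD[OF arc] by (auto simp: atyp_def st_Lft_iff st_Rgt_iff)
    moreover have "i' \<noteq> i \<and> j' \<noteq> j" if "(i', j') \<in> sigma_upto m n g k" for i' j'
    proof -
      have s: "arc ?s (g j') (g i')" "g i' - g j' \<le> int k" using that Suc.IH by auto
      have "g j' = g j" if "i' = i" using arc_unique_left[OF s(1)] arc that by blast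
      moreover have "g i' = g i" if "j' = j" using arc_unique_right[OF s(1)] arc that by blast
      ultimately show ?thesis using s(2) d by auto
    qed
    ultimately show "atyp m n g i j \<and> (\<forall>(i', j')\<in>sigma_upto m n g k. i' \<noteq> i \<and> j' \<noteq> j)" by blast
  qed
  have "(i, j) \<in> sigma_upto m n g (Suc k) \<longleftrightarrow> (i, j) \<in> sigma_upto m n g k \<or>
      (g i - g j = int (Suc k) \<and> atyp m n g i j \<and> (\<forall>(i', j')\<in>sigma_upto m n g k. i' \<noteq> i \<and> j' \<noteq> j))"
    by auto
  also have "\<dots> \<longleftrightarrow> i \<in> negpos m \<and> j \<in> pospos n \<and> arc ?s (g j) (g i) \<and> (g i - g j \<le> int k \<or> g i - g j = int (Suc k))"
    unfolding Suc.IH[of i j] using new by blast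
  also have "g i - g j \<le> int k \<or> g i - g j = int (Suc k) \<longleftrightarrow> g i - g j \<le> int (Suc k)" by auto
  finally show ?case .
qed

lemma sigma_plus_iff:
  assumes "injZ m n g"
  shows "(i, j) \<in> sigma_plus m n g \<longleftrightarrow> i \<in> negpos m \<and> j \<in> pospos n \<and> arc (st m n g) (g j) (g i)"
proof -
  have "g i - g j \<le> int (nat (g i - g j))" by simp
  then show ?thesis unfolding sigma_plus_def UN_iff sigma_upto_iff[OF assms] by blast
qed

lemma Lop_None: "injZ m n g \<Longrightarrow> (\<And>w. \<not> arc (st m n g) w (g i)) \<Longrightarrow> Lop m n i (Some g) = None"
  by (simp add: Lop_def sigma_plus_iff)

lemma Lop_Some:
  assumes g: "injZ m n g" and i: "i \<in> negpos m" and arc: "arc (st m n g) c (g i)"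
  obtains g' where "Lop m n i (Some g) = Some g'" "injZ m n g'" "g' i = c"
    "\<And>k. k \<in> negpos m \<Longrightarrow> k \<noteq> i \<Longrightarrow> g' k = g k"
    "st m n g' = (st m n g)(c := Lft, g i := Rgt)"
proof -
  have lab: "c < g i" "c \<in> g ` pospos n" "c \<notin> g ` negpos m" "g i \<notin> g ` pospos n"
    using arcD[OF arc] by (simp_all add: st_Lft_iff st_Rgt_iff)
  then obtain j where j: "j \<in> pospos n" "g j = c" by auto
  have u: "j' = j" if "(i, j') \<in> sigma_plus m n g" for j'
  proof -
    have h: "j' \<in> pospos n" "arc (st m n g) (g j') (g i)" using that sigma_plus_iff[OF g] by auto
    have "g j' = g j" using arc_unique_left[OF h(2) arc] j by simp
    then show ?thesis using g h(1) j(1) by (auto simp: injZ_def inj_on_def)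
  qed
  have ij: "(i, j) \<in> sigma_plus m n g" using sigma_plus_iff[OF g] i j arc by simp
  have "(THE j. (i, j) \<in> sigma_plus m n g) = j" using ij u by blast
  moreover define g' where "g' = g(i := g j, j := g i)"
  ultimately have 1: "Lop m n i (Some g) = Some g'" using ij by (auto simp: Lop_def Let_def)
  have ne: "i \<noteq> j" using i j by auto
  have neg: "g' k = (if k = i then c else g k)" if "k \<in> negpos m" for k
    using that j ne by (auto simp: g'_def)
  have pos: "g' k = (if k = j then g i else g k)" if "k \<in> pospos n" for k
    using that i ne by (auto simp: g'_def)
  have gi: "inj_on g (negpos m)" "inj_on g (pospos n)" using g by (auto simp: injZ_def)
  have img: "g' ` negpos m = g(i := c) ` negpos m" "g' ` pospos n = g(j := g i) ` pospos n"
    using neg pos by (auto intro!: image_cong)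
  have "inj_on g' (negpos m) \<longleftrightarrow> inj_on (g(i := c)) (negpos m)"
    "inj_on g' (pospos n) \<longleftrightarrow> inj_on (g(j := g i)) (pospos n)"
    using neg pos by (auto intro!: inj_on_cong)
  then have "injZ m n g'"
    unfolding injZ_def using gi lab(3,4) by (simp add: inj_on_fun_updI)
  moreover have "st m n g' = (st m n g)(c := Lft, g i := Rgt)"
  proof -
    have "g i \<in> g ` negpos m" using i by blast
    then show ?thesis
      unfolding fun_eq_iff st_def img image_fun_upd_inj[OF gi(1) i] image_fun_upd_inj[OF gi(2) j(1)] j(2)
      using lab by auto
  qed
  ultimately show thesis using that[OF 1] neg i by auto
qed

section \<open>Expansion of the arcs position by position\<close>

definition arcsJ :: "(int \<Rightarrow> label) \<Rightarrow> int set \<Rightarrow> (int \<times> int) set" where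
  "arcsJ s J = {z \<in> arcs s. snd z \<in> J}"

text \<open>The last condition on \<open>e\<close> excludes, beyond \<open>d\<close>, an unmatched
  \<open>Lft\<close> and the closing end of an arc over \<open>c\<close> and \<open>d\<close>: the
  new \<open>Rgt\<close> at \<open>d\<close> could catch these. Every other arc avoids both changed
  points, so \<open>arc_local\<close> applies. The second conclusion carries the condition from
  \<open>d\<close> over to \<open>c\<close>.\<close>

lemma arc_after_exchange:
  assumes arc: "arc s c d" and e: "e \<noteq> c" "e \<noteq> d" "e < d \<or> s e \<noteq> Lft \<or> (\<exists>w>d. arc s w e)"
  shows "arc (s(c := Lft, d := Rgt)) w e \<longleftrightarrow> arc s w e"
    and "c < e \<Longrightarrow> s e = Lft \<Longrightarrow> \<exists>w>c. arc (s(c := Lft, d := Rgt)) w e"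
proof -
  let ?s = "s(c := Lft, d := Rgt)"
  have cd: "c < d" "s c = Rgt" "s d = Lft" using arcD[OF arc] by auto
  have inner: "\<exists>w>c. arc s w e \<and> arc ?s w e" if le: "c < e" "s e = Lft"
  proof (cases "e < d")
    case True
    then obtain w where w: "c < w" "w < d" "partner s e w"
      using arc_inside[OF arc le(1) True] le(2) by auto
    then have a: "arc s w e" using le(2) by (auto simp: partner_def dest: arcD)
    have "arc ?s w e" by (rule arc_local[OF a]) (use w True in auto)
    then show ?thesis using a w by blast
  next
    case False
    then obtain w where w: "d < w" "arc s w e" using e le(2) by auto
    have "arc ?s w e" by (rule arc_local[OF w(2)]) (use w(1) cd in auto)
    then show ?thesis using w cd by (intro exI[of _ w]) auto
  qed
  then show "c < e \<Longrightarrow> s e = Lft \<Longrightarrow> \<exists>w>c. arc ?s w e" by blast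
  show "arc ?s w e \<longleftrightarrow> arc s w e"
  proof (cases "s e = Lft")
    case False
    then show ?thesis using e(1,2) arcD(3)[of s w e] arcD(3)[of ?s w e] by auto
  next
    case l: True
    show ?thesis
    proof (cases "c < e")
      case True
      then show ?thesis using inner l arc_unique_left by metis
    next
      case False
      then have "e < c" using e by simp
      then have "arc s w e \<Longrightarrow> arc ?s w e" "arc ?s w e \<Longrightarrow> arc s w e"
        using cd arcD(1) by (auto intro!: arc_local[of s w e ?s] arc_local[of ?s w e s])
      then show ?thesis by blast
    qed
  qed
qed

text \<open>Splits the expansion by the choice made at the arc ending at \<open>d\<close>. The
  exchanged terms form an expansion of the exchanged state, since \<open>same\<close> leaves it the
  same arcs ending in \<open>J\<close>.\<close>

lemma uM_exchange:
  assumes "finite_state s" "arc s c d" "d \<notin> J"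
    and same: "\<And>e w. e \<in> J \<Longrightarrow> arc (s(c := Lft, d := Rgt)) w e \<longleftrightarrow> arc s w e"
  shows "uM (arcsJ s (insert d J)) s t
    = uM (arcsJ s J) s t + qq * uM (arcsJ (s(c := Lft, d := Rgt)) J) (s(c := Lft, d := Rgt)) t"
proof -
  let ?M = "arcsJ s J"
  have fin: "finite ?M" using finite_arcs[OF assms(1)] by (simp add: arcsJ_def)
  have ins: "arcsJ s (insert d J) = insert (c, d) ?M"
    using assms(2) by (auto simp: arcsJ_def dest: arc_unique_left[OF _ assms(2)])
  have M': "arcsJ (s(c := Lft, d := Rgt)) J = ?M" using same by (auto simp: arcsJ_def)
  have E: "c \<notin> ends ?M" "d \<notin> ends ?M"
    using arc_ends_disjoint[OF assms(2), of ?M] assms(3) by (auto simp: arcsJ_def)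
  have cd: "c \<noteq> d" "s c = Rgt" "s d = Lft" using arcD[OF assms(2)] by auto
  let ?A = "agree (insert c (insert d (ends ?M))) s t"
  have peel: "agree E s t \<longleftrightarrow> t v = s v \<and> agree (insert v E) s t" if "v \<notin> E" for v E
    using agree_upd(4)[OF that, of s "s v" t] by simp
  have "agree (ends ?M) s t \<longleftrightarrow> t c = Rgt \<and> t d = Lft \<and> ?A"
    using peel[OF E(1)] peel[of d "insert c (ends ?M)"] E(2) cd by (simp add: insert_commute)
  moreover have "agree (ends ?M) (s(c := Lft, d := Rgt)) t \<longleftrightarrow> t c = Lft \<and> t d = Rgt \<and> ?A"
    using E cd(1) by (auto simp: agree_upd(4) insert_commute)
  ultimately show ?thesis
    unfolding uM_def M' ins ends_insert arcprod_insert[OF fin E(1)]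
    by (cases "t c"; cases "t d") simp_all
qed

text \<open>What \<open>arc_after_exchange\<close> requires of the later positions, with
  \<open>g a\<close> as the right end \<open>d\<close>. It follows from decreasing values but,
  unlike these, survives repeated use of the operator at \<open>a\<close>.\<close>

definition Cnd :: "nat \<Rightarrow> nat \<Rightarrow> (int \<Rightarrow> int) \<Rightarrow> int \<Rightarrow> bool" where
  "Cnd m n g a \<longleftrightarrow> (\<forall>k\<in>negpos m. a < k \<longrightarrow> 
    g k < g a \<or> st m n g (g k) \<noteq> Lft \<or> (\<exists>w>g a. arc (st m n g) w (g k)))"

text \<open>Interpolates between the basis vector of \<open>g\<close> (for \<open>a = 0\<close>) and the canonical basis vector
  (for \<open>a = - m\<close>): only the arcs ending at the values of the positions \<open>\<ge> a\<close> are expanded.\<close>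
definition Wvec :: "nat \<Rightarrow> nat \<Rightarrow> int \<Rightarrow> (int \<Rightarrow> int) \<Rightarrow> vecE" where
  "Wvec m n a g = (\<lambda>h. if h \<in> Zplus m n
     then uM (arcsJ (st m n g) (g ` {k \<in> negpos m. a \<le> k})) (st m n g) (st m n h) else 0)"

lemma Wvec_0:
  assumes "injZ m n g"
  shows "Wvec m n 0 g = basisK (sortZ m n (st m n g))"
proof
  fix h
  have v: "valid m n (st m n g)" using assms valid_st by (auto simp: injZ_def)
  have e: "{k \<in> negpos m. 0 \<le> k} = {}" by (auto simp: negpos_def)
  have "h = sortZ m n (st m n g) \<longleftrightarrow> h \<in> Zplus m n \<and> st m n h = st m n g"
    using sortZ[OF v] sortZ_st[of h m n] by metis
  moreover have "agree {} s t \<longleftrightarrow> t = s" for s t by (auto simp: agree_def)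
  ultimately show "Wvec m n 0 g h = basisK (sortZ m n (st m n g)) h"
    unfolding Wvec_def e by (auto simp: uM_def arcsJ_def arcprod_def basisK_def)
qed

lemma Wvec_all: "Wvec m n (- int m) g = Uvec m n (st m n g)"
proof -
  have "{k \<in> negpos m. - int m \<le> k} = negpos m" by (auto simp: negpos_def)
  moreover have "arcsJ (st m n g) (g ` negpos m) = arcs (st m n g)"
    by (auto simp: arcsJ_def st_Lft_iff dest!: arcD(3))
  ultimately show ?thesis unfolding Wvec_def Uvec_def Us_def by (simp only:)
qed

text \<open>In the second case, the value at \<open>a\<close> drops to another labelled point while
  the set of labelled points stays the same: this is the measure that bounds repetition at
  \<open>a\<close>. \<open>Cnd\<close> for \<open>g'\<close> permits the next repetition.\<close>

lemma Wvec_step: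
  assumes g: "injZ m n g" and a: "a \<in> negpos m" and C: "Cnd m n g a"
  obtains "Lop m n a (Some g) = None" "Wvec m n a g = Wvec m n (a + 1) g"
  | g' where "Lop m n a (Some g) = Some g'" "injZ m n g'" "Cnd m n g' a" "g' a < g a"
      "labelled (st m n g) (g' a)" "\<And>v. labelled (st m n g') v = labelled (st m n g) v"
      "\<And>k. k \<in> negpos m \<Longrightarrow> k \<noteq> a \<Longrightarrow> g' k = g k"
      "Wvec m n a g = Wvec m n (a + 1) g + scal qq (Wvec m n (a + 1) g')"
proof -
  let ?s = "st m n g"
  let ?J = "g ` {k \<in> negpos m. a + 1 \<le> k}"
  have "{k \<in> negpos m. a \<le> k} = insert a {k \<in> negpos m. a + 1 \<le> k}" using a by auto
  then have J: "g ` {k \<in> negpos m. a \<le> k} = insert (g a) ?J" by simp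
  have gk: "g k \<noteq> g a" if "k \<in> negpos m" "a + 1 \<le> k" for k
    using g a that by (auto simp: injZ_def inj_on_def)
  show thesis
  proof (cases "\<exists>c. arc ?s c (g a)")
    case False
    then have "arcsJ ?s (insert (g a) ?J) = arcsJ ?s ?J" by (auto simp: arcsJ_def)
    then have "Wvec m n a g = Wvec m n (a + 1) g" unfolding Wvec_def J by (simp only:)
    moreover have "Lop m n a (Some g) = None" using Lop_None[OF g] False by blast
    ultimately show ?thesis by (rule that(1)[rotated])
  next
    case True
    then obtain c where c: "arc ?s c (g a)" by blast
    obtain g' where g': "Lop m n a (Some g) = Some g'" "injZ m n g'" "g' a = c"
      "\<And>k. k \<in> negpos m \<Longrightarrow> k \<noteq> a \<Longrightarrow> g' k = g k" "st m n g' = ?s(c := Lft, g a := Rgt)"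
      using Lop_Some[OF g a c] by blast
    have cl: "c < g a" "?s c = Rgt" "?s (g a) = Lft" using arcD[OF c] by auto
    have cn: "g k \<noteq> c" if "k \<in> negpos m" for k using cl(2) that unfolding st_Rgt_iff by (metis imageI)
    have J': "g' ` {k \<in> negpos m. a + 1 \<le> k} = ?J" using g'(4) by (intro image_cong) auto
    have ex: "arc (st m n g') w (g k) = arc ?s w (g k)" "c < g k \<Longrightarrow> ?s (g k) = Lft \<Longrightarrow> \<exists>w>c. arc (st m n g') w (g k)"
      if k: "k \<in> negpos m" "a + 1 \<le> k" for k w
    proof -
      have "g k < g a \<or> ?s (g k) \<noteq> Lft \<or> (\<exists>w>g a. arc ?s w (g k))" using C k by (simp add: Cnd_def)
      from arc_after_exchange[OF c cn[OF k(1)] gk[OF k] this]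
      show "arc (st m n g') w (g k) = arc ?s w (g k)"
        "c < g k \<Longrightarrow> ?s (g k) = Lft \<Longrightarrow> \<exists>w>c. arc (st m n g') w (g k)"
        unfolding g'(5) by blast+
    qed
    have "uM (arcsJ ?s (insert (g a) ?J)) ?s t
        = uM (arcsJ ?s ?J) ?s t + qq * uM (arcsJ (st m n g') ?J) (st m n g') t" for t
      unfolding g'(5)
    proof (rule uM_exchange[OF finite_state_st c])
      show "g a \<notin> ?J" using gk by fastforce
      show "arc (?s(c := Lft, g a := Rgt)) w e = arc ?s w e" if "e \<in> ?J" for e w
        using that ex(1) unfolding g'(5) by blast
    qed
    then have W: "Wvec m n a g = Wvec m n (a + 1) g + scal qq (Wvec m n (a + 1) g')"
      unfolding Wvec_def J J' by (simp add: fun_eq_iff scal_def)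
    have "Cnd m n g' a"
      unfolding Cnd_def
    proof (intro ballI impI)
      fix k assume k: "k \<in> negpos m" "a < k"
      then have gk': "g' k = g k" using g'(4) by simp
      have st': "st m n g' (g' k) = ?s (g k)"
        unfolding g'(5) gk' using cn[OF k(1)] gk[OF k(1)] k(2) by simp
      show "g' k < g' a \<or> st m n g' (g' k) \<noteq> Lft \<or> (\<exists>w>g' a. arc (st m n g') w (g' k))"
      proof (cases "g k < c \<or> ?s (g k) \<noteq> Lft")
        case True
        then show ?thesis using st' gk' g'(3) by auto
      next
        case False
        then have "c < g k" "?s (g k) = Lft" using cn[OF k(1)] by auto
        then show ?thesis using ex(2)[of k] k gk' g'(3) by auto
      qed
    qed
    moreover have "labelled (st m n g') v = labelled ?s v" for v
      unfolding g'(5) labelled_def using cl by auto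
    ultimately show ?thesis
      using that(2)[OF g'(1,2) _ _ _ _ g'(4) W] g'(3) cl by (simp add: labelled_def)
  qed
qed

section \<open>Summation over the exponents \<theta>\<close>

lemma Lop_funpow_None: "(Lop m n i ^^ k) None = None"
  by (induction k) (simp_all add: Lop_def)

definition Lfold :: "nat \<Rightarrow> nat \<Rightarrow> (int \<Rightarrow> nat) \<Rightarrow> int list \<Rightarrow> (int \<Rightarrow> int) option \<Rightarrow> (int \<Rightarrow> int) option" where
  "Lfold m n \<theta> xs x = fold (\<lambda>i x. (Lop m n i ^^ \<theta> i) x) xs x"

lemma Lfold_None: "Lfold m n \<theta> xs None = None"
  by (induction xs) (simp_all add: Lfold_def Lop_funpow_None)

lemma Lfold_Cons: "Lfold m n \<theta> (i # xs) x = Lfold m n \<theta> xs ((Lop m n i ^^ \<theta> i) x)"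
  by (simp add: Lfold_def)

lemma Lfold_upd: "i \<notin> set xs \<Longrightarrow> Lfold m n (\<theta>(i := k)) xs x = Lfold m n \<theta> xs x"
  unfolding Lfold_def by (rule fold_cong) auto

lemma theta_abs_upd:
  assumes "i \<in> negpos m"
  shows "theta_abs m (\<theta>(i := Suc (\<theta> i))) = Suc (theta_abs m \<theta>)"
  using assms by (simp add: theta_abs_def sum.remove[of _ i])

definition Th01 :: "int set \<Rightarrow> (int \<Rightarrow> nat) set" where
  "Th01 A = {\<theta>. (\<forall>i. i \<notin> A \<longrightarrow> \<theta> i = 0) \<and> (\<forall>i. \<theta> i \<le> 1)}"

lemma Th01_empty: "Th01 {} = {\<lambda>_. 0}"
  by (auto simp: Th01_def)

lemma Th01_insert:
  assumes "i \<notin> A"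
  shows "Th01 (insert i A) = Th01 A \<union> (\<lambda>\<theta>. \<theta>(i := Suc (\<theta> i))) ` Th01 A" (is "?L = ?R")
proof
  show "?L \<subseteq> ?R"
  proof
    fix \<theta> assume t: "\<theta> \<in> ?L"
    show "\<theta> \<in> ?R"
    proof (cases "\<theta> i = 0")
      case True
      have "\<theta> k = 0" if "k \<notin> A" for k using t True that by (cases "k = i") (auto simp: Th01_def)
      then show ?thesis using t by (simp add: Th01_def)
    next
      case False
      moreover have "\<theta> i \<le> 1" using t by (simp add: Th01_def)
      ultimately have "\<theta> i = 1" by simp
      then have "\<theta> = (\<lambda>\<theta>. \<theta>(i := Suc (\<theta> i))) (\<theta>(i := 0))" by (auto simp: fun_eq_iff)
      moreover have "\<theta>(i := 0) \<in> Th01 A" using t by (auto simp: Th01_def)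
      ultimately show ?thesis by blast
    qed
  qed
  show "?R \<subseteq> ?L" using assms by (auto simp: Th01_def)
qed

lemma finite_Th01: "finite A \<Longrightarrow> finite (Th01 A)"
  by (induction A rule: finite_induct) (simp_all add: Th01_empty Th01_insert)

lemma inj_incr: "inj_on (\<lambda>\<theta> :: int \<Rightarrow> nat. \<theta>(i := Suc (\<theta> i))) S"
proof (rule inj_onI)
  fix \<theta> \<theta>' :: "int \<Rightarrow> nat" assume h: "\<theta>(i := Suc (\<theta> i)) = \<theta>'(i := Suc (\<theta>' i))"
  show "\<theta> = \<theta>'"
  proof
    fix k show "\<theta> k = \<theta>' k" using fun_cong[OF h, of k] by (cases "k = i") auto
  qed
qed

lemma scal_sum: "scal c (\<Sum>i\<in>A. F i) = (\<Sum>i\<in>A. scal c (F i))"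
  by (rule ext) (simp add: scal_def sum_fun_app sum_distrib_left)

lemma scal_scal: "scal c (scal d u) = scal (c * d) u"
  by (simp add: scal_def mult.assoc)

lemma scal_0_right [simp]: "scal c 0 = 0"
  by (simp add: scal_def zero_fun_def)

lemma plus_sort_None [simp]: "plus_sort m n None = None"
  by (simp add: plus_sort_def)

lemma Kopt_simps [simp]: "Kopt None = 0" "Kopt (Some f) = basisK f"
  by (simp_all add: Kopt_def)

lemma Uopt_simps [simp]: "Uopt m n None = 0" "Uopt m n (Some f) = Ucan m n f"
  by (simp_all add: Uopt_def)

text \<open>The operator at the lowest position \<open>a\<close> acts first, and \<theta> at
  \<open>a\<close> decides between the two terms of \<open>Wvec_step\<close>. Other negative
  positions keep their values, so those after \<open>a\<close> stay decreasing in both branches, as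
  \<open>Cnd\<close> requires further on.\<close>

lemma sum_Lfold_K:
  assumes "injZ m n g" "- int m \<le> a" "a \<le> 0"
    "\<And>i k. a \<le> i \<Longrightarrow> i < k \<Longrightarrow> k \<le> -1 \<Longrightarrow> g k < g i"
  shows "(\<Sum>\<theta>\<in>Th01 {a..-1}. scal (qq ^ theta_abs m \<theta>) (Kopt (plus_sort m n (Lfold m n \<theta> [a..-1] (Some g)))))
    = Wvec m n a g"
  using assms(3,2,1,4)
proof (induction a arbitrary: g rule: int_le_induct)
  case base
  have "theta_abs m (\<lambda>_. 0) = 0" by (simp add: theta_abs_def)
  then show ?case using base Wvec_0[OF base(2)]
    by (simp add: Th01_empty Lfold_def plus_sort_Some)
next
  case (step b)
  let ?a = "b - 1"
  have a: "?a \<in> negpos m" using step by (auto simp: negpos_def)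
  have set: "{?a..-1} = insert ?a {b..-1}" "?a \<notin> {b..-1}" using step by auto
  have list: "[?a..-1] = ?a # [b..-1]" using step by (simp add: upto_rec1)
  have nin: "?a \<notin> set [b..-1]" by simp
  let ?F = "\<lambda>\<theta> x. Kopt (plus_sort m n (Lfold m n \<theta> [b..-1] x))"
  have disj: "Th01 {b..-1} \<inter> (\<lambda>\<theta>. \<theta>(?a := Suc (\<theta> ?a))) ` Th01 {b..-1} = {}"
    by (auto simp: Th01_def) (metis fun_upd_same nat.distinct(1) set(2) atLeastAtMost_iff)
  have fin: "finite (Th01 {b..-1})" by (rule finite_Th01) simp
  have z: "\<theta> ?a = 0" if "\<theta> \<in> Th01 {b..-1}" for \<theta> using that by (auto simp: Th01_def)
  let ?S = "\<lambda>\<theta>. scal (qq ^ theta_abs m \<theta>) (Kopt (plus_sort m n (Lfold m n \<theta> [?a..-1] (Some g))))"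
  have "(\<Sum>\<theta>\<in>Th01 {?a..-1}. ?S \<theta>) = (\<Sum>\<theta>\<in>Th01 {b..-1}. ?S \<theta>) + (\<Sum>\<theta>\<in>Th01 {b..-1}. ?S (\<theta>(?a := Suc (\<theta> ?a))))"
    unfolding set(1) Th01_insert[OF set(2)]
    by (subst sum.union_disjoint[OF fin finite_imageI[OF fin] disj]) (simp add: sum.reindex[OF inj_incr])
  also have "\<dots> = (\<Sum>\<theta>\<in>Th01 {b..-1}. scal (qq ^ theta_abs m \<theta>) (?F \<theta> (Some g)))
    + scal qq (\<Sum>\<theta>\<in>Th01 {b..-1}. scal (qq ^ theta_abs m \<theta>) (?F \<theta> (Lop m n ?a (Some g))))"
    unfolding list Lfold_Cons Lfold_upd[OF nin] theta_abs_upd[OF a] scal_sum scal_scal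
    by (simp add: z cong: sum.cong)
  finally have rec: "(\<Sum>\<theta>\<in>Th01 {?a..-1}. ?S \<theta>) = (\<Sum>\<theta>\<in>Th01 {b..-1}. scal (qq ^ theta_abs m \<theta>) (?F \<theta> (Some g)))
    + scal qq (\<Sum>\<theta>\<in>Th01 {b..-1}. scal (qq ^ theta_abs m \<theta>) (?F \<theta> (Lop m n ?a (Some g))))" .
  have C: "Cnd m n g ?a" unfolding Cnd_def using step.prems(3) by (auto simp: negpos_def)
  have IH: "(\<Sum>\<theta>\<in>Th01 {b..-1}. scal (qq ^ theta_abs m \<theta>) (?F \<theta> (Some g'))) = Wvec m n b g'"
    if "injZ m n g'" "\<And>k. k \<in> negpos m \<Longrightarrow> k \<noteq> ?a \<Longrightarrow> g' k = g k" for g'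
  proof (rule step.IH)
    show "g' k < g' i" if "b \<le> i" "i < k" "k \<le> -1" for i k
      using step.prems that \<open>\<And>k. k \<in> negpos m \<Longrightarrow> k \<noteq> ?a \<Longrightarrow> g' k = g k\<close>[of i]
        \<open>\<And>k. k \<in> negpos m \<Longrightarrow> k \<noteq> ?a \<Longrightarrow> g' k = g k\<close>[of k] by (auto simp: negpos_def)
  qed (use step.prems that in auto)
  from step.prems(2) a C show ?case
  proof (cases rule: Wvec_step)
    case 1
    then show ?thesis unfolding rec using IH[OF step.prems(2)] by (simp add: Lfold_None)
  next
    case (2 g')
    then show ?thesis unfolding rec 2(1,8) using IH[OF step.prems(2)] IH[OF 2(2)] by simp
  qed
qed

text \<open>Exponents with an empty result are left out, which makes the sum over infinitely many
  exponents a finite one.\<close>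

definition Thfin :: "nat \<Rightarrow> nat \<Rightarrow> int \<Rightarrow> (int \<Rightarrow> int) \<Rightarrow> (int \<Rightarrow> nat) set" where
  "Thfin m n a g = {\<theta>. (\<forall>i. i \<notin> {- int m..a} \<longrightarrow> \<theta> i = 0) \<and> Lfold m n \<theta> (rev [- int m..a]) (Some g) \<noteq> None}"

definition Usum :: "nat \<Rightarrow> nat \<Rightarrow> int \<Rightarrow> (int \<Rightarrow> int) \<Rightarrow> vecE" where
  "Usum m n a g = (\<Sum>\<theta>\<in>Thfin m n a g. scal ((- qq) ^ theta_abs m \<theta>)
     (Uopt m n (plus_sort m n (Lfold m n \<theta> (rev [- int m..a]) (Some g)))))"

text \<open>The operator at \<open>a\<close> is applied first. Lowering a positive exponent at
  \<open>a\<close> by one therefore means starting from the image of \<open>g\<close>, at the cost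
  of one factor -q; exponents vanishing at \<open>a\<close> belong to \<open>a - 1\<close>.\<close>

lemma Usum_step:
  assumes a: "a \<in> negpos m"
  shows "Lop m n a (Some g) = None \<Longrightarrow> Thfin m n a g = Thfin m n (a - 1) g \<and> Usum m n a g = Usum m n (a - 1) g"
    and "Lop m n a (Some g) = Some g' \<Longrightarrow> finite (Thfin m n (a - 1) g) \<Longrightarrow> finite (Thfin m n a g') \<Longrightarrow>
      finite (Thfin m n a g) \<and> Usum m n a g = Usum m n (a - 1) g + scal (- qq) (Usum m n a g')"
proof -
  have le: "- int m \<le> a" "a \<le> -1" using a by (auto simp: negpos_def)
  have list: "rev [- int m..a] = a # rev [- int m..a - 1]" using le by (simp add: upto_rec2)
  have nin: "a \<notin> set (rev [- int m..a - 1])" by simp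
  let ?r = "rev [- int m..a - 1]"
  have zero: "Lfold m n \<theta> (rev [- int m..a]) (Some g) = Lfold m n \<theta> ?r (Some g)" if "\<theta> a = 0" for \<theta>
    unfolding list Lfold_Cons using that by simp
  have suc: "Lfold m n (\<theta>(a := Suc k)) (rev [- int m..a]) (Some g)
      = Lfold m n (\<theta>(a := k)) (rev [- int m..a]) (Lop m n a (Some g))" for \<theta> k
    unfolding list Lfold_Cons Lfold_upd[OF nin] by (simp add: funpow_swap1)
  have split: "Thfin m n a g = Thfin m n (a - 1) g \<union> {\<theta> \<in> Thfin m n a g. \<theta> a \<noteq> 0}"
  proof -
    have "\<theta> \<in> Thfin m n a g \<longleftrightarrow> \<theta> \<in> Thfin m n (a - 1) g" if "\<theta> a = 0" for \<theta>
    proof -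
      have "(\<forall>i. i \<notin> {- int m..a} \<longrightarrow> \<theta> i = 0) \<longleftrightarrow> (\<forall>i. i \<notin> {- int m..a - 1} \<longrightarrow> \<theta> i = 0)"
      proof -
        have "i \<in> {- int m..a} \<longleftrightarrow> i = a \<or> i \<in> {- int m..a - 1}" for i using le by auto
        then show ?thesis using that by metis
      qed
      then show ?thesis using zero[of \<theta>, OF that] by (simp add: Thfin_def)
    qed
    moreover have "\<theta> a = 0" if "\<theta> \<in> Thfin m n (a - 1) g" for \<theta> using that by (auto simp: Thfin_def)
    ultimately show ?thesis by blast
  qed
  have pos: "\<theta> = (\<theta>(a := \<theta> a - 1))(a := Suc ((\<theta>(a := \<theta> a - 1)) a))" if "\<theta> a \<noteq> 0" for \<theta> :: "int \<Rightarrow> nat"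
    using that by auto
  have outside: "(\<forall>i. i \<notin> {- int m..a} \<longrightarrow> (\<theta>(a := k)) i = 0) \<longleftrightarrow> (\<forall>i. i \<notin> {- int m..a} \<longrightarrow> \<theta> i = 0)" for \<theta> k
    using le by auto
  have z: "\<theta> a = 0" if "\<theta> \<in> Thfin m n (a - 1) g" for \<theta> using that by (auto simp: Thfin_def)
  {
    assume N: "Lop m n a (Some g) = None"
    have "{\<theta> \<in> Thfin m n a g. \<theta> a \<noteq> 0} = {}"
    proof -
      have False if t: "\<theta> \<in> Thfin m n a g" "\<theta> a \<noteq> 0" for \<theta>
      proof -
        have "Lfold m n \<theta> (rev [- int m..a]) (Some g) = None"
          by (subst pos[of \<theta>, OF t(2)], subst suc) (simp add: N Lfold_None)
        then show False using t(1) by (simp add: Thfin_def)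
      qed
      then show ?thesis by blast
    qed
    then have T: "Thfin m n a g = Thfin m n (a - 1) g" using split by blast
    moreover have "Usum m n a g = Usum m n (a - 1) g"
      unfolding Usum_def T by (intro sum.cong refl) (simp add: zero z)
    ultimately show "Thfin m n a g = Thfin m n (a - 1) g \<and> Usum m n a g = Usum m n (a - 1) g" ..
  next
    assume S: "Lop m n a (Some g) = Some g'"
      and fin: "finite (Thfin m n (a - 1) g)" "finite (Thfin m n a g')"
    let ?up = "\<lambda>\<theta>. \<theta>(a := Suc (\<theta> a))"
    have up: "Lfold m n (?up \<theta>) (rev [- int m..a]) (Some g) = Lfold m n \<theta> (rev [- int m..a]) (Some g')" for \<theta>
      using suc[of \<theta> "\<theta> a"] S by simp
    have upT: "?up \<theta> \<in> Thfin m n a g \<longleftrightarrow> \<theta> \<in> Thfin m n a g'" for \<theta>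
      unfolding Thfin_def mem_Collect_eq up outside ..
    have "{\<theta> \<in> Thfin m n a g. \<theta> a \<noteq> 0} = ?up ` Thfin m n a g'"
    proof (intro equalityI subsetI)
      fix \<theta> assume t: "\<theta> \<in> {\<theta> \<in> Thfin m n a g. \<theta> a \<noteq> 0}"
      have e: "\<theta> = ?up (\<theta>(a := \<theta> a - 1))" by (rule pos) (use t in simp)
      then have "\<theta>(a := \<theta> a - 1) \<in> Thfin m n a g'" using upT[of "\<theta>(a := \<theta> a - 1)"] t by simp
      then show "\<theta> \<in> ?up ` Thfin m n a g'" using e by blast
    qed (use upT in auto)
    then have T: "Thfin m n a g = Thfin m n (a - 1) g \<union> ?up ` Thfin m n a g'" using split by simp
    have disj: "Thfin m n (a - 1) g \<inter> ?up ` Thfin m n a g' = {}" using z by fastforce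
    have "Usum m n a g = (\<Sum>\<theta>\<in>Thfin m n (a - 1) g. scal ((- qq) ^ theta_abs m \<theta>)
        (Uopt m n (plus_sort m n (Lfold m n \<theta> (rev [- int m..a]) (Some g)))))
      + (\<Sum>\<theta>\<in>Thfin m n a g'. scal ((- qq) ^ theta_abs m (?up \<theta>))
        (Uopt m n (plus_sort m n (Lfold m n (?up \<theta>) (rev [- int m..a]) (Some g)))))"
      unfolding Usum_def T
      by (subst sum.union_disjoint[OF fin(1) finite_imageI[OF fin(2)] disj]) (simp add: sum.reindex[OF inj_incr])
    also have "(\<Sum>\<theta>\<in>Thfin m n (a - 1) g. scal ((- qq) ^ theta_abs m \<theta>)
        (Uopt m n (plus_sort m n (Lfold m n \<theta> (rev [- int m..a]) (Some g))))) = Usum m n (a - 1) g"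
      unfolding Usum_def by (intro sum.cong refl) (simp add: zero z)
    also have "(\<Sum>\<theta>\<in>Thfin m n a g'. scal ((- qq) ^ theta_abs m (?up \<theta>))
        (Uopt m n (plus_sort m n (Lfold m n (?up \<theta>) (rev [- int m..a]) (Some g))))) = scal (- qq) (Usum m n a g')"
      unfolding up theta_abs_upd[OF a] Usum_def scal_sum scal_scal by simp
    finally show "finite (Thfin m n a g) \<and> Usum m n a g = Usum m n (a - 1) g + scal (- qq) (Usum m n a g')"
      using T fin by (simp add: fun_eq_iff)
  }
qed

text \<open>\<open>Wvec_step\<close> is solved for its term at \<open>a + 1\<close>. The remaining
  terms fall under an induction on \<open>a\<close> and, for \<open>g'\<close>, under an inner
  induction on the number of labelled points below \<open>g a\<close>. Decreasing values are assumed
  only from positions before \<open>a\<close>; lowering the value at \<open>a\<close> preserves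
  this.\<close>

lemma Usum_eq_Wvec:
  assumes "- int m - 1 \<le> a" "a \<le> -1" "injZ m n g" "a \<in> negpos m \<Longrightarrow> Cnd m n g a"
    "\<And>i k. i \<in> negpos m \<Longrightarrow> i < a \<Longrightarrow> i < k \<Longrightarrow> k \<in> negpos m \<Longrightarrow> g k < g i"
  shows "finite (Thfin m n a g) \<and> Usum m n a g = Wvec m n (a + 1) g"
  using assms
proof (induction a arbitrary: g rule: int_ge_induct)
  case base
  \<comment> \<open>One step below the lowest position only the zero exponent is left, and all arcs
    are expanded on the other side.\<close>
  have Th: "Thfin m n (- int m - 1) g = {\<lambda>_. 0}" by (auto simp: Thfin_def Lfold_def)
  have v: "valid m n (st m n g)" using base(2) valid_st by (auto simp: injZ_def)
  have "Ucan m n (sortZ m n (st m n g)) = Uvec m n (st m n g)"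
    using Ucan_eq_Uvec[OF sortZ(1)[OF v]] sortZ(2)[OF v] by simp
  then have "Usum m n (- int m - 1) g = Uvec m n (st m n g)"
    unfolding Usum_def Th by (simp add: Lfold_def plus_sort_Some theta_abs_def)
  then show ?case using Th Wvec_all by simp
next
  case (step b)
  define a where "a = b + 1"
  have a: "a \<in> negpos m" "a - 1 = b" using step.hyps step.prems(1) by (auto simp: a_def negpos_def)
  have lower: "finite (Thfin m n b g) \<and> Usum m n b g = Wvec m n a g"
    if "injZ m n g" "\<And>i k. i \<in> negpos m \<Longrightarrow> i < a \<Longrightarrow> i < k \<Longrightarrow> k \<in> negpos m \<Longrightarrow> g k < g i" for g
    unfolding a_def
    by (rule step.IH) (use that step.prems(1) in \<open>auto simp: a_def Cnd_def\<close>)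
  have "finite (Thfin m n a g) \<and> Usum m n a g = Wvec m n (a + 1) g"
    if "injZ m n g" "Cnd m n g a"
      "\<And>i k. i \<in> negpos m \<Longrightarrow> i < a \<Longrightarrow> i < k \<Longrightarrow> k \<in> negpos m \<Longrightarrow> g k < g i" for g
    using that
  proof (induction "card {v. labelled (st m n g) v \<and> v < g a}" arbitrary: g rule: less_induct)
    case less
    note low = lower[OF less.prems(1,3)]
    from less.prems(1) a(1) less.prems(2) show ?case
    proof (cases rule: Wvec_step)
      case 1
      then show ?thesis using Usum_step(1)[OF a(1)] low a(2) by simp
    next
      case g': (2 g')
      have "{v. labelled (st m n g') v \<and> v < g' a} \<subset> {v. labelled (st m n g) v \<and> v < g a}"
        using g'(4,5,6) by auto
      moreover have "finite {v. labelled (st m n g) v \<and> v < g a}"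
        using finite_labelled[OF finite_state_st] by (rule finite_subset[rotated]) auto
      ultimately have "card {v. labelled (st m n g') v \<and> v < g' a} < card {v. labelled (st m n g) v \<and> v < g a}"
        by (rule psubset_card_mono[rotated])
      moreover have "g' k < g' i" if "i \<in> negpos m" "i < a" "i < k" "k \<in> negpos m" for i k
        using less.prems(3)[OF that] g'(4) g'(7)[of i] g'(7)[of k] that by (cases "k = a") auto
      ultimately have IH: "finite (Thfin m n a g') \<and> Usum m n a g' = Wvec m n (a + 1) g'"
        using less.hyps[of g'] g'(2,3) by blast
      have "finite (Thfin m n a g) \<and> Usum m n a g = Usum m n b g + scal (- qq) (Usum m n a g')"
        using Usum_step(2)[OF a(1) g'(1)] low IH a(2) by simp
      then show ?thesis using low IH g'(8) by (auto simp: fun_eq_iff scal_def)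
    qed
  qed
  then show ?case using step.prems a(1) by (simp add: a_def)
qed

theorem theorem4p25:
  fixes m n :: nat and f :: "int \<Rightarrow> int"
  assumes "f \<in> Zplus m n"
  shows "Ucan m n f =
           (\<Sum>\<theta>\<in>Theta01 m. scal (qq ^ theta_abs m \<theta>) (Kopt (Ltheta m n \<theta> f)))
         \<and> finite {\<theta>\<in>Theta m. Ltheta' m n \<theta> f \<noteq> None}
         \<and> basisK f = (\<Sum>\<theta>\<in>{\<theta>\<in>Theta m. Ltheta' m n \<theta> f \<noteq> None}.
                         scal ((- qq) ^ theta_abs m \<theta>) (Uopt m n (Ltheta' m n \<theta> f)))"
proof -
  have inj: "injZ m n f" using Zplus_inj[OF assms] by (simp add: injZ_def)
  have dec: "f k < f i" if "- int m \<le> i" "i < k" "k \<le> -1" for i k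
    using Zplus_neg[OF assms, of i k] that by (simp add: negpos_def)
  have T01: "Theta01 m = Th01 {- int m..-1}" by (auto simp: Theta01_def Theta_def Th01_def negpos_def)
  have "Ucan m n f = Wvec m n (- int m) f" by (simp add: Ucan_eq_Uvec[OF assms] Wvec_all)
  also have "\<dots> = (\<Sum>\<theta>\<in>Theta01 m. scal (qq ^ theta_abs m \<theta>) (Kopt (Ltheta m n \<theta> f)))"
    unfolding T01 Ltheta_def Lfold_def[symmetric] by (rule sum_Lfold_K[symmetric]) (use inj dec in auto)
  finally have 1: "Ucan m n f = (\<Sum>\<theta>\<in>Theta01 m. scal (qq ^ theta_abs m \<theta>) (Kopt (Ltheta m n \<theta> f)))" .
  have "plus_sort m n x \<noteq> None \<longleftrightarrow> x \<noteq> None" for x by (simp add: plus_sort_def split: option.splits)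
  then have T: "{\<theta>\<in>Theta m. Ltheta' m n \<theta> f \<noteq> None} = Thfin m n (-1) f"
    unfolding Ltheta'_def Lfold_def[symmetric] Thfin_def Theta_def negpos_def by blast
  have U: "finite (Thfin m n (-1) f) \<and> Usum m n (-1) f = Wvec m n (-1 + 1) f"
  proof (rule Usum_eq_Wvec)
    show "Cnd m n f (-1)" by (auto simp: Cnd_def negpos_def)
    show "f k < f i" if "i \<in> negpos m" "i < -1" "i < k" "k \<in> negpos m" for i k
      using Zplus_neg[OF assms] that by blast
  qed (use inj in auto)
  have "basisK f = Wvec m n 0 f" using Wvec_0[OF inj] assms by simp
  then have "basisK f = Usum m n (-1) f" using U by simp
  also have "\<dots> = (\<Sum>\<theta>\<in>{\<theta>\<in>Theta m. Ltheta' m n \<theta> f \<noteq> None}.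
                         scal ((- qq) ^ theta_abs m \<theta>) (Uopt m n (Ltheta' m n \<theta> f)))"
    unfolding T Usum_def unfolding Ltheta'_def Lfold_def ..
  finally show ?thesis using 1 U T by simp
qed

end
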